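(* Let $V=\mathbb{C}^3$ and $W=\mathbb{C}^{4\ell+3}$. For each integer $\ell\ge 1$, the prime ideal of the irreducible hypersurface $$\sigma_{3\ell+2}\big(\operatorname{Seg}(\mathbb{P}^2\times\mathbb{G}(1,4\ell+2))\big)\subset\mathbb{P}\big(V\otimes\textstyle\bigwedge^2W\big)=\mathbb{P}^{3\binom{4\ell+3}{2}-1}$$ is generated by the determinant of the $3(4\ell+3)\times3(4\ell+3)$ matrix $\varphi_T\colon V\otimes W^*\to V^*\otimes W$, regarded as a polynomial in the coordinates of $T\in V\otimes\bigwedge^2W$.
   Context: Everything is over $\mathbb{C}$. $\mathbb{G}(k,n)$ is the Grassmannian of $k$-dimensional projective subspaces of $\mathbb{P}^n$. The Segre-Grassmann variety $\operatorname{Seg}(\mathbb{P}^m\times\mathbb{G}(k,n))\subset\mathbb{P}(\mathbb{C}^{m+1}\otimes\bigwedge^{k+1}\mathbb{C}^{n+1})$ is the set of points $[v\otimes(w_0\wedge\cdots\wedge w_k)]$ with $v\neq0$ and $w_0,\dots,w_k$ linearly independent. For a projective variety $X\subset\mathbb{P}^N$ not contained in a hyperplane, $\sigma_r(X)$ is the Zariski closure of the set of points $[p]\in\mathbb{P}^N$ such that $r$ is the minimum number for which $p=\sum_{i=1}^r x_i$ with $[x_i]\in X$. The exterior flattening $\varphi_T$: since $\dim V=3$, $V\cong\bigwedge^2V^*$, so $T\in V\otimes\bigwedge^2W\cong\bigwedge^2V^*\otimes\bigwedge^2W$ induces a linear map $\varphi_T\colon V\otimes W^*\to V^*\otimes W$.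 In coordinates: write $s=4\ell+3$, let $v_1,v_2,v_3$ be a basis of $V$ and $w_1,\dots,w_s$ a basis of $W$, and write $T=\sum_{i=1}^3\sum_{1\le j<k\le s}x_{ijk}\,v_i\otimes(w_j\wedge w_k)$. For $i=1,2,3$ let $X_i$ be the $s\times s$ skew-symmetric matrix whose $(j,k)$ entry is $x_{ijk}$ for $j<k$. Then $\varphi_T$ is the $3s\times3s$ block matrix $$\varphi_T=\begin{pmatrix} 0 & X_1 & -X_2 \\ -X_1 & 0 & X_3 \\ X_2 & -X_3 & 0 \end{pmatrix}.$$ *)

theory Defs
  imports
    Complex_Main
    "HOL-Library.Poly_Mapping"
    "HOL-Algebra.Ideal"
    "Jordan_Normal_Form.Determinant"
    "Jordan_Normal_Form.VS_Connect"
begin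

section \<open>Polynomials over the complex numbers in variables indexed by a set\<close>

text \<open>A monomial is a finitely supported exponent function, a polynomial is a finitely supported
  function from monomials to coefficients; the product is the convolution product of
  \<^theory>\<open>HOL-Library.Poly_Mapping\<close>.\<close>

type_synonym 'v cpoly = "('v \<Rightarrow>\<^sub>0 nat) \<Rightarrow>\<^sub>0 complex"

definition pvar :: "'v \<Rightarrow> 'v cpoly" where
  "pvar v = Poly_Mapping.single (Poly_Mapping.single v 1) 1"

definition peval :: "('v \<Rightarrow> complex) \<Rightarrow> 'v cpoly \<Rightarrow> complex" where
  "peval x f = (\<Sum>m\<in>Poly_Mapping.keys f.
     Poly_Mapping.lookup f m * (\<Prod>v\<in>Poly_Mapping.keys m. x v ^ Poly_Mapping.lookup m v))"

definition poly_ring :: "'v set \<Rightarrow> 'v cpoly ring" where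
  "poly_ring B =
     \<lparr>carrier = {f. \<forall>m\<in>Poly_Mapping.keys f. Poly_Mapping.keys m \<subseteq> B},
      mult = (*), one = 1, zero = 0, add = (+)\<rparr>"

definition homogeneous_of_degree :: "nat \<Rightarrow> 'v cpoly \<Rightarrow> bool" where
  "homogeneous_of_degree d f \<longleftrightarrow>
     (\<forall>m\<in>Poly_Mapping.keys f. (\<Sum>v\<in>Poly_Mapping.keys m. Poly_Mapping.lookup m v) = d)"

definition homogeneous_polys :: "'v set \<Rightarrow> 'v cpoly set" where
  "homogeneous_polys B = {f \<in> carrier (poly_ring B). \<exists>d. homogeneous_of_degree d f}"


section \<open>Projective space with homogeneous coordinates indexed by a set\<close>

text \<open>Vectors of the coordinate space on a finite index set \<open>B\<close> are functions vanishing outside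
  \<open>B\<close>. A point of the projective space is the set of all its nonzero representatives.\<close>

definition coord_space :: "'v set \<Rightarrow> ('v \<Rightarrow> complex) set" where
  "coord_space B = {x. \<forall>v. v \<notin> B \<longrightarrow> x v = 0}"

definition proj_point :: "('v \<Rightarrow> complex) \<Rightarrow> ('v \<Rightarrow> complex) set" where
  "proj_point x = {(\<lambda>v. c * x v) | c. c \<noteq> 0}"

definition proj_space :: "'v set \<Rightarrow> ('v \<Rightarrow> complex) set set" where
  "proj_space B = proj_point ` (coord_space B - {\<lambda>_. 0})"

definition vanishes_at :: "'v cpoly \<Rightarrow> ('v \<Rightarrow> complex) set \<Rightarrow> bool" where
  "vanishes_at f P \<longleftrightarrow> (\<forall>x\<in>P. peval x f = 0)"

definition zero_locus :: "'v set \<Rightarrow> 'v cpoly set \<Rightarrow> ('v \<Rightarrow> complex) set set" where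
  "zero_locus B S = {P \<in> proj_space B. \<forall>f\<in>S. vanishes_at f P}"

definition zariski_closed :: "'v set \<Rightarrow> ('v \<Rightarrow> complex) set set \<Rightarrow> bool" where
  "zariski_closed B Z \<longleftrightarrow> (\<exists>S \<subseteq> homogeneous_polys B. Z = zero_locus B S)"

definition zariski_closure ::
    "'v set \<Rightarrow> ('v \<Rightarrow> complex) set set \<Rightarrow> ('v \<Rightarrow> complex) set set" where
  "zariski_closure B A = zariski_closed B hull A"

definition zariski_irreducible :: "'v set \<Rightarrow> ('v \<Rightarrow> complex) set set \<Rightarrow> bool" where
  "zariski_irreducible B Z \<longleftrightarrow> Z \<noteq> {} \<and>
     (\<forall>Z\<^sub>1 Z\<^sub>2. zariski_closed B Z\<^sub>1 \<and> zariski_closed B Z\<^sub>2 \<and> Z \<subseteq> Z\<^sub>1 \<union> Z\<^sub>2 \<longrightarrow>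
        Z \<subseteq> Z\<^sub>1 \<or> Z \<subseteq> Z\<^sub>2)"

definition hypersurface :: "'v set \<Rightarrow> ('v \<Rightarrow> complex) set set \<Rightarrow> bool" where
  "hypersurface B Z \<longleftrightarrow>
     (\<exists>f \<in> carrier (poly_ring B). \<exists>d>0. f \<noteq> 0 \<and> homogeneous_of_degree d f \<and>
        Z = zero_locus B {f})"

definition homogeneous_ideal ::
    "'v set \<Rightarrow> ('v \<Rightarrow> complex) set set \<Rightarrow> 'v cpoly set" where
  "homogeneous_ideal B Z =
     Idl\<^bsub>poly_ring B\<^esub> {f \<in> homogeneous_polys B. \<forall>P\<in>Z. vanishes_at f P}"


section \<open>Secant varieties\<close>

definition is_sum_of :: "('v \<Rightarrow> complex) set set \<Rightarrow> nat \<Rightarrow> ('v \<Rightarrow> complex) \<Rightarrow> bool" where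
  "is_sum_of X r p \<longleftrightarrow>
     (\<exists>x :: nat \<Rightarrow> 'v \<Rightarrow> complex.
        (\<forall>i<r. proj_point (x i) \<in> X) \<and> p = (\<lambda>v. \<Sum>i<r. x i v))"

definition has_rank :: "('v \<Rightarrow> complex) set set \<Rightarrow> nat \<Rightarrow> ('v \<Rightarrow> complex) \<Rightarrow> bool" where
  "has_rank X r p \<longleftrightarrow> is_sum_of X r p \<and> (\<forall>r'<r. \<not> is_sum_of X r' p)"

definition secant_variety ::
    "'v set \<Rightarrow> nat \<Rightarrow> ('v \<Rightarrow> complex) set set \<Rightarrow> ('v \<Rightarrow> complex) set set" where
  "secant_variety B r X =
     zariski_closure B {proj_point p | p. p \<in> coord_space B - {\<lambda>_. 0} \<and> has_rank X r p}"


section \<open>Segre-Grassmann varieties\<close>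

text \<open>The standard basis of \<open>\<complex>\<^sup>m\<^sup>+\<^sup>1 \<otimes> \<And>\<^sup>k\<^sup>+\<^sup>1 \<complex>\<^sup>n\<^sup>+\<^sup>1\<close>: the index \<open>(i, [j\<^sub>0, \<dots>, j\<^sub>k])\<close> with
  \<open>j\<^sub>0 < \<dots> < j\<^sub>k\<close> stands for the vector \<open>e\<^sub>i \<otimes> (e\<^sub>j\<^sub>0 \<and> \<dots> \<and> e\<^sub>j\<^sub>k)\<close>. All indices start at 0.\<close>

definition segre_grassmann_basis :: "nat \<Rightarrow> nat \<Rightarrow> nat \<Rightarrow> (nat \<times> nat list) set" where
  "segre_grassmann_basis m k n =
     {..m} \<times> {js. length js = k + 1 \<and> sorted_wrt (<) js \<and> set js \<subseteq> {..n}}"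

text \<open>The coordinates of \<open>v \<otimes> (w\<^sub>0 \<and> \<dots> \<and> w\<^sub>k)\<close> in this basis; those of
  \<open>w\<^sub>0 \<and> \<dots> \<and> w\<^sub>k\<close> are the maximal minors of the matrix with rows \<open>w\<^sub>0, \<dots>, w\<^sub>k\<close>.\<close>

definition tensor_wedge ::
    "nat \<Rightarrow> nat \<Rightarrow> nat \<Rightarrow> complex vec \<Rightarrow> complex vec list \<Rightarrow> nat \<times> nat list \<Rightarrow> complex" where
  "tensor_wedge m k n v ws = (\<lambda>(i, js).
     if (i, js) \<in> segre_grassmann_basis m k n
     then v $ i * det (mat (k + 1) (k + 1) (\<lambda>(a, b). (ws ! a) $ (js ! b)))
     else 0)"

text \<open>Linear independence of a family of vectors (not just of its set of values).\<close>

definition lin_indep_family :: "nat \<Rightarrow> complex vec list \<Rightarrow> bool" where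
  "lin_indep_family d ws \<longleftrightarrow> set ws \<subseteq> carrier_vec d \<and> distinct ws \<and>
     \<not> module.lin_dep class_ring (module_vec TYPE(complex) d) (set ws)"

definition segre_grassmann ::
    "nat \<Rightarrow> nat \<Rightarrow> nat \<Rightarrow> (nat \<times> nat list \<Rightarrow> complex) set set" where
  "segre_grassmann m k n =
     {proj_point (tensor_wedge m k n v ws) | v ws.
        v \<in> carrier_vec (m + 1) \<and> v \<noteq> 0\<^sub>v (m + 1) \<and>
        length ws = k + 1 \<and> lin_indep_family (n + 1) ws}"


section \<open>The exterior flattening\<close>

text \<open>The coordinates \<open>x\<close> of \<open>T\<close> may be numbers or polynomial variables; \<open>x (i, [j, k])\<close> is
  the coefficient of \<open>v\<^sub>i \<otimes> (w\<^sub>j \<and> w\<^sub>k)\<close>, and it is only used for \<open>j < k\<close>.\<close>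

definition skew_slice :: "nat \<Rightarrow> (nat \<times> nat list \<Rightarrow> 'a::comm_ring_1) \<Rightarrow> nat \<Rightarrow> 'a mat" where
  "skew_slice s x i = mat s s (\<lambda>(j, k).
     if j < k then x (i, [j, k]) else if k < j then - x (i, [k, j]) else 0)"

definition exterior_flattening :: "nat \<Rightarrow> (nat \<times> nat list \<Rightarrow> 'a::comm_ring_1) \<Rightarrow> 'a mat" where
  "exterior_flattening s x =
     (let X\<^sub>1 = skew_slice s x 0; X\<^sub>2 = skew_slice s x 1; X\<^sub>3 = skew_slice s x 2; N = 0\<^sub>m s s;
          blocks = [[  N,  X\<^sub>1, - X\<^sub>2],
                    [- X\<^sub>1,   N,  X\<^sub>3],
                    [ X\<^sub>2, - X\<^sub>3,   N]]
      in mat (3 * s) (3 * s)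
           (\<lambda>(a, b). (blocks ! (a div s) ! (b div s)) $$ (a mod s, b mod s)))"

end

theory Submission
  imports
    Defs
    "HOL-Library.List_Lexorder"
    "HOL-Library.Product_Lexorder"
    "HOL-Computational_Algebra.Computational_Algebra"
    "HOL-Computational_Algebra.Field_as_Ring"
begin

text \<open>Put \<open>s = 4 * l + 3\<close> and \<open>r = 3 * l + 2\<close>, and let \<open>D\<close> be the determinant of the flattening, a
  form of degree \<open>3 * s\<close>. A term \<open>v \<otimes> (a \<and> b)\<close> flattens to the Kronecker product of the cross
  product matrix of \<open>v\<close> and the skew matrix of \<open>a \<and> b\<close>, both of rank at most 2. A sum of \<open>r\<close> terms
  therefore flattens to a matrix of rank at most \<open>4 * r = 3 * s - 1\<close>, and \<open>D\<close> vanishes on it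
  (\<open>flat_det_rank_le\<close>). The substance of the theorem is the converse: every polynomial that
  vanishes at the tensors of rank exactly \<open>r\<close> is a multiple of \<open>D\<close>. All the assertions on the
  closure, its irreducibility and its ideal follow from this.

  \<^emph>\<open>The tensors of rank at most \<open>r\<close> fill a hypersurface.\<close> At a well chosen \<open>r\<close>-tuple of rank one
  tensors the tangent directions span a subspace of codimension at most 1 (\<open>nondefective_exists\<close>).
  The proof is an induction on \<open>l\<close> that adds four vectors to the basis of \<open>W\<close> and three rank one
  tensors to the tuple; what remains to be killed in the mixed coordinates is an auxiliary linear
  system in \<open>6 * s\<close> unknowns (\<open>gluable\<close>), for which explicit tuples exist for all \<open>l\<close>. Both
  properties of a tuple are Zariski open, so some tuple on the line through a tuple of each kind
  has both. As a consequence, for a suitable direction \<open>b\<close> with \<open>D b \<noteq> 0\<close>, the points \<open>x\<close> for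
  which the line \<open>x + t b\<close> meets the tensors of rank at most \<open>r\<close> are Zariski dense (\<open>dominance\<close>).

  \<^emph>\<open>\<open>D\<close> is irreducible\<close> (\<open>flat_det_irreducible\<close>). The group of diagonal matrices acts on \<open>D\<close> by a
  character, so each factor \<open>P\<close> of \<open>D\<close> is homogeneous for every index of \<open>W\<close> separately, of a
  degree \<open>b j\<close> at most 6. Sparse tensors at which \<open>D\<close> does not vanish have nontrivial stabilisers
  in the torus, on which the character of \<open>P\<close> has to be trivial. This forces all \<open>b j\<close> to be
  equal, even, and divisible by 3, so \<open>P\<close> or its cofactor has degree 0.

  \<^emph>\<open>From density to divisibility\<close> (\<open>dvd_of_vanishing\<close>). The polynomials in \<open>x\<close> and \<open>t\<close> that vanish
  whenever \<open>x + t b\<close> has rank at most \<open>r\<close> form a prime ideal without nonzero elements free of \<open>t\<close>.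
  It contains \<open>D (x + t b)\<close>, whose leading coefficient in \<open>t\<close> is the nonzero number \<open>D b\<close>. By
  Gauss's lemma the ideal is generated by a polynomial that is monic in \<open>t\<close>. Setting \<open>t = 0\<close> turns
  its generator into a common divisor of \<open>D\<close> and of every polynomial vanishing at rank at most
  \<open>r\<close>, and irreducibility makes it \<open>D\<close> up to a scalar.

  \<^emph>\<open>Rank exactly \<open>r\<close>\<close> (\<open>vanishes_on_rank_le\<close>). Since \<open>D\<close> is not identically 0, there is a least
  \<open>m > r\<close> such that \<open>D\<close> does not vanish on all sums of \<open>m\<close> terms. Fixing \<open>m - r\<close> of the terms of
  such a sum gives a translate of \<open>D\<close> that vanishes on sums of fewer than \<open>r\<close> terms but not on all
  sums of \<open>r\<close> terms. The functions vanishing at rank at most \<open>r\<close> form a prime ideal, so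
  multiplying by this translate removes the tensors of lower rank.\<close>

section \<open>Substitution into polynomials\<close>

abbreviation lookup where "lookup \<equiv> Poly_Mapping.lookup"
abbreviation keys where "keys \<equiv> Poly_Mapping.keys"
abbreviation Cst :: "complex \<Rightarrow> 'v cpoly" where "Cst a \<equiv> Poly_Mapping.single 0 a"

definition mono_val :: "('v \<Rightarrow> 'r::comm_ring_1) \<Rightarrow> ('v \<Rightarrow>\<^sub>0 nat) \<Rightarrow> 'r" where
  "mono_val h m = (\<Prod>v\<in>keys m. h v ^ lookup m v)"

text \<open>Substitution with an arbitrary coefficient map \<open>c\<close>: evaluation at points, at polynomial
  curves and at lines with a symbolic parameter are all instances, distinguished only by the
  target ring.\<close>

definition psubst :: "(complex \<Rightarrow> 'r) \<Rightarrow> ('v \<Rightarrow> 'r) \<Rightarrow> 'v cpoly \<Rightarrow> 'r::comm_ring_1" where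
  "psubst c h f = (\<Sum>m\<in>keys f. c (lookup f m) * mono_val h m)"

lemma mono_val_superset:
  assumes "finite A" "keys m \<subseteq> A"
  shows "mono_val h m = (\<Prod>v\<in>A. h v ^ lookup m v)"
  unfolding mono_val_def
  by (rule prod.mono_neutral_left) (use assms in \<open>auto simp: in_keys_iff\<close>)

lemma mono_val_add: "mono_val h (m + n) = mono_val h m * mono_val h n"
proof -
  have fin: "finite (keys m \<union> keys n)" by simp
  have "keys (m + n) \<subseteq> keys m \<union> keys n" by (rule Poly_Mapping.keys_add)
  then show ?thesis
    by (simp add: mono_val_superset[OF fin] lookup_add power_add prod.distrib)
qed

lemma mono_val_0 [simp]: "mono_val h 0 = 1"
  by (simp add: mono_val_def)

lemma cpoly_sum_single: "(\<Sum>m\<in>keys f. Poly_Mapping.single m (lookup f m)) = f"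
proof (rule poly_mapping_eqI)
  fix k
  have "lookup (\<Sum>m\<in>keys f. Poly_Mapping.single m (lookup f m)) k
      = (\<Sum>m\<in>keys f. if m = k then lookup f m else 0)"
    by (simp add: lookup_sum lookup_single when_def)
  also have "\<dots> = lookup f k"
    by (simp add: in_keys_iff)
  finally show "lookup (\<Sum>m\<in>keys f. Poly_Mapping.single m (lookup f m)) k = lookup f k" .
qed

context
  fixes c :: "complex \<Rightarrow> 'r::comm_ring_1"
  assumes c: "comm_ring_hom c"
begin

interpretation c: comm_ring_hom c by (rule c)

lemma psubst_superset:
  assumes "finite A" "keys f \<subseteq> A"
  shows "psubst c h f = (\<Sum>m\<in>A. c (lookup f m) * mono_val h m)"
  unfolding psubst_def
  by (rule sum.mono_neutral_left) (use assms in \<open>auto simp: in_keys_iff\<close>)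

lemma psubst_add: "psubst c h (f + g) = psubst c h f + psubst c h g"
proof -
  have fin: "finite (keys f \<union> keys g)" by simp
  have "keys (f + g) \<subseteq> keys f \<union> keys g" by (rule Poly_Mapping.keys_add)
  then show ?thesis
    by (simp add: psubst_superset[OF fin] lookup_add c.hom_add algebra_simps sum.distrib)
qed

lemma psubst_0: "psubst c h 0 = 0"
  by (simp add: psubst_def)

lemma psubst_single: "psubst c h (Poly_Mapping.single m a) = c a * mono_val h m"
  by (cases "a = 0") (simp_all add: psubst_def)

lemma psubst_sum: "psubst c h (sum F A) = (\<Sum>i\<in>A. psubst c h (F i))"
  by (induction A rule: infinite_finite_induct) (simp_all add: psubst_0 psubst_add)

lemma psubst_mult: "psubst c h (f * g) = psubst c h f * psubst c h g"
proof -
  have "psubst c h (f * g) = psubst c h ((\<Sum>m\<in>keys f. Poly_Mapping.single m (lookup f m)) *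
      (\<Sum>m\<in>keys g. Poly_Mapping.single m (lookup g m)))"
    by (simp only: cpoly_sum_single)
  also have "\<dots> = psubst c h f * psubst c h g"
    by (simp only: sum_product psubst_sum mult_single psubst_single c.hom_mult mono_val_add)
      (simp add: psubst_def sum_product mult_ac)
  finally show ?thesis .
qed

lemma psubst_hom: "comm_ring_hom (psubst c h)"
proof
  show "psubst c h 1 = 1"
    using psubst_single[of h 0 1] by (simp)
qed (simp_all add: psubst_0 psubst_add psubst_mult)

lemma psubst_Cst: "psubst c h (Cst a) = c a"
  by (simp add: psubst_single)

lemma psubst_pvar: "psubst c h (pvar v) = h v"
  by (simp add: pvar_def psubst_single mono_val_def)

end

lemma comm_ring_hom_id: "comm_ring_hom (\<lambda>x. x)"
  by standard auto

lemma Cst_hom: "comm_ring_hom (Poly_Mapping.single 0 :: complex \<Rightarrow> 'v cpoly)"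
  by standard (auto simp: single_add mult_single)

lemma pvar_power: "pvar v ^ n = Poly_Mapping.single (Poly_Mapping.single v n) 1"
  by (induction n) (simp_all add: pvar_def mult_single single_add[symmetric])

lemma mono_val_pvar: "mono_val pvar m = Poly_Mapping.single m 1"
proof -
  have "(\<Prod>v\<in>A. pvar v ^ lookup m v) =
      Poly_Mapping.single (\<Sum>v\<in>A. Poly_Mapping.single v (lookup m v)) 1" if "finite A" for A
    using that by (induction A) (simp_all add: pvar_power mult_single)
  moreover have "(\<Sum>v\<in>keys m. Poly_Mapping.single v (lookup m v)) = m"
    by (rule poly_mapping_eqI)
      (simp add: lookup_sum lookup_single when_def in_keys_iff)
  ultimately show ?thesis
    by (simp add: mono_val_def)
qed

lemma psubst_Cst_pvar: "psubst (Poly_Mapping.single 0) pvar f = f"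
  using cpoly_sum_single[of f] by (simp add: psubst_def mono_val_pvar mult_single)

lemma psubst_unique:
  assumes "comm_ring_hom \<phi>"
  shows "\<phi> f = psubst (\<lambda>a. \<phi> (Cst a)) (\<lambda>v. \<phi> (pvar v)) f"
proof -
  interpret comm_ring_hom \<phi> by (rule assms)
  have "\<phi> f = \<phi> (psubst (Poly_Mapping.single 0) pvar f)"
    by (simp add: psubst_Cst_pvar)
  then show ?thesis
    by (simp add: psubst_def mono_val_def hom_sum hom_mult hom_prod hom_power)
qed

text \<open>All later identities between composed substitutions are proved by comparing two ring
  homomorphisms on constants and variables.\<close>

lemma hom_eqI:
  assumes "comm_ring_hom \<phi>" "comm_ring_hom \<psi>"
    and "\<And>a. \<phi> (Cst a) = \<psi> (Cst a)" "\<And>v. \<phi> (pvar v) = \<psi> (pvar v)"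
  shows "\<phi> f = \<psi> f"
  using psubst_unique[OF assms(1), of f] psubst_unique[OF assms(2), of f] assms(3,4) by simp

lemma cpoly_induct [case_names Cst pvar add mult]:
  assumes "\<And>a. P (Cst a)" "\<And>v. P (pvar v)"
    and "\<And>f g. P f \<Longrightarrow> P g \<Longrightarrow> P (f + g)" and "\<And>f g. P f \<Longrightarrow> P g \<Longrightarrow> P (f * g)"
  shows "P f"
proof -
  have P0: "P 0" using assms(1)[of 0] by simp
  have P1: "P 1" using assms(1)[of 1] by simp
  have pow: "P (g ^ n)" if "P g" for g n
    using that by (induction n) (auto intro: P1 assms(4))
  have prd: "P (\<Prod>v\<in>A. pvar v ^ k v)" if "finite A" for A k
    using that by (induction A) (auto intro: P1 assms(2,4) pow)
  have "P (\<Sum>m\<in>A. Cst (lookup f m) * mono_val pvar m)" if "finite A" for A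
    using that by (induction A) (auto intro!: P0 assms(1,3,4) prd simp: mono_val_def)
  then have "P (psubst (Poly_Mapping.single 0) pvar f)"
    by (simp add: psubst_def)
  then show ?thesis by (simp add: psubst_Cst_pvar)
qed

lemma peval_psubst: "peval x f = psubst (\<lambda>a. a) x f"
  by (simp add: peval_def psubst_def mono_val_def)

lemma peval_hom: "comm_ring_hom (peval x)"
proof -
  have "peval x = psubst (\<lambda>a. a) x" by (rule ext) (rule peval_psubst)
  then show ?thesis using psubst_hom[OF comm_ring_hom_id] by metis
qed

interpretation peval: comm_ring_hom "peval x" for x by (rule peval_hom)

lemma peval_Cst [simp]: "peval x (Cst a) = a"
  by (simp add: peval_psubst psubst_Cst[OF comm_ring_hom_id])

lemma peval_pvar [simp]: "peval x (pvar v) = x v"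
  by (simp add: peval_psubst psubst_pvar[OF comm_ring_hom_id])

lemmas peval_simps = peval.hom_add peval.hom_mult peval.hom_minus peval.hom_uminus peval.hom_sum
  peval.hom_prod peval.hom_power

text \<open>This is membership in the carrier of \<^const>\<open>poly_ring\<close>, as a predicate.\<close>

definition in_vars :: "'v set \<Rightarrow> 'v cpoly \<Rightarrow> bool" where
  "in_vars B f \<longleftrightarrow> (\<forall>m\<in>keys f. keys m \<subseteq> B)"

lemma in_vars_add: "in_vars B f \<Longrightarrow> in_vars B g \<Longrightarrow> in_vars B (f + g)"
  using Poly_Mapping.keys_add[of f g] by (auto simp: in_vars_def)

lemma in_vars_mult: 
  assumes "in_vars B f" "in_vars B g"
  shows "in_vars B (f * g)"
  unfolding in_vars_def
proof
  fix m assume "m \<in> keys (f * g)"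
  then obtain a b where "m = a + b" "a \<in> keys f" "b \<in> keys g" using keys_mult[of f g] by blast
  then show "keys m \<subseteq> B" using assms Poly_Mapping.keys_add[of a b] by (fastforce simp: in_vars_def)
qed

lemma in_vars_Cst [simp]: "in_vars B (Cst a)"
  by (auto simp: in_vars_def)

lemma in_vars_0 [simp]: "in_vars B 0" and in_vars_1 [simp]: "in_vars B 1"
  using in_vars_Cst[of B 0] in_vars_Cst[of B 1] by simp_all

lemma in_vars_uminus: "in_vars B f \<Longrightarrow> in_vars B (- f)"
  by (simp add: in_vars_def)

lemma in_vars_pvar: "v \<in> B \<Longrightarrow> in_vars B (pvar v)"
  by (auto simp: in_vars_def pvar_def)

lemma in_vars_sum: "(\<And>i. i \<in> A \<Longrightarrow> in_vars B (F i)) \<Longrightarrow> in_vars B (sum F A)"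
  by (induction A rule: infinite_finite_induct) (auto intro: in_vars_add)

lemma in_vars_prod: "(\<And>i. i \<in> A \<Longrightarrow> in_vars B (F i)) \<Longrightarrow> in_vars B (prod F A)"
  by (induction A rule: infinite_finite_induct) (auto intro: in_vars_mult)

lemma peval_cong:
  assumes "in_vars B f" "\<And>v. v \<in> B \<Longrightarrow> x v = y v"
  shows "peval x f = peval y f"
  unfolding peval_psubst psubst_def mono_val_def
proof (rule sum.cong[OF refl], rule arg_cong2[where f = "(*)"], rule refl, rule prod.cong)
  fix m v assume "m \<in> keys f" "v \<in> keys m"
  then show "x v ^ lookup m v = y v ^ lookup m v"
    using assms by (metis in_vars_def subsetD)
qed auto

lemma in_vars_finite: obtains A where "finite A" "in_vars A f"
proof
  show "finite (\<Union>m\<in>keys f. keys m)" by simp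
  show "in_vars (\<Union>m\<in>keys f. keys m) f" by (auto simp: in_vars_def)
qed

text \<open>A polynomial read as a univariate polynomial in the variable \<open>v\<close> over the other variables.\<close>

definition uni_at :: "'v \<Rightarrow> 'v cpoly \<Rightarrow> 'v cpoly poly" where
  "uni_at v = psubst (\<lambda>a. [:Cst a:]) (\<lambda>w. if w = v then [:0, 1:] else [:pvar w:])"

lemma const_poly_hom: "comm_ring_hom (\<lambda>a. [:\<phi> a:])" if "comm_ring_hom \<phi>"
proof -
  interpret comm_ring_hom \<phi> by (rule that)
  show ?thesis by standard (auto simp: hom_add hom_mult one_pCons)
qed

lemma poly_hom: "comm_ring_hom (\<lambda>F. poly F (a::'a::comm_ring_1))"
  by standard auto

lemma comp_hom: "comm_ring_hom \<phi> \<Longrightarrow> comm_ring_hom \<psi> \<Longrightarrow> comm_ring_hom (\<lambda>x. \<phi> (\<psi> x))"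
proof -
  assume "comm_ring_hom \<phi>" "comm_ring_hom \<psi>"
  then interpret a: comm_ring_hom \<phi> + b: comm_ring_hom \<psi> by auto
  show ?thesis by standard (auto simp: a.hom_add b.hom_add a.hom_mult b.hom_mult)
qed

lemma map_poly_hom: "comm_ring_hom \<phi> \<Longrightarrow> comm_ring_hom (map_poly \<phi>)"
proof -
  assume "comm_ring_hom \<phi>"
  then interpret comm_ring_hom \<phi> .
  show ?thesis
    by standard (auto intro!: poly_eqI simp: coeff_map_poly coeff_mult hom_sum hom_mult hom_add
        coeff_1)
qed

lemma coeff_in_vars_mult:
  assumes "\<forall>i. in_vars A (coeff F i)" "\<forall>i. in_vars A (coeff G i)"
  shows "in_vars A (coeff (F * G) i)"
  using assms by (auto simp: coeff_mult intro!: in_vars_sum in_vars_mult)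

text \<open>A property stable under the ring operations passes to a substituted polynomial as soon as
  the substituted values of the variables that occur have it.\<close>

lemma psubst_closed:
  assumes "\<And>a. P (c a)" "\<And>v. v \<in> B \<Longrightarrow> P (h v)" "\<And>f g. P f \<Longrightarrow> P g \<Longrightarrow> P (f + g)"
    "\<And>f g. P f \<Longrightarrow> P g \<Longrightarrow> P (f * g)" "P 0" "P 1" "in_vars B f"
  shows "P (psubst c h f)"
proof -
  have pow: "P (g ^ n)" if "P g" for g n
    using that by (induction n) (auto intro: assms(4,6))
  have prd: "P (\<Prod>v\<in>A. h v ^ k v)" if "finite A" "A \<subseteq> B" for A k
    using that by (induction A) (auto intro: assms(2,4,6) pow)
  have "P (\<Sum>m\<in>A. c (lookup f m) * mono_val h m)" if "finite A" "A \<subseteq> keys f" for A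
    using that \<open>in_vars B f\<close>
    by (induction A) (auto intro!: assms(1,3,4,5) prd simp: mono_val_def in_vars_def)
  then show ?thesis by (simp add: psubst_def)
qed

lemma uni_at_coeff_in_vars:
  assumes "in_vars (insert v A) f"
  shows "in_vars A (coeff (uni_at v f) i)"
proof -
  have "\<forall>i. in_vars A (coeff (uni_at v f) i)"
    unfolding uni_at_def
    by (rule psubst_closed[OF _ _ _ _ _ _ assms])
      (auto simp: coeff_pCons in_vars_pvar in_vars_add coeff_in_vars_mult split: nat.splits)
  then show ?thesis by blast
qed

lemma uni_at_poly: "poly (uni_at v f) (pvar v) = f"
proof -
  have h: "comm_ring_hom (\<lambda>a. [:Cst a:] :: 'a cpoly poly)" by (rule const_poly_hom[OF Cst_hom])
  show ?thesis unfolding uni_at_def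
    by (rule hom_eqI[where \<phi> = "\<lambda>f. poly (psubst _ _ f) (pvar v)" and \<psi> = "\<lambda>f. f"])
      (auto intro: comp_hom[OF poly_hom psubst_hom[OF h]] comm_ring_hom_id
        simp: psubst_Cst[OF h] psubst_pvar[OF h])
qed

lemma exists_poly_nonzero:
  assumes "p \<noteq> (0 :: complex poly)"
  shows "\<exists>t. poly p t \<noteq> 0"
  using assms poly_all_0_iff_0 by blast

lemma uni_at_peval:
  "peval (x(v := t)) f = poly (map_poly (peval x) (uni_at v f)) t"
proof -
  have h: "comm_ring_hom (\<lambda>a. [:Cst a:] :: 'a cpoly poly)" by (rule const_poly_hom[OF Cst_hom])
  have hm: "comm_ring_hom (map_poly (peval x))"
    by (rule map_poly_hom[OF peval_hom])
  show ?thesis unfolding uni_at_def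
    by (rule hom_eqI[where \<psi> = "\<lambda>f. poly (map_poly (peval x) (psubst _ _ f)) t"])
      (auto intro!: comp_hom[OF poly_hom comp_hom[OF hm psubst_hom[OF h]]] peval_hom
        simp: psubst_Cst[OF h] psubst_pvar[OF h] map_poly_pCons)
qed

text \<open>Complex polynomials are determined by their values: induct on the number of variables and
  use that a nonzero univariate polynomial has a non-root.\<close>

lemma peval_nonzero:
  assumes "f \<noteq> 0"
  shows "\<exists>x. peval x f \<noteq> 0"
proof -
  obtain A where A: "finite A" "in_vars A f" by (rule in_vars_finite)
  then show ?thesis using assms
  proof (induction A arbitrary: f rule: finite_induct)
    case empty
    then have "keys f \<subseteq> {0}" by (auto simp: in_vars_def)
    then have "f = Cst (lookup f 0)"
      using cpoly_sum_single[of f] by (cases "keys f = {}") (auto simp: subset_singleton_iff)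
    with \<open>f \<noteq> 0\<close> have "lookup f 0 \<noteq> 0" by auto
    then show ?case using \<open>f = Cst (lookup f 0)\<close> by (metis peval_Cst)
  next
    case (insert v A)
    have "uni_at v f \<noteq> 0" using uni_at_poly[of v f] \<open>f \<noteq> 0\<close> by auto
    then obtain i where "coeff (uni_at v f) i \<noteq> 0" by (auto simp: poly_eq_iff)
    then obtain x where x: "peval x (coeff (uni_at v f) i) \<noteq> 0"
      using insert.IH[OF uni_at_coeff_in_vars[OF insert.prems(1)]] by blast
    then have "map_poly (peval x) (uni_at v f) \<noteq> 0"
      by (metis coeff_0 coeff_map_poly peval.hom_zero)
    then show ?case using exists_poly_nonzero uni_at_peval by metis
  qed
qed

lemma peval_eqI: "(\<And>x. peval x f = peval x g) \<Longrightarrow> f = g"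
  using peval_nonzero[of "f - g"] by (auto simp: peval.hom_minus)

section \<open>Gauss's lemma on lines and the divisibility criterion\<close>

lemma hom_poly:
  assumes "comm_ring_hom \<phi>"
  shows "\<phi> (poly F a) = poly (map_poly \<phi> F) (\<phi> a)"
proof -
  interpret comm_ring_hom \<phi> by (rule assms)
  show ?thesis
    by (induction F) (simp_all add: map_poly_pCons hom_add hom_mult)
qed

text \<open>Restriction of \<open>f\<close> to the polynomial curve \<open>p\<close>.\<close>

lemma poly_psubst:
  "poly (psubst (\<lambda>a. [:a:]) p f) u = peval (\<lambda>v. poly (p v) u) f"
  by (rule hom_eqI[where \<phi> = "\<lambda>f. poly (psubst _ _ f) u"])
    (auto intro!: comp_hom[OF poly_hom psubst_hom] peval_hom const_poly_hom comm_ring_hom_id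
      simp: psubst_Cst[OF const_poly_hom[OF comm_ring_hom_id]] psubst_pvar[OF const_poly_hom[OF comm_ring_hom_id]])

text \<open>The polynomial \<open>f (x + t b)\<close> in the indeterminate \<open>t\<close>, with coefficients polynomials in
  \<open>x\<close>.\<close>

definition shift :: "('v \<Rightarrow> complex) \<Rightarrow> 'v cpoly \<Rightarrow> 'v cpoly poly" where
  "shift b = psubst (\<lambda>a. [:Cst a:]) (\<lambda>v. [:pvar v, Cst (b v):])"

lemma const_Cst_hom: "comm_ring_hom (\<lambda>a. [:Cst a:] :: 'a cpoly poly)"
  by (rule const_poly_hom[OF Cst_hom])

lemma shift_hom: "comm_ring_hom (shift b)"
  unfolding shift_def by (rule psubst_hom[OF const_Cst_hom])

interpretation shift: comm_ring_hom "shift b" for b by (rule shift_hom)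

lemma shift_simps [simp]: "shift b (Cst a) = [:Cst a:]" "shift b (pvar v) = [:pvar v, Cst (b v):]"
  by (simp_all add: shift_def psubst_Cst[OF const_Cst_hom] psubst_pvar[OF const_Cst_hom])

lemma peval_poly_shift:
  "peval x (poly (shift b f) (Cst t)) = peval (\<lambda>v. x v + t * b v) f"
  by (rule hom_eqI[where \<phi> = "\<lambda>f. peval x (poly (shift b f) (Cst t))"])
    (auto intro!: comp_hom[OF peval_hom comp_hom[OF poly_hom shift_hom]] peval_hom
      simp: peval_simps)

lemma poly_shift_0: "poly (shift b f) 0 = f"
  by (rule peval_eqI) (use peval_poly_shift[of _ b f 0] in simp)

lemma peval_poly: "peval x (poly F (Cst t)) = poly (map_poly (peval x) F) t"
  using hom_poly[OF peval_hom, of x F "Cst t"] by simp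

definition mdeg :: "('v \<Rightarrow>\<^sub>0 nat) \<Rightarrow> nat" where
  "mdeg m = (\<Sum>v\<in>keys m. lookup m v)"

definition homogeneous_part :: "nat \<Rightarrow> 'v cpoly \<Rightarrow> 'v cpoly" where
  "homogeneous_part d f = (\<Sum>m\<in>{m\<in>keys f. mdeg m = d}. Poly_Mapping.single m (lookup f m))"

text \<open>Leading coefficients relative to degree bounds: the bound \<open>e\<close> in \<open>shift_leading\<close> need not be
  attained in a given direction \<open>b\<close>.\<close>

lemma coeff_mult_le:
  assumes "degree p \<le> m" "degree q \<le> n"
  shows "degree (p * q) \<le> m + n" "coeff (p * q) (m + n) = coeff p m * coeff q n"
proof -
  show "degree (p * q) \<le> m + n" using degree_mult_le[of p q] assms by linarith
  have "coeff (p * q) (m + n) = (\<Sum>i\<le>m + n. coeff p i * coeff q (m + n - i))"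
    by (simp add: coeff_mult)
  also have "\<dots> = (\<Sum>i\<in>{m}. coeff p i * coeff q (m + n - i))"
  proof (rule sum.mono_neutral_right)
    show "\<forall>i\<in>{..m + n} - {m}. coeff p i * coeff q (m + n - i) = 0"
    proof
      fix i assume "i \<in> {..m + n} - {m}"
      then have "i > m \<or> m + n - i > n" by auto
      then show "coeff p i * coeff q (m + n - i) = 0"
        using assms coeff_eq_0[of p i] coeff_eq_0[of q "m + n - i"] by auto
    qed
  qed auto
  finally show "coeff (p * q) (m + n) = coeff p m * coeff q n" by simp
qed

lemma coeff_power_le:
  assumes "degree p \<le> 1"
  shows "degree (p ^ k) \<le> k \<and> coeff (p ^ k) k = coeff p 1 ^ k"
proof (induction k)
  case (Suc k)
  then show ?case using coeff_mult_le[OF assms, of "p ^ k" k] by simp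
qed auto

lemma coeff_prod_power_le:
  assumes "finite A" "\<And>v. degree (h v) \<le> 1"
  shows "degree (\<Prod>v\<in>A. h v ^ k v) \<le> (\<Sum>v\<in>A. k v) \<and>
    coeff (\<Prod>v\<in>A. h v ^ k v) (\<Sum>v\<in>A. k v) = (\<Prod>v\<in>A. coeff (h v) 1 ^ k v)"
  using assms(1)
proof induction
  case (insert v A)
  show ?case
    using coeff_mult_le[of "h v ^ k v" "k v" "\<Prod>v\<in>A. h v ^ k v" "sum k A"]
      coeff_power_le[OF assms(2), of v "k v"] insert by simp
qed auto

lemma mono_val_hom: "comm_ring_hom \<phi> \<Longrightarrow> \<phi> (mono_val h m) = mono_val (\<lambda>v. \<phi> (h v)) m"
proof -
  assume "comm_ring_hom \<phi>"
  then interpret comm_ring_hom \<phi> .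
  show ?thesis by (simp add: mono_val_def hom_prod hom_power)
qed

lemma shift_mono:
  "degree (mono_val (\<lambda>v. [:pvar v, Cst (b v):]) m) \<le> mdeg m \<and>
   coeff (mono_val (\<lambda>v. [:pvar v, Cst (b v):]) m) (mdeg m) = Cst (mono_val b m)"
  using coeff_prod_power_le[of "keys m" "\<lambda>v. [:pvar v, Cst (b v):]" "lookup m"]
  by (simp add: mono_val_hom[OF Cst_hom]) (simp add: mono_val_def mdeg_def)

text \<open>Only the monomials of top degree contribute to the top power of \<open>t\<close> in \<open>f (x + t b)\<close>, each
  with its value at \<open>b\<close>. In a direction where the top form does not vanish the polynomial is
  therefore monic in \<open>t\<close> up to a nonzero constant.\<close>

lemma shift_leading:
  assumes "\<And>m. m \<in> keys f \<Longrightarrow> mdeg m \<le> e"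
  shows "degree (shift b f) \<le> e" "coeff (shift b f) e = Cst (peval b (homogeneous_part e f))"
proof -
  let ?M = "\<lambda>m. mono_val (\<lambda>v. [:pvar v, Cst (b v):]) m"
  have eq: "shift b f = (\<Sum>m\<in>keys f. smult (Cst (lookup f m)) (?M m))"
    by (simp add: shift_def psubst_def)
  show "degree (shift b f) \<le> e" unfolding eq
  proof (rule degree_sum_le)
    fix m assume "m \<in> keys f"
    then show "degree (smult (Cst (lookup f m)) (?M m)) \<le> e"
      using shift_mono[of b m] assms[of m] degree_smult_le[of "Cst (lookup f m)" "?M m"] by linarith
  qed simp
  have "coeff (shift b f) e =
      (\<Sum>m\<in>keys f. if mdeg m = e then Cst (lookup f m * mono_val b m) else 0)"
    unfolding eq coeff_sum
  proof (rule sum.cong[OF refl])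
    fix m assume m: "m \<in> keys f"
    show "coeff (smult (Cst (lookup f m)) (?M m)) e =
        (if mdeg m = e then Cst (lookup f m * mono_val b m) else 0)"
    proof (cases "mdeg m = e")
      case True
      then show ?thesis using shift_mono[of b m] by (auto simp: mult_single)
    next
      case False
      then have "degree (?M m) < e" using shift_mono[of b m] assms[OF m] by linarith
      then show ?thesis using False by (simp add: coeff_eq_0)
    qed
  qed
  also have "\<dots> = Cst (\<Sum>m\<in>{m\<in>keys f. mdeg m = e}. lookup f m * mono_val b m)"
  proof -
    interpret c: comm_ring_hom "Poly_Mapping.single 0 :: complex \<Rightarrow> 'a cpoly" by (rule Cst_hom)
    show ?thesis by (simp add: c.hom_sum sum.If_cases Collect_conj_eq)
  qed
  also have "(\<Sum>m\<in>{m\<in>keys f. mdeg m = e}. lookup f m * mono_val b m) = peval b (homogeneous_part e f)"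
    by (simp add: homogeneous_part_def peval_psubst psubst_sum[OF comm_ring_hom_id]
        psubst_single[OF comm_ring_hom_id])
  finally show "coeff (shift b f) e = Cst (peval b (homogeneous_part e f))" .
qed

lemma top_part_nonzero:
  assumes "f \<noteq> 0"
  obtains e where "\<And>m. m \<in> keys f \<Longrightarrow> mdeg m \<le> e" "homogeneous_part e f \<noteq> 0"
proof -
  have ne: "mdeg ` keys f \<noteq> {}" "finite (mdeg ` keys f)" using assms by auto
  define e where "e = Max (mdeg ` keys f)"
  have le: "mdeg m \<le> e" if "m \<in> keys f" for m using that ne by (auto simp: e_def)
  obtain m where m: "m \<in> keys f" "mdeg m = e" using Max_in[OF ne(2,1)] by (auto simp: e_def)
  have "lookup (homogeneous_part e f) m = lookup f m"
    using m by (simp add: homogeneous_part_def lookup_sum lookup_single when_def)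
  then have "homogeneous_part e f \<noteq> 0" using m by (auto simp: in_keys_iff)
  with le show ?thesis by (rule that)
qed

lemma pseudo_division:
  fixes f g :: "'a::idom poly"
  assumes "g \<noteq> 0"
  obtains k q r where "smult (lead_coeff g ^ k) f = g * q + r" "r = 0 \<or> degree r < degree g"
proof -
  obtain q r where "pseudo_divmod f g = (q, r)" by force
  from pseudo_divmod[OF assms this] show ?thesis using that by blast
qed

lemma unit_lead_division:
  fixes f g :: "'a::idom poly"
  assumes "lead_coeff g * u = 1"
  obtains q r where "f = g * q + r" "r = 0 \<or> degree r < degree g"
proof -
  have "g \<noteq> 0" using assms by auto
  then obtain k q r where *: "smult (lead_coeff g ^ k) f = g * q + r" "r = 0 \<or> degree r < degree g"
    by (rule pseudo_division)
  have "f = smult (u ^ k) (smult (lead_coeff g ^ k) f)"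
    using assms by (simp add: power_mult_distrib[symmetric] mult.commute)
  also have "\<dots> = g * smult (u ^ k) q + smult (u ^ k) r"
    by (simp add: * smult_add_right)
  finally show ?thesis using that *(2)
    by (metis degree_smult_le le_less_trans smult_0_right)
qed

text \<open>Gauss's lemma in the form used here. The content of \<open>p q\<close> is \<open>u\<close> up to a unit, since \<open>D\<close> is
  primitive; comparing leading coefficients, the leading coefficient of \<open>p\<close> is its content times a
  unit, and it divides every coefficient of \<open>p\<close>.\<close>

lemma lead_coeff_dvd_coeffs:
  fixes p q D :: "'a :: {factorial_ring_gcd, semiring_gcd_mult_normalize} poly"
  assumes eq: "p * q = smult u D" and D: "is_unit (lead_coeff D)" and u: "u \<noteq> 0"
  shows "lead_coeff p dvd coeff p i"
proof -
  have D0: "D \<noteq> 0" using D by auto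
  have pq: "p \<noteq> 0" "q \<noteq> 0" using eq u D0 by auto
  have cD: "is_unit (content D)" using content_dvd_coeff[of D "degree D"] D dvd_trans by blast
  obtain a' where a: "lead_coeff p = content p * a'" by (meson content_dvd_coeff dvdE)
  obtain b' where b: "lead_coeff q = content q * b'" by (meson content_dvd_coeff dvdE)
  have lc: "lead_coeff p * lead_coeff q = u * lead_coeff D"
    using arg_cong[OF eq, of lead_coeff] by (simp add: lead_coeff_mult)
  have "content p * content q = content (smult u D)"
    by (simp add: eq[symmetric] content_mult)
  also have "\<dots> = normalize u * content D" by simp
  finally have "u dvd content p * content q" by simp
  then have "u * lead_coeff D dvd content p * content q"
    using D by (simp add: mult_unit_dvd_iff)
  then have "(content p * content q) * (a' * b') dvd content p * content q * 1"
    using lc a b by (simp add: algebra_simps)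
  moreover have "content p * content q \<noteq> 0" using pq by simp
  ultimately have "is_unit (a' * b')" 
    by (simp only: dvd_mult_cancel_left) blast
  then have "is_unit a'" using is_unit_mult_iff by blast
  then have "lead_coeff p dvd content p" by (simp add: a mult_unit_dvd_iff)
  then show ?thesis using content_dvd_coeff dvd_trans by blast
qed

definition on_line :: "('v \<Rightarrow> complex) \<Rightarrow> ('v \<Rightarrow> complex) \<Rightarrow> 'v cpoly \<Rightarrow> complex poly" where
  "on_line x c f = map_poly (peval x) (shift c f)"

lemma on_line_hom: "comm_ring_hom (on_line x c)"
proof -
  have "on_line x c = (\<lambda>f. map_poly (peval x) (shift c f))" by (simp add: on_line_def fun_eq_iff)
  then show ?thesis using comp_hom[OF map_poly_hom[OF peval_hom] shift_hom] by metis
qed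

text \<open>Divisibility can be tested on the lines of one direction \<open>c\<close>, if the divisor has constant
  leading coefficient along them: division with remainder by \<open>\<alpha> (x + t c)\<close> then has no
  denominators, and its remainder vanishes on every line. This reduces divisibility questions in
  several variables to the principal ideal domain of univariate polynomials.\<close>

lemma dvd_if_dvd_on_lines:
  fixes \<alpha> f :: "'v::linorder cpoly"
  assumes lc: "coeff (shift c \<alpha>) e = Cst a" "degree (shift c \<alpha>) \<le> e" "a \<noteq> 0"
    and dvd: "\<And>x. on_line x c \<alpha> dvd on_line x c f"
  shows "\<alpha> dvd f"
proof -
  interpret map_hom: comm_ring_hom "map_poly (peval x)" for x by (rule map_poly_hom[OF peval_hom])
  have e: "degree (shift c \<alpha>) = e" using lc by (metis le_antisym le_degree peval.hom_zero peval_Cst)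
  then have "lead_coeff (shift c \<alpha>) * Cst (1 / a) = 1" using lc by (simp add: mult_single)
  then obtain q r where qr: "shift c f = shift c \<alpha> * q + r" "r = 0 \<or> degree r < degree (shift c \<alpha>)"
    by (rule unit_lead_division)
  have "map_poly (peval x) r = 0" for x
  proof (rule ccontr)
    assume ne: "map_poly (peval x) r \<noteq> 0"
    then have "r \<noteq> 0" by auto
    have "on_line x c f = on_line x c \<alpha> * map_poly (peval x) q + map_poly (peval x) r"
      unfolding on_line_def qr(1) by (simp add: map_hom.hom_add map_hom.hom_mult)
    with dvd[of x] have "on_line x c \<alpha> dvd map_poly (peval x) r"
      by (metis dvd_add_right_iff dvd_triv_left)
    then have "degree (on_line x c \<alpha>) \<le> degree (map_poly (peval x) r)"
      using ne by (rule dvd_imp_degree_le)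
    moreover have "degree (map_poly (peval x) r) \<le> degree r" by (rule map_poly_degree_leq)
    moreover have "coeff (on_line x c \<alpha>) e = a" by (simp add: on_line_def coeff_map_poly lc)
    then have "e \<le> degree (on_line x c \<alpha>)" using \<open>a \<noteq> 0\<close> by (metis le_degree)
    ultimately show False using qr(2) \<open>r \<noteq> 0\<close> e by linarith
  qed
  then have "r = 0"
    by (intro poly_eqI peval_eqI) (metis coeff_0 coeff_map_poly peval.hom_zero)
  then have "poly (shift c f) 0 = poly (shift c \<alpha>) 0 * poly q 0" using qr(1) by simp
  then show ?thesis by (simp add: poly_shift_0)
qed

text \<open>Any two points of \<open>S\<close> are joined by a polynomial curve in \<open>S\<close> (\<open>conn\<close>), the set lies in the
  zero set of the irreducible form \<open>D\<close>, and the lines with direction \<open>b\<close> that meet it are dense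
  (\<open>dom\<close>). Consider the ideal of all polynomials in \<open>t\<close> over the polynomials in \<open>x\<close> that vanish at
  \<open>(x, t)\<close> whenever \<open>x + t b\<close> is in \<open>S\<close>. It is prime by \<open>conn\<close>, meets the coefficient ring in 0 by
  \<open>dom\<close>, and contains \<open>D (x + t b)\<close>, which is monic in \<open>t\<close> up to the constant \<open>D b\<close>. Let \<open>p\<close> be an
  element of least \<open>t\<close>-degree. Pseudo-division gives \<open>p q = \<alpha>\<^sup>k D (x + t b)\<close> with \<open>\<alpha>\<close> the leading
  coefficient of \<open>p\<close>, and Gauss's lemma on each line shows that \<open>\<alpha>\<close> divides \<open>p\<close>. By primality the
  monic quotient \<open>g\<close> lies in the ideal, so it divides every element, in particular \<open>D (x + t b)\<close>
  and \<open>f (x + t b)\<close>. At \<open>t = 0\<close> it becomes a common divisor of \<open>D\<close> and \<open>f\<close>.\<close>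

theorem dvd_of_vanishing:
  fixes D f :: "'v::linorder cpoly"
  assumes homog: "\<And>m. m \<in> keys D \<Longrightarrow> mdeg m = n"
    and Db: "peval b D \<noteq> 0"
    and conn: "\<And>x y. x \<in> S \<Longrightarrow> y \<in> S \<Longrightarrow> \<exists>p. (\<forall>v. poly (p v) 0 = x v) \<and> (\<forall>v. poly (p v) 1 = y v) \<and>
      (\<forall>u. (\<lambda>v. poly (p v) u) \<in> S)"
    and van: "\<And>x. x \<in> S \<Longrightarrow> peval x D = 0"
    and dom: "\<And>h. (\<And>x t. (\<lambda>v. x v + t * b v) \<in> S \<Longrightarrow> peval x h = 0) \<Longrightarrow> h = 0"
    and irr: "\<And>P Q. D = P * Q \<Longrightarrow> (\<exists>c. P = Cst c) \<or> (\<exists>c. Q = Cst c)"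
    and f: "\<And>x. x \<in> S \<Longrightarrow> peval x f = 0"
  shows "D dvd f"
proof -
  define ev where "ev x t F = peval x (poly F (Cst t))" for x :: "'v \<Rightarrow> complex" and t F
  have ev_simps: "ev x t (F + G) = ev x t F + ev x t G" "ev x t (F * G) = ev x t F * ev x t G"
    "ev x t (smult a F) = peval x a * ev x t F" "ev x t [:a:] = peval x a" for x t F G a
    by (simp_all add: ev_def peval_simps)
  define It where "It F \<longleftrightarrow> (\<forall>x t. (\<lambda>v. x v + t * b v) \<in> S \<longrightarrow> ev x t F = 0)" for F
  have It_shift: "It (shift b g)" if "\<And>x. x \<in> S \<Longrightarrow> peval x g = 0" for g
    unfolding It_def ev_def by (simp add: peval_poly_shift that)
  have It_prime: "It F \<or> It G" if FG: "It (F * G)" for F G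
  proof (rule ccontr)
    assume "\<not> (It F \<or> It G)"
    then obtain x1 t1 x2 t2 where
      1: "(\<lambda>v. x1 v + t1 * b v) \<in> S" "ev x1 t1 F \<noteq> 0" and
      2: "(\<lambda>v. x2 v + t2 * b v) \<in> S" "ev x2 t2 G \<noteq> 0" by (auto simp: It_def)
    obtain p where p: "\<And>v. poly (p v) 0 = x1 v + t1 * b v" "\<And>v. poly (p v) 1 = x2 v + t2 * b v"
      "\<And>u. (\<lambda>v. poly (p v) u) \<in> S" using conn[OF 1(1) 2(1)] by blast
    define T where "T = [:t1, t2 - t1:]"
    \<comment> \<open>The curve \<open>(p u - T u b, T u)\<close> joins the two points, and its image under \<open>(x, t) \<mapsto> x + t b\<close>
      is the curve \<open>p\<close> in \<open>S\<close>.\<close>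
    define \<theta> where "\<theta> = psubst (\<lambda>a. [:a:]) (\<lambda>v. p v - smult (b v) T)"
    define \<Psi> where "\<Psi> F = poly (map_poly \<theta> F) T" for F
    have h\<theta>: "comm_ring_hom \<theta>" unfolding \<theta>_def
      by (rule psubst_hom[OF const_poly_hom[OF comm_ring_hom_id]])
    have ev\<Psi>: "poly (\<Psi> F) u = ev (\<lambda>v. poly (p v) u - poly T u * b v) (poly T u) F" for F u
    proof -
      have "poly (\<Psi> F) u = poly (map_poly (\<lambda>q. poly q u) (map_poly \<theta> F)) (poly T u)"
        unfolding \<Psi>_def by (rule hom_poly[OF poly_hom])
      also have "map_poly (\<lambda>q. poly q u) (map_poly \<theta> F) =
          map_poly (\<lambda>g. peval (\<lambda>v. poly (p v) u - poly T u * b v) g) F"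
      proof -
        interpret comm_ring_hom \<theta> by (rule h\<theta>)
        have "poly (\<theta> g) u = peval (\<lambda>v. poly (p v) u - poly T u * b v) g" for g
          unfolding \<theta>_def poly_psubst by (simp add: mult.commute)
        then show ?thesis by (auto intro!: poly_eqI simp: coeff_map_poly)
      qed
      finally show ?thesis by (simp add: ev_def peval_poly)
    qed
    have "poly (\<Psi> F * \<Psi> G) u = 0" for u
      using FG p(3)[of u] by (simp add: ev\<Psi> It_def ev_simps)
    then have "\<Psi> F * \<Psi> G = 0" using poly_all_0_iff_0 by blast
    moreover have "poly (\<Psi> F) 0 \<noteq> 0" using 1 by (simp add: ev\<Psi> p T_def)
    moreover have "poly (\<Psi> G) 1 \<noteq> 0" using 2 by (simp add: ev\<Psi> p T_def)
    ultimately show False by auto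
  qed
  have It_const: "h = 0" if "It [:h:]" for h
    by (rule dom) (use that in \<open>auto simp: It_def ev_simps\<close>)
  define Dh where "Dh = shift b D"
  have D0: "D \<noteq> 0" using Db by auto
  have hpD: "homogeneous_part n D = D"
  proof -
    have "{m \<in> keys D. mdeg m = n} = keys D" using homog by auto
    then show ?thesis by (simp add: homogeneous_part_def cpoly_sum_single)
  qed
  have coD: "coeff Dh n = Cst (peval b D)" and "degree Dh \<le> n"
    using shift_leading[of D n b] homog hpD by (auto simp: Dh_def)
  then have degD: "degree Dh = n" using Db
    by (metis le_antisym le_degree peval.hom_zero peval_Cst)
  have ItD: "It Dh" unfolding Dh_def by (rule It_shift) (rule van)
  have "Dh \<noteq> 0" using coD Db by (metis coeff_0 peval.hom_zero peval_Cst)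
  define d where "d = (LEAST d. \<exists>p. p \<noteq> 0 \<and> It p \<and> degree p = d)"
  have "\<exists>p. p \<noteq> 0 \<and> It p \<and> degree p = d" unfolding d_def
    by (rule LeastI[of _ "degree Dh"]) (use ItD \<open>Dh \<noteq> 0\<close> in auto)
  then obtain p where p: "p \<noteq> 0" "It p" "degree p = d" by blast
  have min: "r = 0" if "It r" "r = 0 \<or> degree r < d" for r
    using that not_less_Least[of "degree r" "\<lambda>d. \<exists>p. p \<noteq> 0 \<and> It p \<and> degree p = d"]
    unfolding d_def by blast
  define \<alpha> where "\<alpha> = lead_coeff p"
  have "\<alpha> \<noteq> 0" using p(1) unfolding \<alpha>_def by (rule leading_coeff_neq_0)
  have rem: "It r" if "F = g * q + r" "It F" "It g" for F g q r
    using that by (auto simp: It_def ev_simps)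
  have It_smult: "It (smult a F)" if "It F" for a F
    using that by (auto simp: It_def ev_simps)
  obtain k q r where "smult (\<alpha> ^ k) Dh = p * q + r" "r = 0 \<or> degree r < degree p"
    unfolding \<alpha>_def by (rule pseudo_division[OF p(1)])
  moreover from this have "r = 0" using rem[OF _ It_smult[OF ItD] p(2)] min p(3) by metis
  ultimately have pq: "p * q = smult (\<alpha> ^ k) Dh" by simp
  have dvd: "\<alpha> dvd coeff p i" for i
  proof -
    obtain e where e: "\<And>m. m \<in> keys \<alpha> \<Longrightarrow> mdeg m \<le> e" "homogeneous_part e \<alpha> \<noteq> 0"
      using top_part_nonzero[OF \<open>\<alpha> \<noteq> 0\<close>] by blast
    obtain c where c: "peval c (homogeneous_part e \<alpha>) \<noteq> 0" using peval_nonzero[OF e(2)] by blast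
    show ?thesis
    proof (rule dvd_if_dvd_on_lines)
      show co: "coeff (shift c \<alpha>) e = Cst (peval c (homogeneous_part e \<alpha>))" and "degree (shift c \<alpha>) \<le> e"
        using shift_leading[OF e(1)] by auto
      show "peval c (homogeneous_part e \<alpha>) \<noteq> 0" by (rule c)
      fix x
      interpret L: comm_ring_hom "on_line x c" by (rule on_line_hom)
      interpret mapL: comm_ring_hom "map_poly (on_line x c)" by (rule map_poly_hom[OF on_line_hom])
      have "coeff (on_line x c \<alpha>) e \<noteq> 0" using c by (simp add: on_line_def coeff_map_poly co)
      then have L\<alpha>: "on_line x c \<alpha> \<noteq> 0" by auto
      have lcp: "lead_coeff (map_poly (on_line x c) p) = on_line x c \<alpha>"
        using L\<alpha> by (subst lead_coeff_map_poly_nz) (auto simp: \<alpha>_def)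
      have LD: "on_line x c (Cst (peval b D)) = [:peval b D:]"
        by (simp add: on_line_def map_poly_pCons)
      have "lead_coeff Dh = Cst (peval b D)" using coD degD by simp
      then have lcD: "lead_coeff (map_poly (on_line x c) Dh) = [:peval b D:]"
        using LD Db by (subst lead_coeff_map_poly_nz) auto
      have "map_poly (on_line x c) p * map_poly (on_line x c) q =
          smult (on_line x c \<alpha> ^ k) (map_poly (on_line x c) Dh)"
        using arg_cong[OF pq, of "map_poly (on_line x c)"]
        by (simp add: mapL.hom_mult) (auto intro!: poly_eqI simp: coeff_map_poly L.hom_mult L.hom_power)
      from lead_coeff_dvd_coeffs[OF this] L\<alpha> Db
      show "on_line x c \<alpha> dvd on_line x c (coeff p i)"
        by (simp add: lcp lcD is_unit_const_poly_iff coeff_map_poly dvd_field_iff)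
    qed
  qed
  then have "[:\<alpha>:] dvd p" by (simp add: const_poly_dvd_iff)
  then obtain g where g: "p = [:\<alpha>:] * g" by (rule dvdE)
  have "It g" using It_prime[of "[:\<alpha>:]" g] It_const[of \<alpha>] \<open>\<alpha> \<noteq> 0\<close> p(2) g by auto
  have degg: "degree g = d" using g p(3) \<open>\<alpha> \<noteq> 0\<close> by simp
  have "lead_coeff p = \<alpha> * lead_coeff g" unfolding g by (simp add: lead_coeff_mult)
  then have "\<alpha> * lead_coeff g = \<alpha> * 1" by (simp add: \<alpha>_def)
  then have lcg: "lead_coeff g * 1 = 1" using \<open>\<alpha> \<noteq> 0\<close> by simp
  have gdvd: "g dvd F" if "It F" for F
  proof -
    obtain q r where "F = g * q + r" "r = 0 \<or> degree r < degree g"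
      by (rule unit_lead_division[OF lcg])
    then show ?thesis using rem[OF _ that \<open>It g\<close>] min degg by (metis add_0_right dvd_triv_left)
  qed
  obtain Q where "Dh = g * Q" using gdvd[OF ItD] by (rule dvdE)
  then have Dfac: "D = poly g 0 * poly Q 0" using poly_shift_0[of b D] by (simp add: Dh_def)
  obtain w where "shift b f = g * w" using gdvd[OF It_shift[OF f]] by (rule dvdE)
  then have ffac: "f = poly g 0 * poly w 0" using poly_shift_0[of b f] by simp
  from irr[OF Dfac] show ?thesis
  proof
    assume "\<exists>c. poly g 0 = Cst c"
    then obtain c where c: "poly g 0 = Cst c" by blast
    \<comment> \<open>Since \<open>g\<close> vanishes at \<open>(y, 0)\<close> for \<open>y\<close> in \<open>S\<close>, a constant \<open>g (x, 0)\<close> would be 0, and so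
      would \<open>D\<close>.\<close>
    have "S \<noteq> {}" using dom[of 1] by auto
    then obtain y where "y \<in> S" by blast
    then have "ev y 0 g = 0" using \<open>It g\<close> unfolding It_def by (auto dest: spec[of _ y] spec[of _ 0])
    then have "c = 0" using c by (simp add: ev_def)
    then show ?thesis using Dfac c D0 by simp
  next
    assume "\<exists>c. poly Q 0 = Cst c"
    then obtain c where c: "poly Q 0 = Cst c" by blast
    then have "c \<noteq> 0" using Dfac D0 by auto
    then have "poly g 0 = D * Cst (1 / c)" using Dfac c by (simp add: mult_single mult.assoc)
    then show ?thesis using ffac by (simp add: mult.assoc)
  qed
qed

section \<open>Genericity and dominance\<close>

text \<open>A homogeneous linear system with coefficients polynomial in \<open>u\<close> that has only the zero
  solution at \<open>u0\<close> has only the zero solution for all \<open>u\<close> outside the zeros of a polynomial \<open>\<Delta>\<close>.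
  The proof is Gaussian elimination over the polynomials, and \<open>\<Delta>\<close> is the product of the pivots.\<close>

lemma generic_injectivity:
  fixes R :: "('k \<Rightarrow> complex poly) set"
  assumes "finite A"
    and "\<forall>x. (\<forall>\<rho>\<in>R. (\<Sum>k\<in>A. poly (\<rho> k) u0 * x k) = 0) \<longrightarrow> (\<forall>k\<in>A. x k = 0)"
  shows "\<exists>\<Delta>. poly \<Delta> u0 \<noteq> 0 \<and> (\<forall>u x. poly \<Delta> u \<noteq> 0 \<longrightarrow>
      (\<forall>\<rho>\<in>R. (\<Sum>k\<in>A. poly (\<rho> k) u * x k) = 0) \<longrightarrow> (\<forall>k\<in>A. x k = 0))"
  using assms
proof (induction A arbitrary: R rule: finite_induct)
  case empty
  then show ?case by (intro exI[of _ 1]) auto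
next
  case (insert a A)
  have "\<exists>\<rho>\<in>R. poly (\<rho> a) u0 \<noteq> 0"
  proof (rule ccontr)
    assume "\<not> ?thesis"
    then have "(\<Sum>k\<in>insert a A. poly (\<rho> k) u0 * (if k = a then 1 else 0)) = 0" if "\<rho> \<in> R" for \<rho>
      using that insert.hyps by simp
    then have "\<forall>k\<in>insert a A. (if k = a then 1 else 0 :: complex) = 0"
      using insert.prems[THEN spec, of "\<lambda>k. if k = a then 1 else 0"] by blast
    then show False by auto
  qed
  then obtain \<rho>0 where \<rho>0: "\<rho>0 \<in> R" "poly (\<rho>0 a) u0 \<noteq> 0" by blast
  define R' where "R' = (\<lambda>\<sigma> k. \<rho>0 a * \<sigma> k - \<sigma> a * \<rho>0 k) ` R"
  have row: "(\<Sum>k\<in>A. poly (\<rho>0 a * \<sigma> k - \<sigma> a * \<rho>0 k) u * x k) =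
      poly (\<rho>0 a) u * (\<Sum>k\<in>insert a A. poly (\<sigma> k) u * x k)
      - poly (\<sigma> a) u * (\<Sum>k\<in>insert a A. poly (\<rho>0 k) u * x k)" for \<sigma> u x
  proof -
    have "(\<Sum>k\<in>A. poly (\<rho>0 a * \<sigma> k - \<sigma> a * \<rho>0 k) u * x k) =
        poly (\<rho>0 a) u * (\<Sum>k\<in>A. poly (\<sigma> k) u * x k) - poly (\<sigma> a) u * (\<Sum>k\<in>A. poly (\<rho>0 k) u * x k)"
      unfolding sum_distrib_left sum_subtractf[symmetric] by (simp add: left_diff_distrib mult.assoc)
    then show ?thesis using insert.hyps by (simp add: right_diff_distrib distrib_left mult_ac)
  qed
  have inj': "\<forall>k\<in>A. x k = 0" if x: "\<forall>\<rho>\<in>R'. (\<Sum>k\<in>A. poly (\<rho> k) u0 * x k) = 0" for x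
  proof -
    define y where "y = x(a := - (\<Sum>k\<in>A. poly (\<rho>0 k) u0 * x k) / poly (\<rho>0 a) u0)"
    have yA: "(\<Sum>k\<in>A. F k * y k) = (\<Sum>k\<in>A. F k * x k)" for F
      using insert.hyps by (intro sum.cong) (auto simp: y_def)
    have y0: "(\<Sum>k\<in>insert a A. poly (\<rho>0 k) u0 * y k) = 0"
      using insert.hyps \<rho>0 by (simp add: yA) (simp add: y_def)
    have "(\<Sum>k\<in>insert a A. poly (\<sigma> k) u0 * y k) = 0" if "\<sigma> \<in> R" for \<sigma>
    proof -
      have "(\<Sum>k\<in>A. poly (\<rho>0 a * \<sigma> k - \<sigma> a * \<rho>0 k) u0 * x k) = 0"
        using x that by (simp add: R'_def)
      then have "(\<Sum>k\<in>A. poly (\<rho>0 a * \<sigma> k - \<sigma> a * \<rho>0 k) u0 * y k) = 0" by (simp only: yA)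
      then show ?thesis unfolding row y0 using \<rho>0 by simp
    qed
    then have "\<forall>k\<in>insert a A. y k = 0" by (intro insert.prems[THEN spec, THEN mp] ballI)
    moreover have "y k = x k" if "k \<in> A" for k
      using that insert.hyps(2) by (auto simp: y_def)
    ultimately show ?thesis by simp
  qed
  have "\<forall>x. (\<forall>\<rho>\<in>R'. (\<Sum>k\<in>A. poly (\<rho> k) u0 * x k) = 0) \<longrightarrow> (\<forall>k\<in>A. x k = 0)"
    using inj' by simp
  from insert.IH[OF this] obtain \<Delta> where \<Delta>: "poly \<Delta> u0 \<noteq> 0"
    "\<forall>u x. poly \<Delta> u \<noteq> 0 \<longrightarrow> (\<forall>\<rho>\<in>R'. (\<Sum>k\<in>A. poly (\<rho> k) u * x k) = 0) \<longrightarrow> (\<forall>k\<in>A. x k = 0)"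
    by (elim exE conjE)
  show ?case
  proof (intro exI[of _ "\<Delta> * \<rho>0 a"] conjI allI impI)
    show "poly (\<Delta> * \<rho>0 a) u0 \<noteq> 0" using \<Delta>(1) \<rho>0 by simp
    fix u x
    assume u: "poly (\<Delta> * \<rho>0 a) u \<noteq> 0"
      and x: "\<forall>\<rho>\<in>R. (\<Sum>k\<in>insert a A. poly (\<rho> k) u * x k) = 0"
    have "poly \<Delta> u \<noteq> 0" using u by simp
    then have A: "\<forall>k\<in>A. x k = 0"
    proof (rule \<Delta>(2)[THEN spec, THEN spec, THEN mp, THEN mp], intro ballI)
      fix \<rho> assume "\<rho> \<in> R'"
      then obtain \<sigma> where \<sigma>: "\<sigma> \<in> R" "\<rho> = (\<lambda>k. \<rho>0 a * \<sigma> k - \<sigma> a * \<rho>0 k)" by (auto simp: R'_def)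
      show "(\<Sum>k\<in>A. poly (\<rho> k) u * x k) = 0"
        unfolding \<sigma>(2) row using x \<sigma>(1) \<rho>0(1) by simp
    qed
    have "(\<Sum>k\<in>insert a A. poly (\<rho>0 k) u * x k) = 0" using x \<rho>0 by blast
    then have "poly (\<rho>0 a) u * x a = 0" using A insert.hyps by simp
    then show "\<forall>k\<in>insert a A. x k = 0" using A u by simp
  qed
qed

definition dir_deriv :: "('v \<Rightarrow> complex) \<Rightarrow> 'v cpoly \<Rightarrow> 'v cpoly" where
  "dir_deriv c h = coeff (shift c h) 1"

definition unit_dir :: "'v \<Rightarrow> 'v \<Rightarrow> complex" where
  "unit_dir v w = (if w = v then 1 else 0)"

lemma coeff_shift_0: "coeff (shift c h) 0 = h"
  using poly_shift_0[of c h] by (simp add: poly_0_coeff_0)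

lemma dir_deriv_simps:
  "dir_deriv c (Cst a) = 0" "dir_deriv c (pvar v) = Cst (c v)" "dir_deriv c (f + g) = dir_deriv c f + dir_deriv c g"
  "dir_deriv c (f * g) = dir_deriv c f * g + f * dir_deriv c g"
  by (simp_all add: dir_deriv_def shift.hom_add shift.hom_mult coeff_mult coeff_shift_0)

lemma dir_deriv_partial:
  assumes "finite B" "\<And>v. v \<notin> B \<Longrightarrow> c v = 0"
  shows "dir_deriv c h = (\<Sum>v\<in>B. Cst (c v) * dir_deriv (unit_dir v) h)"
proof (induction h rule: cpoly_induct)
  case (pvar w)
  have "(\<Sum>v\<in>B. Cst (c v) * Cst (unit_dir v w)) = (\<Sum>v\<in>B. if v = w then Cst (c v) else 0)"
    by (intro sum.cong) (auto simp: unit_dir_def)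
  also have "\<dots> = Cst (c w)" using assms by auto
  finally show ?case unfolding dir_deriv_simps by (rule sym)
qed (simp_all add: dir_deriv_simps sum.distrib sum_distrib_left sum_distrib_right algebra_simps)

interpretation on_line: comm_ring_hom "on_line x c" for x c by (rule on_line_hom)

lemma on_line_simps [simp]: "on_line x c (Cst a) = [:a:]" "on_line x c (pvar v) = [:x v, c v:]"
  by (simp_all add: on_line_def map_poly_pCons)

lemma poly_on_line: "poly (on_line x c h) t = peval (\<lambda>v. x v + t * c v) h"
  by (simp add: on_line_def peval_poly[symmetric] peval_poly_shift)

lemma pderiv_on_line: "pderiv (on_line x c h) = on_line x c (dir_deriv c h)"
  by (induction h rule: cpoly_induct)
    (simp_all add: dir_deriv_simps on_line.hom_add on_line.hom_mult pderiv_add pderiv_mult pderiv_pCons)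

lemma coeff_1_on_line: "coeff (on_line x c h) 1 = peval x (dir_deriv c h)"
  by (simp add: on_line_def coeff_map_poly dir_deriv_def)

lemma dir_deriv_zero_on_line:
  assumes "\<And>\<epsilon>. peval (\<lambda>v. x v + \<epsilon> * c v) h = 0"
  shows "peval x (dir_deriv c h) = 0"
proof -
  have "on_line x c h = 0" using assms poly_all_0_iff_0 poly_on_line by metis
  then show ?thesis using coeff_1_on_line[of x c h] by simp
qed

text \<open>Taylor's formula: a family of polynomials that vanish at \<open>y\<close> and is closed under partial
  derivatives and linear combinations consists of 0 only.\<close>

lemma zero_if_derivatives_zero:
  assumes der: "\<And>h v. Z h \<Longrightarrow> Z (dir_deriv (unit_dir v) h)"
    and add: "\<And>f g. Z f \<Longrightarrow> Z g \<Longrightarrow> Z (f + g)" and sm: "\<And>a f. Z f \<Longrightarrow> Z (Cst a * f)" 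
    and pt: "\<And>h. Z h \<Longrightarrow> peval y h = 0" and h: "Z h"
  shows "h = 0"
proof (rule ccontr)
  assume "h \<noteq> 0"
  then obtain x where x: "peval x h \<noteq> 0" using peval_nonzero by blast
  obtain A where A: "finite A" "in_vars A h" by (rule in_vars_finite)
  define c where "c v = (if v \<in> A then x v - y v else 0)" for v
  have Z0: "Z 0" using sm[OF h, of 0] by simp
  have Zsum: "Z (\<Sum>v\<in>A'. Cst (c v) * dir_deriv (unit_dir v) g)" if "finite A'" "Z g" for A' g
    using that by (induction A') (auto intro: Z0 add sm der)
  then have Zd: "Z (dir_deriv c g)" if "Z g" for g
  proof -
    have "dir_deriv c g = (\<Sum>v\<in>A. Cst (c v) * dir_deriv (unit_dir v) g)"
      by (rule dir_deriv_partial[OF A(1)]) (simp add: c_def)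
    then show ?thesis using Zsum[OF A(1) that] by simp
  qed
  have "on_line y c g = 0" if "Z g" for g
    using that
  proof (induction "degree (on_line y c g)" arbitrary: g rule: less_induct)
    case less
    have "pderiv (on_line y c g) = 0"
    proof (cases "degree (on_line y c g) = 0")
      case False
      then have "degree (on_line y c (dir_deriv c g)) < degree (on_line y c g)"
        by (simp add: pderiv_on_line[symmetric] degree_pderiv)
      then show ?thesis using less(1)[OF _ Zd[OF less(2)]] by (simp add: pderiv_on_line)
    qed (simp add: pderiv_eq_0_iff)
    then obtain k where k: "on_line y c g = [:k:]" by (meson pderiv_eq_0_iff degree_eq_zeroE)
    moreover have "poly (on_line y c g) 0 = 0" using pt[OF less(2)] by (simp add: poly_on_line)
    ultimately show ?case by simp
  qed
  then have "peval (\<lambda>v. y v + 1 * c v) h = 0" using h poly_on_line[of y c h 1] by simp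
  moreover have "peval (\<lambda>v. y v + 1 * c v) h = peval x h"
    by (rule peval_cong[OF A(2)]) (simp add: c_def)
  ultimately show False using x by simp
qed

text \<open>The conclusion says that the points \<open>x\<close> with \<open>x + t b\<close> in \<open>S\<close> for some \<open>t\<close> are Zariski
  dense. The polynomials vanishing at these points are closed under partial derivatives, hence
  zero by Taylor's formula: the gradient of such a polynomial annihilates \<open>b\<close> and the tangent
  vectors to \<open>S\<close>, and at a generic point these span the whole space. To reach a given point \<open>y\<close>,
  the hypothesis \<open>tang\<close> provides a curve \<open>q\<close> in \<open>S\<close> that ends at \<open>y\<close>, with tangent vectors \<open>\<tau>\<close>
  along it that span together with \<open>b\<close> at the start \<open>u = 0\<close>. They then span for all but finitely
  many \<open>u\<close>, so the gradient vanishes along the whole curve.\<close>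

theorem dominance:
  fixes S :: "('v \<Rightarrow> complex) set"
  assumes B: "finite B" and S: "S \<noteq> {}"
    and cyl: "\<And>x y. x \<in> S \<Longrightarrow> (\<And>v. v \<in> B \<Longrightarrow> x v = y v) \<Longrightarrow> y \<in> S"
    and tang: "\<And>y. y \<in> S \<Longrightarrow> \<exists>q TT. (\<forall>v. poly (q v) 1 = y v) \<and>
      (\<forall>\<tau>\<in>TT. \<forall>u \<epsilon>. (\<lambda>v. poly (q v) u + \<epsilon> * poly (\<tau> v) u) \<in> S) \<and>
      (\<forall>u. (\<lambda>v. poly (q v) u) \<in> S) \<and>
      (\<forall>\<theta>. (\<forall>\<tau>\<in>TT. (\<Sum>v\<in>B. \<theta> v * poly (\<tau> v) 0) = 0) \<and> (\<Sum>v\<in>B. \<theta> v * b v) = 0 \<longrightarrow>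
        (\<forall>v\<in>B. \<theta> v = 0))"
    and h: "\<And>x t. (\<lambda>v. x v + t * b v) \<in> S \<Longrightarrow> peval x h = 0"
  shows "h = 0"
proof -
  define Z where "Z h \<longleftrightarrow> (\<forall>x t. (\<lambda>v. x v + t * b v) \<in> S \<longrightarrow> peval x h = 0)" for h
  obtain y0 where y0: "y0 \<in> S" using S by blast
  have "Z (dir_deriv (unit_dir v) g)" if Z: "Z g" for g v
    unfolding Z_def
  proof (intro allI impI)
    fix x t assume xt: "(\<lambda>v. x v + t * b v) \<in> S"
    show "peval x (dir_deriv (unit_dir v) g) = 0"
    proof (cases "v \<in> B")
      case False
      show ?thesis
      proof (rule dir_deriv_zero_on_line)
        fix \<epsilon>
        have "(\<lambda>w. (x w + \<epsilon> * unit_dir v w) + t * b w) \<in> S"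
          by (rule cyl[OF xt]) (use False in \<open>simp add: unit_dir_def, blast\<close>)
        then show "peval (\<lambda>w. x w + \<epsilon> * unit_dir v w) g = 0"
          by (rule Z[unfolded Z_def, rule_format])
      qed
    next
      case True
      from tang[OF xt] obtain q TT where q': "(\<forall>v. poly (q v) 1 = x v + t * b v) \<and>
        (\<forall>\<tau>\<in>TT. \<forall>u \<epsilon>. (\<lambda>v. poly (q v) u + \<epsilon> * poly (\<tau> v) u) \<in> S) \<and>
        (\<forall>u. (\<lambda>v. poly (q v) u) \<in> S) \<and>
        (\<forall>\<theta>. (\<forall>\<tau>\<in>TT. (\<Sum>v\<in>B. \<theta> v * poly (\<tau> v) 0) = 0) \<and> (\<Sum>v\<in>B. \<theta> v * b v) = 0 \<longrightarrow>
          (\<forall>v\<in>B. \<theta> v = 0))"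
        by (elim exE)
      have q1: "poly (q v) 1 = x v + t * b v" for v using q' by simp
      have q2: "(\<lambda>v. poly (q v) u + \<epsilon> * poly (\<tau> v) u) \<in> S" if "\<tau> \<in> TT" for \<tau> u \<epsilon>
        using q'[THEN conjunct2, THEN conjunct1] that by simp
      have q3: "(\<lambda>v. poly (q v) u) \<in> S" for u using q' by simp
      note q4 = q'[THEN conjunct2, THEN conjunct2, THEN conjunct2, rule_format]
      define R where "R = insert (\<lambda>v. [:b v:]) TT"
      have inj0: "\<forall>k\<in>B. \<theta> k = 0"
        if "\<forall>\<rho>\<in>R. (\<Sum>k\<in>B. poly (\<rho> k) 0 * \<theta> k) = 0" for \<theta>
      proof -
        have 1: "\<forall>\<tau>\<in>TT. (\<Sum>v\<in>B. \<theta> v * poly (\<tau> v) 0) = 0"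
          using that by (simp add: R_def mult.commute)
        have 2: "(\<Sum>v\<in>B. \<theta> v * b v) = 0"
          using that by (simp add: R_def mult.commute)
        show ?thesis using q4[OF conjI[OF 1 2]] by blast
      qed
      have "\<forall>\<theta>. (\<forall>\<rho>\<in>R. (\<Sum>k\<in>B. poly (\<rho> k) 0 * \<theta> k) = 0) \<longrightarrow> (\<forall>k\<in>B. \<theta> k = 0)"
        using inj0 by simp
      from generic_injectivity[OF B this]
      obtain \<Delta> where \<Delta>: "poly \<Delta> 0 \<noteq> 0" "\<forall>u \<theta>. poly \<Delta> u \<noteq> 0 \<longrightarrow>
        (\<forall>\<rho>\<in>R. (\<Sum>k\<in>B. poly (\<rho> k) u * \<theta> k) = 0) \<longrightarrow> (\<forall>k\<in>B. \<theta> k = 0)" by (elim exE conjE)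
      define X where "X u v = poly (q v) u - t * b v" for u v
      define W where "W w = psubst (\<lambda>a. [:a:]) (\<lambda>v. q v - [:t * b v:]) (dir_deriv (unit_dir w) g)" for w
      have W: "poly (W w) u = peval (X u) (dir_deriv (unit_dir w) g)" for w u
        by (simp add: W_def poly_psubst X_def [abs_def])
      have ann: "(\<Sum>w\<in>B. d w * poly (W w) u) = 0"
        if ex: "\<And>\<epsilon>. \<exists>t'. (\<lambda>v. X u v + \<epsilon> * (if v \<in> B then d v else 0) + t' * b v) \<in> S" for u d
      proof -
        define c where "c v = (if v \<in> B then d v else 0)" for v
        have "peval (X u) (dir_deriv c g) = 0"
        proof (rule dir_deriv_zero_on_line)
          fix \<epsilon>
          from ex[of \<epsilon>] obtain t' where "(\<lambda>v. X u v + \<epsilon> * (if v \<in> B then d v else 0) + t' * b v) \<in> S" ..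
          then show "peval (\<lambda>v. X u v + \<epsilon> * c v) g = 0"
            unfolding c_def by (rule Z[unfolded Z_def, rule_format])
        qed
        then have "(\<Sum>w\<in>B. c w * poly (W w) u) = 0"
          by (subst (asm) dir_deriv_partial[OF B]) (auto simp: c_def W peval.hom_sum peval.hom_mult)
        then show ?thesis by (simp add: c_def)
      qed
      have "poly (W v) u = 0" if "poly \<Delta> u \<noteq> 0" for u
      proof -
        have "\<forall>k\<in>B. poly (W k) u = 0"
        proof (rule \<Delta>(2)[THEN spec, THEN spec, THEN mp, THEN mp, OF that], rule ballI)
          fix \<rho> assume "\<rho> \<in> R"
          show "(\<Sum>k\<in>B. poly (\<rho> k) u * poly (W k) u) = 0"
          proof (rule ann)
            fix \<epsilon>
            show "\<exists>t'. (\<lambda>v. X u v + \<epsilon> * (if v \<in> B then poly (\<rho> v) u else 0) + t' * b v) \<in> S"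
            proof (cases "\<rho> \<in> TT")
              case True
              show ?thesis
                by (rule exI[of _ t], rule cyl[OF q2[OF True, of u \<epsilon>]]) (simp add: X_def)
            next
              case False
              then have "\<rho> = (\<lambda>v. [:b v:])" using \<open>\<rho> \<in> R\<close> by (simp add: R_def)
              then show ?thesis
                by (intro exI[of _ "t - \<epsilon>"] cyl[OF q3[of u]]) (simp add: X_def algebra_simps)
            qed
          qed
        qed
        with True show ?thesis by blast
      qed
      then have "poly (\<Delta> * W v) u = 0" for u by auto
      then have "\<Delta> * W v = 0" using poly_all_0_iff_0 by blast
      moreover have "\<Delta> \<noteq> 0" using \<Delta>(1) by auto
      ultimately have "poly (W v) 1 = 0" by simp
      moreover have "X 1 = x" by (rule ext) (simp add: X_def q1)
      ultimately show ?thesis by (simp add: W)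
    qed
  qed
  then show ?thesis
  proof (rule zero_if_derivatives_zero)
    show "Z h" using h by (simp add: Z_def)
    show "peval y0 g = 0" if "Z g" for g
      using that[unfolded Z_def, rule_format, of y0 0] y0 by simp
    show "Z (f + g)" if "Z f" "Z g" for f g
      using that by (simp add: Z_def peval_simps)
    show "Z (Cst a * f)" if "Z f" for a f
      using that by (simp add: Z_def peval_simps)
  qed
qed

section \<open>The determinant of the flattening\<close>

text \<open>The basis of \<open>V \<otimes> \<And>\<^sup>2 W\<close>, with \<open>s\<close> the dimension of \<open>W\<close>; \<^const>\<open>segre_grassmann_basis\<close> counts
  projective dimensions.\<close>

definition tensor_basis :: "nat \<Rightarrow> (nat \<times> nat list) set" where
  "tensor_basis s = {(i, [j, k]) | i j k. i < 3 \<and> j < k \<and> k < s}"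

lemma segre_grassmann_basis_eq: "segre_grassmann_basis 2 1 n = tensor_basis (Suc n)"
proof -
  have "length js = 2 \<and> sorted_wrt (<) js \<and> set js \<subseteq> {..n} \<longleftrightarrow>
      (\<exists>j k. js = [j, k] \<and> j < k \<and> k < Suc n)" for js
    by (cases js; cases "tl js"; cases "tl (tl js)") auto
  then show ?thesis
    unfolding segre_grassmann_basis_def tensor_basis_def by (auto simp: less_Suc_eq_le numeral_3_eq_3 numeral_2_eq_2)
qed

lemma finite_tensor_basis: "finite (tensor_basis s)"
proof -
  have "tensor_basis s \<subseteq> (\<lambda>(i, j, k). (i, [j, k])) ` ({..<3} \<times> {..<s} \<times> {..<s})"
    by (force simp: tensor_basis_def image_iff)
  then show ?thesis by (rule finite_subset) auto
qed

definition skew_entry :: "(nat \<times> nat list \<Rightarrow> 'a::comm_ring_1) \<Rightarrow> nat \<Rightarrow> nat \<Rightarrow> nat \<Rightarrow> 'a" where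
  "skew_entry x c j k = (if j < k then x (c, [j, k]) else if k < j then - x (c, [k, j]) else 0)"

text \<open>Entry \<open>(j, k)\<close> of the block \<open>(\<beta>, \<gamma>)\<close> of the flattening.\<close>

definition flattening_entry :: "(nat \<times> nat list \<Rightarrow> 'a::comm_ring_1) \<Rightarrow> nat \<Rightarrow> nat \<Rightarrow> nat \<Rightarrow> nat \<Rightarrow> 'a" where
  "flattening_entry x \<beta> \<gamma> j k = 
     (if \<beta> = 0 \<and> \<gamma> = 1 then skew_entry x 0 j k else if \<beta> = 0 \<and> \<gamma> = 2 then - skew_entry x 1 j k
      else if \<beta> = 1 \<and> \<gamma> = 0 then - skew_entry x 0 j k else if \<beta> = 1 \<and> \<gamma> = 2 then skew_entry x 2 j k
      else if \<beta> = 2 \<and> \<gamma> = 0 then skew_entry x 1 j k else if \<beta> = 2 \<and> \<gamma> = 1 then - skew_entry x 2 j k else 0)"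

lemma less_3_cases: "(\<beta>::nat) < 3 \<longleftrightarrow> \<beta> = 0 \<or> \<beta> = 1 \<or> \<beta> = 2" by auto

lemma exterior_flattening_eq:
  "exterior_flattening s x = mat (3 * s) (3 * s) (\<lambda>(a, b). flattening_entry x (a div s) (b div s) (a mod s) (b mod s))"
proof (rule eq_matI)
  fix a b assume ab: "a < dim_row (mat (3 * s) (3 * s) (\<lambda>(a, b). flattening_entry x (a div s) (b div s) (a mod s) (b mod s)))"
    "b < dim_col (mat (3 * s) (3 * s) (\<lambda>(a, b). flattening_entry x (a div s) (b div s) (a mod s) (b mod s)))"
  then have s: "s > 0" by (cases s) auto
  have "a div s < 3" "b div s < 3" using ab s by (simp_all add: less_mult_imp_div_less)
  moreover have "a mod s < s" "b mod s < s" using s by auto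
  moreover have sl: "skew_slice s x i $$ (j, k) = skew_entry x i j k" "skew_slice s x i \<in> carrier_mat s s"
    if "j < s" "k < s" for i j k
    using that by (simp_all add: skew_slice_def skew_entry_def)
  have "([[0\<^sub>m s s, skew_slice s x 0, - skew_slice s x 1], [- skew_slice s x 0, 0\<^sub>m s s, skew_slice s x 2],
      [skew_slice s x 1, - skew_slice s x 2, 0\<^sub>m s s]] ! \<beta> ! \<gamma>) $$ (j, k) = flattening_entry x \<beta> \<gamma> j k"
    if "\<beta> < 3" "\<gamma> < 3" "j < s" "k < s" for \<beta> \<gamma> j k
    using that(1,2) sl[OF that(3,4)] that(3,4) unfolding less_3_cases
    by (elim disjE) (simp_all add: flattening_entry_def skew_slice_def skew_entry_def)
  ultimately show "exterior_flattening s x $$ (a, b) =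
      mat (3 * s) (3 * s) (\<lambda>(a, b). flattening_entry x (a div s) (b div s) (a mod s) (b mod s)) $$ (a, b)"
    using ab by (simp add: exterior_flattening_def Let_def)
qed (simp_all add: exterior_flattening_def Let_def)

lemma sum_div_mod: "(\<Sum>b<n * s. F (b div s) (b mod s)) = (\<Sum>\<gamma><n. \<Sum>k<s. F \<gamma> k)"
  for F :: "nat \<Rightarrow> nat \<Rightarrow> 'a::comm_monoid_add"
proof -
  have "(\<Sum>b<n * s. F (b div s) (b mod s)) = (\<Sum>\<gamma><n. \<Sum>b=\<gamma> * s..<\<gamma> * s + s. F (b div s) (b mod s))"
    by (rule sum.nat_group[symmetric])
  also have "\<dots> = (\<Sum>\<gamma><n. \<Sum>k<s. F \<gamma> k)"
  proof (rule sum.cong[OF refl])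
    fix \<gamma>
    have "(\<Sum>b=\<gamma> * s..<\<gamma> * s + s. F (b div s) (b mod s)) =
        (\<Sum>k=0..<s. F ((k + \<gamma> * s) div s) ((k + \<gamma> * s) mod s))"
      using sum.shift_bounds_nat_ivl[of "\<lambda>b. F (b div s) (b mod s)" 0 "\<gamma> * s" s]
      by (simp add: add.commute)
    also have "\<dots> = (\<Sum>k<s. F \<gamma> k)" by (intro sum.cong) auto
    finally show "(\<Sum>b=\<gamma> * s..<\<gamma> * s + s. F (b div s) (b mod s)) = (\<Sum>k<s. F \<gamma> k)" .
  qed
  finally show ?thesis .
qed

lemma prod_div_mod: "(\<Prod>b<n * s. F (b div s) (b mod s)) = (\<Prod>\<gamma><n. \<Prod>k<s. F \<gamma> k)"
  for F :: "nat \<Rightarrow> nat \<Rightarrow> 'a::comm_monoid_mult"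
proof -
  have "(\<Prod>b<n * s. F (b div s) (b mod s)) = (\<Prod>\<gamma><n. \<Prod>b=\<gamma> * s..<\<gamma> * s + s. F (b div s) (b mod s))"
    by (rule prod.nat_group[symmetric])
  also have "\<dots> = (\<Prod>\<gamma><n. \<Prod>k<s. F \<gamma> k)"
  proof (rule prod.cong[OF refl])
    fix \<gamma>
    have "(\<Prod>b=\<gamma> * s..<\<gamma> * s + s. F (b div s) (b mod s)) =
        (\<Prod>k=0..<s. F ((k + \<gamma> * s) div s) ((k + \<gamma> * s) mod s))"
      using prod.shift_bounds_nat_ivl[of "\<lambda>b. F (b div s) (b mod s)" 0 "\<gamma> * s" s]
      by (simp add: add.commute)
    also have "\<dots> = (\<Prod>k<s. F \<gamma> k)" by (intro prod.cong) auto
    finally show "(\<Prod>b=\<gamma> * s..<\<gamma> * s + s. F (b div s) (b mod s)) = (\<Prod>k<s. F \<gamma> k)" .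
  qed
  finally show ?thesis .
qed

lemma sum_less_4: "(\<Sum>e<4. f e) = f 0 + f 1 + f 2 + f (3::nat)"
  for f :: "nat \<Rightarrow> 'a::comm_monoid_add"
  by (simp add: eval_nat_numeral)

definition flat_det :: "nat \<Rightarrow> (nat \<times> nat list \<Rightarrow> 'a::comm_ring_1) \<Rightarrow> 'a" where
  "flat_det s x = det (exterior_flattening s x)"

lemma skew_entry_hom: "comm_ring_hom \<phi> \<Longrightarrow> \<phi> (skew_entry x c j k) = skew_entry (\<lambda>w. \<phi> (x w)) c j k"
proof -
  assume "comm_ring_hom \<phi>"
  then interpret comm_ring_hom \<phi> .
  show ?thesis by (simp add: skew_entry_def hom_uminus)
qed

lemma peval_flat_det: "peval x (flat_det s pvar) = flat_det s x"
proof -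
  have "map_mat (peval x) (exterior_flattening s pvar) = exterior_flattening s x"
    by (rule eq_matI) (auto simp: exterior_flattening_eq flattening_entry_def skew_entry_hom[OF peval_hom] peval.hom_uminus)
  then show ?thesis using peval.hom_det[of x "exterior_flattening s pvar"] by (simp add: flat_det_def)
qed

lemma skew_entry_cong:
  assumes "\<And>w. w \<in> tensor_basis s \<Longrightarrow> x w = y w" "c < 3" "j < s" "k < s"
  shows "skew_entry x c j k = skew_entry y c j k"
proof -
  have "j < k \<Longrightarrow> (c, [j, k]) \<in> tensor_basis s" "k < j \<Longrightarrow> (c, [k, j]) \<in> tensor_basis s" using assms(2-) by (auto simp: tensor_basis_def)
  then show ?thesis using assms(1) by (auto simp: skew_entry_def)
qed

lemma flat_det_cong:
  assumes "\<And>w. w \<in> tensor_basis s \<Longrightarrow> x w = y w"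
  shows "flat_det s x = flat_det s y"
proof -
  have "exterior_flattening s x = exterior_flattening s y"
  proof (rule eq_matI)
    fix a b assume "a < dim_row (exterior_flattening s y)" "b < dim_col (exterior_flattening s y)"
    moreover from this have "s > 0" by (cases s) (auto simp: exterior_flattening_eq)
    ultimately show "exterior_flattening s x $$ (a, b) = exterior_flattening s y $$ (a, b)"
      by (simp add: exterior_flattening_eq flattening_entry_def skew_entry_cong[OF assms])
  qed (simp_all add: exterior_flattening_eq)
  then show ?thesis by (simp add: flat_det_def)
qed

text \<open>Nonvanishing of the determinant is always shown by solving the linear system of the kernel,
  with the unknown vector cut into three blocks.\<close>

lemma flat_det_nonzeroI:
  fixes x :: "nat \<times> nat list \<Rightarrow> complex"
  assumes ker: "\<And>\<kappa>. (\<And>\<beta> j. \<beta> < 3 \<Longrightarrow> j < s \<Longrightarrow> (\<Sum>\<gamma><3. \<Sum>k<s. flattening_entry x \<beta> \<gamma> j k * \<kappa> \<gamma> k) = 0) \<Longrightarrow>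
      (\<And>\<gamma> k. \<gamma> < 3 \<Longrightarrow> k < s \<Longrightarrow> \<kappa> \<gamma> k = 0)"
  shows "flat_det s x \<noteq> 0"
proof
  assume "flat_det s x = 0"
  moreover have car: "exterior_flattening s x \<in> carrier_mat (3 * s) (3 * s)"
    by (simp add: exterior_flattening_eq)
  ultimately obtain v where v: "v \<in> carrier_vec (3 * s)" "v \<noteq> 0\<^sub>v (3 * s)"
    "exterior_flattening s x *\<^sub>v v = 0\<^sub>v (3 * s)"
    unfolding flat_det_def using det_0_iff_vec_prod_zero[OF car] by blast
  have "(\<Sum>\<gamma><3. \<Sum>k<s. flattening_entry x \<beta> \<gamma> j k * v $ (\<gamma> * s + k)) = 0" if "\<beta> < 3" "j < s" for \<beta> j
  proof -
    define a where "a = \<beta> * s + j"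
    have a: "a < 3 * s" "a div s = \<beta>" "a mod s = j"
      using that by (auto simp: a_def less_3_cases)
    have "(exterior_flattening s x *\<^sub>v v) $ a = 0" using v(3) a by simp
    then have "(\<Sum>b<3 * s. flattening_entry x \<beta> (b div s) j (b mod s) * v $ (b div s * s + b mod s)) = 0"
      using a v(1) by (simp add: exterior_flattening_eq scalar_prod_def atLeast0LessThan)
    then show ?thesis by (subst (asm) sum_div_mod)
  qed
  from ker[of "\<lambda>\<gamma> k. v $ (\<gamma> * s + k)", OF this]
  have z: "v $ (\<gamma> * s + k) = 0" if "\<gamma> < 3" "k < s" for \<gamma> k using that by blast
  have "v = 0\<^sub>v (3 * s)"
  proof (rule eq_vecI)
    fix a assume "a < dim_vec (0\<^sub>v (3 * s) :: complex vec)"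
    then have a: "a < 3 * s" by simp
    then have "s > 0" by (cases s) auto
    then have "a div s < 3" "a mod s < s" using a by (simp_all add: less_mult_imp_div_less)
    from z[OF this] show "v $ a = 0\<^sub>v (3 * s) $ a" using a by simp
  qed (use v in auto)
  with v(2) show False by blast
qed

lemma det_low_rank:
  fixes U V :: "nat \<Rightarrow> nat \<Rightarrow> 'a::idom"
  assumes "m < n"
  shows "det (mat n n (\<lambda>(a, b). \<Sum>c<m. U a c * V c b)) = 0"
proof -
  define A where "A = mat n n (\<lambda>(a, c). if c < m then U a c else 0)"
  define C where "C = mat n n (\<lambda>(c, b). if c < m then V c b else 0)"
  have car: "A \<in> carrier_mat n n" "C \<in> carrier_mat n n" by (simp_all add: A_def C_def)
  have "mat n n (\<lambda>(a, b). \<Sum>c<m. U a c * V c b) = A * C"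
  proof (rule eq_matI)
    fix a b assume "a < dim_row (A * C)" "b < dim_col (A * C)"
    then have ab: "a < n" "b < n" by (simp_all add: A_def C_def)
    have "(A * C) $$ (a, b) = (\<Sum>c<n. if c < m then U a c * V c b else 0)"
      using ab by (auto simp: A_def C_def scalar_prod_def atLeast0LessThan intro!: sum.cong)
    also have "\<dots> = (\<Sum>c<m. U a c * V c b)"
      using assms by (intro sum.mono_neutral_cong_right) auto
    finally show "mat n n (\<lambda>(a, b). \<Sum>c<m. U a c * V c b) $$ (a, b) = (A * C) $$ (a, b)"
      using ab by simp
  qed (simp_all add: A_def C_def)
  moreover have "det C = 0"
  proof -
    have "transpose_mat C *\<^sub>v unit_vec n m = 0\<^sub>v n"
      using assms by (intro eq_vecI) (auto simp: C_def scalar_prod_right_unit)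
    moreover have "unit_vec n m \<noteq> (0\<^sub>v n :: 'a vec)" using assms by (simp add: unit_vec_nonzero)
    ultimately have "det (transpose_mat C) = 0"
      using det_0_iff_vec_prod_zero[of "transpose_mat C" n] car(2)
      by (metis transpose_carrier_mat unit_vec_carrier)
    then show ?thesis using det_transpose[OF car(2)] by simp
  qed
  ultimately show ?thesis using det_mult[OF car] by simp
qed

text \<open>The coordinates of \<open>v \<otimes> (a \<and> b)\<close>.\<close>

definition rank_one :: "(nat \<Rightarrow> 'a::comm_ring_1) \<Rightarrow> (nat \<Rightarrow> 'a) \<Rightarrow> (nat \<Rightarrow> 'a) \<Rightarrow> nat \<times> nat list \<Rightarrow> 'a" where
  "rank_one v a b = (\<lambda>(i, js). v i * (a (js ! 0) * b (js ! 1) - a (js ! 1) * b (js ! 0)))"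

text \<open>The sums of \<open>r\<close> decomposable tensors. Coordinates outside the basis are left free, so that
  the set is a cylinder over the tensors of rank at most \<open>r\<close>, and polynomials in arbitrary
  variables can be restricted to it.\<close>

definition rank_le :: "nat \<Rightarrow> nat \<Rightarrow> (nat \<times> nat list \<Rightarrow> complex) set" where
  "rank_le r s = {x. \<exists>v a b. \<forall>w\<in>tensor_basis s. x w = (\<Sum>i<r. rank_one (v i) (a i) (b i) w)}"

text \<open>The cross product matrix of \<open>v\<close> has the form \<open>p q\<^sup>T - q p\<^sup>T\<close>, since every element of the
  exterior square of a three-dimensional space is decomposable.\<close>

lemma cross_factor:
  fixes v :: "nat \<Rightarrow> complex"
  shows "\<exists>(p :: nat \<Rightarrow> complex) (q :: nat \<Rightarrow> complex). p 0 * q 1 - p 1 * q 0 = v 0 \<and> p 0 * q 2 - p 2 * q 0 = - v 1 \<and>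
    p 1 * q 2 - p 2 * q 1 = v 2"
proof -
  consider "v 0 \<noteq> 0" | "v 0 = 0" "v 1 \<noteq> 0" | "v 0 = 0" "v 1 = 0" by blast
  then show ?thesis
  proof cases
    case 1
    then show ?thesis
      by (intro exI[of _ "\<lambda>i::nat. if i = 0 then 1 else if i = 1 then 0 else - v 2 / v 0"]
          exI[of _ "\<lambda>i::nat. if i = 0 then 0 else if i = 1 then v 0 else - v 1"]) auto
  next
    case 2
    then show ?thesis
      by (intro exI[of _ "\<lambda>i::nat. if i = 0 then 1 else if i = 1 then - v 2 / v 1 else 0"]
          exI[of _ "\<lambda>i::nat. if i = 2 then - v 1 else 0"]) auto
  next
    case 3
    then show ?thesis
      by (intro exI[of _ "\<lambda>i::nat. if i = 1 then 1 else 0"] exI[of _ "\<lambda>i::nat. if i = 2 then v 2 else 0"]) auto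
  qed
qed

text \<open>With \<open>p q\<^sup>T - q p\<^sup>T\<close> the cross product matrix of \<open>v\<close>, each term flattens to the Kronecker
  product of \<open>p q\<^sup>T - q p\<^sup>T\<close> and \<open>a b\<^sup>T - b a\<^sup>T\<close>, a sum of four matrices of rank one. So the
  flattening factors through dimension \<open>4 * r\<close>.\<close>

lemma flat_det_rank_le:
  assumes x: "x \<in> rank_le r s" and r: "4 * r < 3 * s"
  shows "flat_det s x = 0"
proof -
  obtain v a b where x: "\<And>w. w \<in> tensor_basis s \<Longrightarrow> x w = (\<Sum>i<r. rank_one (v i) (a i) (b i) w)"
    using x by (auto simp: rank_le_def)
  have "\<forall>i. \<exists>(p :: nat \<Rightarrow> complex) (q :: nat \<Rightarrow> complex). p 0 * q 1 - p 1 * q 0 = v i 0 \<and> p 0 * q 2 - p 2 * q 0 = - v i 1 \<and>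
    p 1 * q 2 - p 2 * q 1 = v i 2" using cross_factor by blast
  then obtain p q :: "nat \<Rightarrow> nat \<Rightarrow> complex" where pq: "\<And>i. p i 0 * q i 1 - p i 1 * q i 0 = v i 0"
    "\<And>i. p i 0 * q i 2 - p i 2 * q i 0 = - v i 1" "\<And>i. p i 1 * q i 2 - p i 2 * q i 1 = v i 2"
    by metis
  have skw_x: "skew_entry x c j k = (\<Sum>i<r. v i c * (a i j * b i k - a i k * b i j))" if "c < 3" "j < s" "k < s" for c j k
  proof -
    have "skew_entry x c j k = skew_entry (\<lambda>w. \<Sum>i<r. rank_one (v i) (a i) (b i) w) c j k"
      by (rule skew_entry_cong[OF x that])
    also have "\<dots> = (\<Sum>i<r. v i c * (a i j * b i k - a i k * b i j))"
      by (auto simp: skew_entry_def rank_one_def sum_negf[symmetric] algebra_simps intro!: sum.cong sum.neutral)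
    finally show ?thesis .
  qed
  have flx: "flattening_entry x \<beta> \<gamma> j k = (\<Sum>i<r. (p i \<beta> * q i \<gamma> - p i \<gamma> * q i \<beta>) * (a i j * b i k - a i k * b i j))"
    if "\<beta> < 3" "\<gamma> < 3" "j < s" "k < s" for \<beta> \<gamma> j k
  proof -
    have m: "p i 1 * q i 0 - p i 0 * q i 1 = - v i 0" "p i 2 * q i 0 - p i 0 * q i 2 = v i 1"
      "p i 2 * q i 1 - p i 1 * q i 2 = - v i 2" for i
      using pq[of i] by (simp_all add: algebra_simps)
    show ?thesis using that unfolding less_3_cases[of \<beta>] less_3_cases[of \<gamma>]
      by (elim disjE) (simp_all add: flattening_entry_def skw_x pq m sum_negf del: One_nat_def)
  qed
  \<comment> \<open>The four products of the expansion of \<open>(p q\<^sup>T - q p\<^sup>T) \<otimes> (a b\<^sup>T - b a\<^sup>T)\<close>, indexed by \<open>e\<close>.\<close>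
  define U' where "U' i e \<beta> j = (if e = 0 then p i \<beta> * a i j else if e = 1 then - p i \<beta> * b i j
     else if e = 2 then - q i \<beta> * a i j else q i \<beta> * b i j)" for i e \<beta> j :: nat
  define V' where "V' i e \<beta> j = (if e = 0 then q i \<beta> * b i j else if e = 1 then q i \<beta> * a i j
     else if e = 2 then p i \<beta> * b i j else p i \<beta> * a i j)" for i e \<beta> j :: nat
  define U where "U \<alpha> c = U' (c div 4) (c mod 4) (\<alpha> div s) (\<alpha> mod s)" for \<alpha> c
  define V where "V c \<alpha> = V' (c div 4) (c mod 4) (\<alpha> div s) (\<alpha> mod s)" for \<alpha> c
  have "exterior_flattening s x = mat (3 * s) (3 * s) (\<lambda>(\<alpha>, \<alpha>'). \<Sum>c<r * 4. U \<alpha> c * V c \<alpha>')"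
  proof (rule eq_matI)
    fix \<alpha> \<alpha>' assume "\<alpha> < dim_row (mat (3 * s) (3 * s) (\<lambda>(\<alpha>, \<alpha>'). \<Sum>c<r * 4. U \<alpha> c * V c \<alpha>'))"
      "\<alpha>' < dim_col (mat (3 * s) (3 * s) (\<lambda>(\<alpha>, \<alpha>'). \<Sum>c<r * 4. U \<alpha> c * V c \<alpha>'))"
    then have \<alpha>: "\<alpha> < 3 * s" "\<alpha>' < 3 * s" by auto
    then have s: "s > 0" by (cases s) auto
    have l: "\<alpha> div s < 3" "\<alpha>' div s < 3" "\<alpha> mod s < s" "\<alpha>' mod s < s"
      using \<alpha> s by (simp_all add: less_mult_imp_div_less)
    have "(\<Sum>c<r * 4. U \<alpha> c * V c \<alpha>') = (\<Sum>i<r. \<Sum>e<4. U' i e (\<alpha> div s) (\<alpha> mod s) * V' i e (\<alpha>' div s) (\<alpha>' mod s))"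
      unfolding U_def V_def by (rule sum_div_mod)
    also have "\<dots> = flattening_entry x (\<alpha> div s) (\<alpha>' div s) (\<alpha> mod s) (\<alpha>' mod s)"
      unfolding flx[OF l] sum_less_4
      by (rule sum.cong[OF refl]) (simp add: U'_def V'_def algebra_simps)
    finally show "exterior_flattening s x $$ (\<alpha>, \<alpha>') =
        mat (3 * s) (3 * s) (\<lambda>(\<alpha>, \<alpha>'). \<Sum>c<r * 4. U \<alpha> c * V c \<alpha>') $$ (\<alpha>, \<alpha>')"
      using \<alpha> by (simp add: exterior_flattening_eq)
  qed (simp_all add: exterior_flattening_eq)
  then show ?thesis unfolding flat_det_def using det_low_rank[of "r * 4" "3 * s" U V] r by simp
qed

lemma homogeneous_of_degree_mdeg: "homogeneous_of_degree d f \<longleftrightarrow> (\<forall>m\<in>keys f. mdeg m = d)"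
  by (simp add: homogeneous_of_degree_def mdeg_def)

lemma mdeg_add: "mdeg (m + n) = mdeg m + mdeg n"
proof -
  have fin: "finite (keys m \<union> keys n)" by simp
  have *: "mdeg k = (\<Sum>v\<in>keys m \<union> keys n. lookup k v)" if "keys k \<subseteq> keys m \<union> keys n" for k
    unfolding mdeg_def by (rule sum.mono_neutral_left) (use that in \<open>auto simp: in_keys_iff\<close>)
  show ?thesis using Poly_Mapping.keys_add[of m n] by (simp add: * lookup_add sum.distrib)
qed

lemma homogeneous_of_degree_add: "homogeneous_of_degree d f \<Longrightarrow> homogeneous_of_degree d g \<Longrightarrow> homogeneous_of_degree d (f + g)"
  using Poly_Mapping.keys_add[of f g] by (auto simp: homogeneous_of_degree_mdeg)

lemma homogeneous_of_degree_mult: 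
  assumes "homogeneous_of_degree d f" "homogeneous_of_degree e g"
  shows "homogeneous_of_degree (d + e) (f * g)"
  unfolding homogeneous_of_degree_mdeg
proof
  fix m assume "m \<in> keys (f * g)"
  then obtain a b where "m = a + b" "a \<in> keys f" "b \<in> keys g" using keys_mult[of f g] by blast
  then show "mdeg m = d + e" using assms by (simp add: homogeneous_of_degree_mdeg mdeg_add)
qed

lemma homogeneous_of_degree_0 [simp]: "homogeneous_of_degree d 0" by (simp add: homogeneous_of_degree_mdeg)
lemma homogeneous_of_degree_1 [simp]: "homogeneous_of_degree 0 1" by (simp add: homogeneous_of_degree_mdeg mdeg_def)
lemma homogeneous_of_degree_uminus: "homogeneous_of_degree d f \<Longrightarrow> homogeneous_of_degree d (- f)" by (simp add: homogeneous_of_degree_mdeg)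
lemma homogeneous_of_degree_pvar: "homogeneous_of_degree (Suc 0) (pvar v)" by (simp add: homogeneous_of_degree_mdeg pvar_def mdeg_def)

lemma homogeneous_of_degree_sum: "(\<And>i. i \<in> A \<Longrightarrow> homogeneous_of_degree d (F i)) \<Longrightarrow> homogeneous_of_degree d (sum F A)"
  by (induction A rule: infinite_finite_induct) (auto intro: homogeneous_of_degree_add)

lemma homogeneous_of_degree_prod: "finite A \<Longrightarrow> (\<And>i. i \<in> A \<Longrightarrow> homogeneous_of_degree 1 (F i)) \<Longrightarrow> homogeneous_of_degree (card A) (prod F A)"
proof (induction A rule: finite_induct)
  case (insert a A)
  then show ?case using homogeneous_of_degree_mult[of 1 "F a" "card A" "prod F A"] by simp
qed simp

lemma flat_det_homogeneous: "homogeneous_of_degree (3 * s) (flat_det s pvar)" and flat_det_in_vars: "in_vars (tensor_basis s) (flat_det s pvar)"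
proof -
  let ?M = "exterior_flattening s pvar :: (nat \<times> nat list) cpoly mat"
  have ent: "homogeneous_of_degree 1 (?M $$ (a, b)) \<and> in_vars (tensor_basis s) (?M $$ (a, b))" if "a < 3 * s" "b < 3 * s" for a b
  proof -
    have s: "s > 0" using that by (cases s) auto
    have "homogeneous_of_degree 1 (skew_entry pvar c j k) \<and> in_vars (tensor_basis s) (skew_entry pvar c j k)" if "c < 3" "j < s" "k < s" for c j k
      using that by (auto simp: skew_entry_def tensor_basis_def intro!: homogeneous_of_degree_pvar homogeneous_of_degree_uminus in_vars_uminus in_vars_pvar)
    then show ?thesis using that s
      by (auto simp: exterior_flattening_eq flattening_entry_def intro!: homogeneous_of_degree_uminus in_vars_uminus)
  qed
  have sgn: "of_int (sign p) * f = f \<or> of_int (sign p) * f = - f" for p :: "nat \<Rightarrow> nat" and f :: "(nat \<times> nat list) cpoly"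
    by (auto simp: sign_def)
  have car: "?M \<in> carrier_mat (3 * s) (3 * s)" by (simp add: exterior_flattening_eq)
  note det = det_def'[OF car]
  have pp: "p i < 3 * s" if "p permutes {0..<3 * s}" "i < 3 * s" for p i
    using permutes_in_image[OF that(1), of i] that(2) by simp
  show "homogeneous_of_degree (3 * s) (flat_det s pvar)" unfolding flat_det_def det
  proof (rule homogeneous_of_degree_sum)
    fix p assume p: "p \<in> {p. p permutes {0..<3 * s}}"
    have "homogeneous_of_degree (card {0..<3 * s}) (\<Prod>i = 0..<3 * s. ?M $$ (i, p i))"
      using ent pp p by (intro homogeneous_of_degree_prod) auto
    then have "homogeneous_of_degree (3 * s) (\<Prod>i = 0..<3 * s. ?M $$ (i, p i))" by simp
    then show "homogeneous_of_degree (3 * s) (signof p * (\<Prod>i = 0..<3 * s. ?M $$ (i, p i)))"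
      by (cases rule: disjE[OF sgn[of p "\<Prod>i = 0..<3 * s. ?M $$ (i, p i)"]])
        (simp_all only: homogeneous_of_degree_uminus)
  qed
  show "in_vars (tensor_basis s) (flat_det s pvar)" unfolding flat_det_def det
  proof (rule in_vars_sum)
    fix p assume p: "p \<in> {p. p permutes {0..<3 * s}}"
    have "in_vars (tensor_basis s) (\<Prod>i = 0..<3 * s. ?M $$ (i, p i))"
      using ent pp p by (intro in_vars_prod) auto
    then show "in_vars (tensor_basis s) (signof p * (\<Prod>i = 0..<3 * s. ?M $$ (i, p i)))"
      by (cases rule: disjE[OF sgn[of p "\<Prod>i = 0..<3 * s. ?M $$ (i, p i)"]])
        (simp_all only: in_vars_uminus)
  qed
qed

text \<open>Interpolating \<open>v\<close>, \<open>a\<close> and \<open>b\<close> linearly in every term joins two sums of \<open>r\<close> terms by a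
  polynomial curve of such sums.\<close>

lemma rank_le_connected:
  assumes "x \<in> rank_le r s" "y \<in> rank_le r s"
  shows "\<exists>p. (\<forall>v. poly (p v) 0 = x v) \<and> (\<forall>v. poly (p v) 1 = y v) \<and>
      (\<forall>u. (\<lambda>v. poly (p v) u) \<in> rank_le r s)"
proof -
  obtain v a b where x: "\<And>w. w \<in> tensor_basis s \<Longrightarrow> x w = (\<Sum>i<r. rank_one (v i) (a i) (b i) w)"
    using assms(1) by (auto simp: rank_le_def)
  obtain v' a' b' where y: "\<And>w. w \<in> tensor_basis s \<Longrightarrow> y w = (\<Sum>i<r. rank_one (v' i) (a' i) (b' i) w)"
    using assms(2) by (auto simp: rank_le_def)
  define ln where "ln c d = [:c, d - c:]" for c d :: complex
  define p where "p w = (if w \<in> tensor_basis s then \<Sum>i<r. rank_one (\<lambda>j. ln (v i j) (v' i j)) (\<lambda>j. ln (a i j) (a' i j))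
    (\<lambda>j. ln (b i j) (b' i j)) w else ln (x w) (y w))" for w
  have pd: "poly (rank_one (\<lambda>j. F j) (\<lambda>j. G j) (\<lambda>j. K j) w) u =
      rank_one (\<lambda>j. poly (F j) u) (\<lambda>j. poly (G j) u) (\<lambda>j. poly (K j) u) w" for F G K w u
    by (simp add: rank_one_def split: prod.split)
  show ?thesis
  proof (intro exI[of _ p] conjI allI)
    fix w show "poly (p w) 0 = x w" "poly (p w) 1 = y w"
      by (cases "w \<in> tensor_basis s"; simp add: p_def poly_sum pd x y ln_def)+
  next
    fix u
    show "(\<lambda>v. poly (p v) u) \<in> rank_le r s" unfolding rank_le_def
      by (intro CollectI exI[of _ "\<lambda>i j. poly (ln (v i j) (v' i j)) u"]
          exI[of _ "\<lambda>i j. poly (ln (a i j) (a' i j)) u"]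
          exI[of _ "\<lambda>i j. poly (ln (b i j) (b' i j)) u"] ballI) (simp add: p_def poly_sum pd)
  qed
qed

section \<open>Torus weights and sparse tensors\<close>

text \<open>The indeterminate divides one of the two factors, as long as the product is not constant.\<close>

lemma monom_factor:
  fixes p q :: "'a::idom poly"
  assumes "p * q = monom c m" "c \<noteq> 0"
  shows "\<exists>a i b j. p = monom a i \<and> q = monom b j \<and> i + j = m"
  using assms
proof (induction m arbitrary: p q)
  case 0
  have "p \<noteq> 0" "q \<noteq> 0" using 0 by auto
  then have "degree p + degree q = 0" using 0 by (metis degree_mult_eq degree_monom_eq)
  then obtain a b where "p = [:a:]" "q = [:b:]" by (metis add_is_0 degree_eq_zeroE)
  then show ?case by (intro exI[of _ a] exI[of _ 0] exI[of _ b]) (simp add: monom_0)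
next
  case (Suc m)
  have "coeff p 0 * coeff q 0 = coeff (p * q) 0" by (simp add: coeff_mult)
  also have "\<dots> = 0" using Suc.prems by simp
  finally consider "coeff p 0 = 0" | "coeff q 0 = 0" by auto
  then show ?case
  proof cases
    case 1
    then obtain p' where p': "p = pCons 0 p'" by (cases p) auto
    have "pCons 0 (p' * q) = pCons 0 (monom c m)" using Suc.prems by (simp add: p' monom_Suc)
    then have "p' * q = monom c m" by simp
    from Suc.IH[OF this Suc.prems(2)] obtain a i b j where "p' = monom a i" "q = monom b j" "i + j = m" by blast
    then show ?thesis by (intro exI[of _ a] exI[of _ "Suc i"] exI[of _ b] exI[of _ j]) (simp add: p' monom_Suc)
  next
    case 2
    then obtain q' where q': "q = pCons 0 q'" by (cases q) auto
    have "pCons 0 (p * q') = pCons 0 (monom c m)" using Suc.prems by (simp add: q' monom_Suc)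
    then have "p * q' = monom c m" by simp
    from Suc.IH[OF this Suc.prems(2)] obtain a i b j where "p = monom a i" "q' = monom b j" "i + j = m" by blast
    then show ?thesis by (intro exI[of _ a] exI[of _ i] exI[of _ b] exI[of _ "Suc j"]) (simp add: q' monom_Suc)
  qed
qed

text \<open>Homogeneity for the one-parameter group that scales the variable \<open>v\<close> by \<open>t\<close> to the power
  \<open>wt v\<close>. It is stated for values, including \<open>t = 0\<close>.\<close>

definition has_weight :: "('v \<Rightarrow> nat) \<Rightarrow> nat \<Rightarrow> 'v cpoly \<Rightarrow> bool" where
  "has_weight wt n P \<longleftrightarrow> (\<forall>t x. peval (\<lambda>v. t ^ wt v * x v) P = t ^ n * peval x P)"

text \<open>Factors of a weighted homogeneous polynomial are weighted homogeneous: scaling the variables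
  by powers of an indeterminate \<open>t\<close> turns the product into a monomial in \<open>t\<close>, whose factors are
  monomials.\<close>

lemma weight_factors:
  fixes P Q :: "'v::linorder cpoly"
  assumes "P * Q \<noteq> 0"
    and sc: "\<And>t x. t \<noteq> 0 \<Longrightarrow> peval (\<lambda>v. t ^ wt v * x v) (P * Q) = t ^ m * peval x (P * Q)"
  obtains n1 n2 where "n1 + n2 = m" "has_weight wt n1 P" "has_weight wt n2 Q"
proof -
  have hC: "comm_ring_hom (\<lambda>a. [:Cst a:] :: 'v cpoly poly)" by (rule const_poly_hom[OF Cst_hom])
  define gr where "gr = psubst (\<lambda>a. [:Cst a:]) (\<lambda>v. monom (pvar v) (wt v) :: 'v cpoly poly)"
  interpret gr: comm_ring_hom gr unfolding gr_def by (rule psubst_hom[OF hC])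
  have ev: "peval x (poly (gr f) (Cst t)) = peval (\<lambda>v. t ^ wt v * x v) f" for x f t
    by (rule hom_eqI[where \<phi> = "\<lambda>f. peval x (poly (gr f) (Cst t))"],
        rule comp_hom[OF peval_hom comp_hom[OF poly_hom gr.comm_ring_hom_axioms]], rule peval_hom)
      (simp_all add: gr_def psubst_Cst[OF hC] psubst_pvar[OF hC] poly_monom peval_simps)
  have "gr (P * Q) - monom (P * Q) m = 0"
  proof (intro poly_eqI peval_eqI)
    fix x i
    define F where "F = map_poly (peval x) (gr (P * Q) - monom (P * Q) m)"
    \<comment> \<open>The scaling rule is given for \<open>t \<noteq> 0\<close> only, so the identity is first multiplied by \<open>t\<close>.\<close>
    have "poly F t = 0" if "t \<noteq> 0" for t
      using sc[OF that, of x]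
      by (simp add: F_def peval_poly[symmetric] peval.hom_minus ev poly_monom peval.hom_mult peval.hom_power)
    then have "poly ([:0, 1:] * F) t = 0" for t by (cases "t = 0") auto
    then have "[:0, 1:] * F = 0" using poly_all_0_iff_0 by blast
    then have "F = 0" by simp
    then have "coeff F i = 0" by simp
    then show "peval x (coeff (gr (P * Q) - monom (P * Q) m) i) = peval x (coeff 0 i)"
      by (simp add: F_def coeff_map_poly)
  qed
  then have "gr P * gr Q = monom (P * Q) m" by (simp add: gr.hom_mult)
  from monom_factor[OF this assms(1)] obtain a i b j where
    "gr P = monom a i" "gr Q = monom b j" and ij: "i + j = m" by blast
  moreover have "has_weight wt i f" if "gr f = monom a i" for f a i
  proof -
    have *: "peval (\<lambda>v. t ^ wt v * x v) f = peval x a * t ^ i" for t x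
      using ev[of x f t] by (simp add: that poly_monom peval_simps)
    from *[of 1] have "peval x f = peval x a" for x by simp
    with * show ?thesis by (simp add: has_weight_def mult.commute)
  qed
  ultimately show ?thesis using that[OF ij] by blast
qed

lemma has_weight_prod:
  assumes "finite J" "\<And>j. j \<in> J \<Longrightarrow> has_weight (wt j) (b j) P"
  shows "peval (\<lambda>v. (\<Prod>j\<in>J. g j ^ wt j v) * x v) P = (\<Prod>j\<in>J. g j ^ b j) * peval x P"
  using assms
proof (induction J)
  case (insert j J)
  then have "peval (\<lambda>v. g j ^ wt j v * ((\<Prod>j\<in>J. g j ^ wt j v) * x v)) P =
      g j ^ b j * ((\<Prod>j\<in>J. g j ^ b j) * peval x P)"
    by (simp add: has_weight_def)
  then show ?case using insert.hyps by (simp add: mult.assoc)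
qed simp

lemma det_scale:
  fixes A :: "nat \<Rightarrow> nat \<Rightarrow> 'a::comm_ring_1"
  shows "det (mat n n (\<lambda>(i, j). \<rho> i * \<sigma> j * A i j)) = (\<Prod>i<n. \<rho> i) * (\<Prod>j<n. \<sigma> j) * det (mat n n (\<lambda>(i, j). A i j))"
proof -
  have "(\<Prod>i = 0..<n. \<rho> i * \<sigma> (p i) * A i (p i)) = (\<Prod>i<n. \<rho> i) * (\<Prod>j<n. \<sigma> j) * (\<Prod>i = 0..<n. A i (p i))"
    if "p permutes {0..<n}" for p
    using prod.permute[OF that, of \<sigma>] by (simp add: prod.distrib atLeast0LessThan o_def)
  moreover have "(\<Prod>i = 0..<n. mat n n f $$ (i, p i)) = (\<Prod>i = 0..<n. f (i, p i))"
    if "p permutes {0..<n}" for p and f :: "nat \<times> nat \<Rightarrow> 'a"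
    using permutes_in_image[OF that] by (intro prod.cong) auto
  ultimately show ?thesis
    by (simp add: det_def'[of _ n] sum_distrib_left mult_ac)
qed

text \<open>The weight of the one-parameter group that scales the basis vector \<open>w\<^sub>j\<close> of \<open>W\<close>.\<close>

definition index_count :: "nat \<Rightarrow> nat \<times> nat list \<Rightarrow> nat" where
  "index_count j w = (if snd w ! 0 = j then 1 else 0) + (if snd w ! 1 = j then 1 else 0)"

text \<open>The weight that scales the variables outside the basis. A factor of the determinant could a
  priori contain such variables.\<close>

definition outside_weight :: "nat \<Rightarrow> nat \<times> nat list \<Rightarrow> nat" where
  "outside_weight s w = (if w \<in> tensor_basis s then 0 else 1)"

lemma flat_det_scale:
  fixes x y :: "nat \<times> nat list \<Rightarrow> complex"
  assumes "\<And>\<beta> \<gamma> j k. \<beta> < 3 \<Longrightarrow> \<gamma> < 3 \<Longrightarrow> j < s \<Longrightarrow> k < s \<Longrightarrow> flattening_entry y \<beta> \<gamma> j k = \<rho> \<beta> j * \<sigma> \<gamma> k * flattening_entry x \<beta> \<gamma> j k"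
  shows "flat_det s y = (\<Prod>\<beta><3. \<Prod>j<s. \<rho> \<beta> j) * (\<Prod>\<beta><3. \<Prod>j<s. \<sigma> \<beta> j) * flat_det s x"
proof -
  have "exterior_flattening s y = mat (3 * s) (3 * s) (\<lambda>(a, b). \<rho> (a div s) (a mod s) * \<sigma> (b div s) (b mod s) *
      flattening_entry x (a div s) (b div s) (a mod s) (b mod s))"
  proof (rule eq_matI)
    fix a b assume "a < dim_row (mat (3 * s) (3 * s) (\<lambda>(a, b). \<rho> (a div s) (a mod s) * \<sigma> (b div s) (b mod s) *
        flattening_entry x (a div s) (b div s) (a mod s) (b mod s)))"
      "b < dim_col (mat (3 * s) (3 * s) (\<lambda>(a, b). \<rho> (a div s) (a mod s) * \<sigma> (b div s) (b mod s) *
        flattening_entry x (a div s) (b div s) (a mod s) (b mod s)))"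
    then have ab: "a < 3 * s" "b < 3 * s" by auto
    then have s: "s > 0" by (cases s) auto
    have "a div s < 3" "b div s < 3" "a mod s < s" "b mod s < s"
      using ab s by (simp_all add: less_mult_imp_div_less)
    then show "exterior_flattening s y $$ (a, b) = mat (3 * s) (3 * s) (\<lambda>(a, b). \<rho> (a div s) (a mod s) * \<sigma> (b div s) (b mod s) *
        flattening_entry x (a div s) (b div s) (a mod s) (b mod s)) $$ (a, b)"
      using ab by (simp add: exterior_flattening_eq assms)
  qed (simp_all add: exterior_flattening_eq)
  then show ?thesis
    by (simp only: flat_det_def exterior_flattening_eq[of s x] det_scale prod_div_mod)
qed

lemma prod_if_point:
  assumes "j < (s::nat)"
  shows "(\<Prod>k<s. if k = j then t else 1) = (t :: 'a::comm_monoid_mult)"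
  using assms by (simp add: prod.delta)

text \<open>Scaling \<open>w\<^sub>j\<close> scales one row and one column of the flattening in each of the three blocks.\<close>

lemma flat_det_scale_W:
  assumes "j < s"
  shows "flat_det s (\<lambda>w. t ^ index_count j w * x w) = t ^ 6 * flat_det s (x :: nat \<times> nat list \<Rightarrow> complex)"
proof -
  define \<tau> where "\<tau> k = (if k = j then t else 1)" for k
  have "skew_entry (\<lambda>w. t ^ index_count j w * x w) c p q = \<tau> p * \<tau> q * skew_entry x c p q" for c p q
    by (auto simp: skew_entry_def index_count_def \<tau>_def power2_eq_square)
  then have "flattening_entry (\<lambda>w. t ^ index_count j w * x w) \<beta> \<gamma> p q = \<tau> p * \<tau> q * flattening_entry x \<beta> \<gamma> p q" for \<beta> \<gamma> p q
    by (simp add: flattening_entry_def)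
  from flat_det_scale[of s "\<lambda>w. t ^ index_count j w * x w" "\<lambda>\<beta>. \<tau>" "\<lambda>\<beta>. \<tau>", OF this]
  show ?thesis using assms by (simp add: \<tau>_def prod_if_point)
qed

text \<open>The block \<open>(\<beta>, \<gamma>)\<close> contains the slice \<open>\<beta> + \<gamma> - 1\<close> in the numbering of the slices from 0, so
  scaling the slice \<open>c\<close> by \<open>t\<^sup>c\<close> scales the block rows by \<open>t\<^sup>\<beta>\<close> and the block columns by
  \<open>t\<^sup>\<gamma>\<^sup>-\<^sup>1\<close>.\<close>

lemma flat_det_scale_V:
  assumes "t \<noteq> 0"
  shows "flat_det s (\<lambda>w. t ^ fst w * x w) = t ^ (3 * s) * flat_det s (x :: nat \<times> nat list \<Rightarrow> complex)"
proof -
  have "skew_entry (\<lambda>w. t ^ fst w * x w) c p q = t ^ c * skew_entry x c p q" for c p q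
    by (auto simp: skew_entry_def)
  then have "flattening_entry (\<lambda>w. t ^ fst w * x w) \<beta> \<gamma> p q = t ^ \<beta> * (t ^ \<gamma> / t) * flattening_entry x \<beta> \<gamma> p q" 
    if "\<beta> < 3" "\<gamma> < 3" for \<beta> \<gamma> p q
    using that assms by (auto simp: flattening_entry_def less_3_cases power2_eq_square)
  from flat_det_scale[of s "\<lambda>w. t ^ fst w * x w" "\<lambda>\<beta> _. t ^ \<beta>" "\<lambda>\<gamma> _. t ^ \<gamma> / t" x, OF this]
  have "flat_det s (\<lambda>w. t ^ fst w * x w) = ((\<Prod>\<beta><3. (t ^ \<beta>) ^ s) * (\<Prod>\<beta><3. (t ^ \<beta> / t) ^ s)) * flat_det s x"
    by simp
  also have "(\<Prod>\<beta><3. (t ^ \<beta>) ^ s) * (\<Prod>\<beta><3. (t ^ \<beta> / t) ^ s) = ((\<Prod>\<beta><3. t ^ \<beta>) * (\<Prod>\<beta><3. t ^ \<beta> / t)) ^ s"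
    by (simp add: prod_power_distrib power_mult_distrib)
  also have "(\<Prod>\<beta><3. t ^ \<beta>) * (\<Prod>\<beta><3. t ^ \<beta> / t) = t ^ 3"
    using assms by (simp add: eval_nat_numeral)
  finally show ?thesis by (simp add: power_mult)
qed

text \<open>The element \<open>(c, p, p')\<close> stands for the summand \<open>v\<^sub>c \<otimes> (w\<^sub>p \<and> w\<^sub>p')\<close> of a tensor in four
  vectors of \<open>W\<close>. The two types differ by the exchange of \<open>v\<^sub>0\<close> and \<open>v\<^sub>1\<close>.\<close>

definition edges4 :: "bool \<Rightarrow> (nat \<times> nat \<times> nat) set" where
  "edges4 tp = (if tp then {(1, 0, 1), (1, 2, 3), (0, 0, 3), (2, 1, 2)}
     else {(0, 0, 1), (0, 2, 3), (1, 0, 3), (2, 1, 2)})"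

text \<open>The indices of \<open>W\<close> are cut into one block \<open>{0, 1, 2}\<close>, which carries the tensor \<open>v\<^sub>0 \<otimes> (w\<^sub>1
  \<and> w\<^sub>2) + v\<^sub>1 \<otimes> (w\<^sub>2 \<and> w\<^sub>0) + v\<^sub>2 \<otimes> (w\<^sub>0 \<and> w\<^sub>1)\<close>, and blocks of four indices. The parameter \<open>tp\<close>
  selects the type of the first block of four; the others have the type \<open>False\<close>.\<close>

definition edge :: "bool \<Rightarrow> nat \<Rightarrow> nat \<Rightarrow> nat \<Rightarrow> bool" where
  "edge tp c j k \<longleftrightarrow> (if j < 3 then (c, j, k) \<in> {(0, 1, 2), (1, 2, 0), (2, 0, 1)}
     else 3 \<le> k \<and> (j - 3) div 4 = (k - 3) div 4 \<and>
       (c, (j - 3) mod 4, (k - 3) mod 4) \<in> edges4 (tp \<and> (j - 3) div 4 = 0))"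

definition adj :: "bool \<Rightarrow> nat \<Rightarrow> nat \<Rightarrow> nat \<Rightarrow> complex" where
  "adj tp c j k = of_bool (edge tp c j k) - of_bool (edge tp c k j)"

text \<open>The relabelling \<open>\<pi>\<close> will be a transposition of indices.\<close>

definition sparse_tensor :: "nat \<Rightarrow> bool \<Rightarrow> (nat \<Rightarrow> nat) \<Rightarrow> nat \<times> nat list \<Rightarrow> complex" where
  "sparse_tensor s tp \<pi> w = (if w \<in> tensor_basis s then adj tp (fst w) (\<pi> (snd w ! 0)) (\<pi> (snd w ! 1)) else 0)"

definition adj4 :: "bool \<Rightarrow> nat \<Rightarrow> nat \<Rightarrow> nat \<Rightarrow> complex" where
  "adj4 tp c p p' = of_bool ((c, p, p') \<in> edges4 tp) - of_bool ((c, p', p) \<in> edges4 tp)"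

lemma adj_block:
  assumes "p < 4" "p' < 4"
  shows "adj tp c (3 + 4 * q + p) (3 + 4 * q + p') = adj4 (tp \<and> q = 0) c p p'"
  using assms by (simp add: adj_def adj4_def edge_def)

lemma adj_row3:
  assumes "j < 3" "3 \<le> s"
  shows "(\<Sum>k<s. adj tp c j k * f k) = (\<Sum>k<3. adj tp c j k * f k)"
proof (rule sum.mono_neutral_right)
  show "\<forall>k\<in>{..<s} - {..<3}. adj tp c j k * f k = 0"
    using assms by (auto simp: adj_def edge_def)
qed (use assms in auto)

lemma adj_row4:
  assumes "p < 4" "3 + 4 * q + 3 < s"
  shows "(\<Sum>k<s. adj tp c (3 + 4 * q + p) k * f k) = (\<Sum>p'<4. adj4 (tp \<and> q = 0) c p p' * f (3 + 4 * q + p'))"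
proof -
  have "(\<Sum>k<s. adj tp c (3 + 4 * q + p) k * f k) = (\<Sum>k\<in>(\<lambda>p'. 3 + 4 * q + p') ` {..<4}. adj tp c (3 + 4 * q + p) k * f k)"
  proof (rule sum.mono_neutral_right)
    show "\<forall>k\<in>{..<s} - (\<lambda>p'. 3 + 4 * q + p') ` {..<4}. adj tp c (3 + 4 * q + p) k * f k = 0"
    proof
      fix k assume k: "k \<in> {..<s} - (\<lambda>p'. 3 + 4 * q + p') ` {..<4}"
      have "\<not> (3 \<le> k \<and> (k - 3) div 4 = q)"
      proof
        assume *: "3 \<le> k \<and> (k - 3) div 4 = q"
        then have "k = 3 + 4 * q + (k - 3) mod 4" by (metis add.assoc le_add_diff_inverse mult_div_mod_eq)
        moreover have "(k - 3) mod 4 < 4" by simp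
        ultimately show False using k by blast
      qed
      then have "\<not> edge tp c (3 + 4 * q + p) k" "\<not> edge tp c k (3 + 4 * q + p)"
        using assms(1) by (auto simp: edge_def)
      then show "adj tp c (3 + 4 * q + p) k * f k = 0" by (simp add: adj_def)
    qed
  qed (use assms in auto)
  also have "\<dots> = (\<Sum>p'<4. adj tp c (3 + 4 * q + p) (3 + 4 * q + p') * f (3 + 4 * q + p'))"
    by (subst sum.reindex) (auto simp: inj_on_def)
  also have "\<dots> = (\<Sum>p'<4. adj4 (tp \<and> q = 0) c p p' * f (3 + 4 * q + p'))"
    by (rule sum.cong[OF refl]) (simp add: adj_block assms)
  finally show ?thesis .
qed

text \<open>The kernel equations of the flattening of a sparse tensor decouple into the blocks, and in
  each block all unknowns vanish by direct elimination.\<close>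

lemma adj_kernel:
  fixes \<kappa> :: "nat \<Rightarrow> nat \<Rightarrow> complex" and l :: nat and tp :: bool
  defines "A c \<gamma> j \<equiv> \<Sum>k<4 * l + 3. adj tp c j k * \<kappa> \<gamma> k"
  assumes eqs: "\<And>j. j < 4 * l + 3 \<Longrightarrow> A 0 1 j = A 1 2 j" "\<And>j. j < 4 * l + 3 \<Longrightarrow> A 2 2 j = A 0 0 j"
    "\<And>j. j < 4 * l + 3 \<Longrightarrow> A 1 0 j = A 2 1 j"
    and \<gamma>: "\<gamma> < 3" and k: "k < 4 * l + 3"
  shows "\<kappa> \<gamma> k = 0"
proof (cases "k < 3")
  case True
  have A: "A c \<gamma> j = (\<Sum>k<3. adj tp c j k * \<kappa> \<gamma> k)" if "j < 3" for c \<gamma> j :: nat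
    unfolding A_def by (rule adj_row3) (use that in simp_all)
  have e: "A 0 1 j = A 1 2 j" "A 2 2 j = A 0 0 j" "A 1 0 j = A 2 1 j" if "j < 3" for j
  proof -
    have "j < 4 * l + 3" using that by simp
    then show "A 0 1 j = A 1 2 j" "A 2 2 j = A 0 0 j" "A 1 0 j = A 2 1 j" by (rule eqs)+
  qed
  note e0 = e[of 0] and e1 = e[of 1] and e2 = e[of 2]
  have sum3: "(\<Sum>k<3. g k) = g 0 + g 1 + g (2::nat)" for g :: "nat \<Rightarrow> complex"
    by (simp add: eval_nat_numeral)
  have v: "\<kappa> 2 2 = 0" "\<kappa> 2 1 = 0" "- \<kappa> 0 2 = \<kappa> 1 1"
    using e0 by (simp_all add: A sum3 adj_def edge_def)
  have v': "\<kappa> 1 2 = 0" "- \<kappa> 2 0 = \<kappa> 0 2" "\<kappa> 1 0 = 0"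
    using e1 by (simp_all add: A sum3 adj_def edge_def)
  have v'': "- \<kappa> 1 1 = \<kappa> 2 0" "\<kappa> 0 1 = 0" "\<kappa> 0 0 = 0"
    using e2 by (simp_all add: A sum3 adj_def edge_def)
  have "\<kappa> 1 1 = - \<kappa> 0 2" by (rule v(3)[symmetric])
  also have "\<dots> = - (- \<kappa> 2 0)" by (rule arg_cong[OF v'(2)[symmetric]])
  also have "\<dots> = - \<kappa> 1 1" using v''(1) by (simp only: minus_minus)
  finally have "\<kappa> 1 1 = - \<kappa> 1 1" .
  then have w: "\<kappa> 1 1 = 0" unfolding complex_eq_iff by simp
  then have w': "\<kappa> 0 2 = 0" "\<kappa> 2 0 = 0" using v(3) v''(1) by simp_all
  from True have "k = 0 \<or> k = 1 \<or> k = 2" by auto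
  with v(1,2) v'(1,3) v''(2,3) w w' \<gamma> show ?thesis unfolding less_3_cases by (elim disjE) simp_all
next
  case False
  define q where "q = (k - 3) div 4"
  define p where "p = (k - 3) mod 4"
  have kqp: "k = 3 + 4 * q + p" using False unfolding q_def p_def by (metis add.assoc le_add_diff_inverse mult_div_mod_eq not_less)
  have p: "p < 4" by (simp add: p_def)
  have q: "3 + 4 * q + 3 < 4 * l + 3" using k kqp by presburger
  define bb where "bb = (tp \<and> q = 0)"
  define f where "f \<gamma> p = \<kappa> \<gamma> (3 + 4 * q + p)" for \<gamma> p
  have A: "A c \<gamma> (3 + 4 * q + p) = (\<Sum>p'<4. adj4 bb c p p' * f \<gamma> p')" if "p < 4" for c \<gamma> p :: nat
    unfolding A_def f_def bb_def by (rule adj_row4[OF that q])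
  have e: "A 0 1 (3 + 4 * q + p) = A 1 2 (3 + 4 * q + p)" "A 2 2 (3 + 4 * q + p) = A 0 0 (3 + 4 * q + p)"
    "A 1 0 (3 + 4 * q + p) = A 2 1 (3 + 4 * q + p)" if "p < 4" for p
  proof -
    have "3 + 4 * q + p < 4 * l + 3" using that q by linarith
    then show "A 0 1 (3 + 4 * q + p) = A 1 2 (3 + 4 * q + p)" "A 2 2 (3 + 4 * q + p) = A 0 0 (3 + 4 * q + p)"
      "A 1 0 (3 + 4 * q + p) = A 2 1 (3 + 4 * q + p)" by (rule eqs)+
  qed
  have e': "(\<Sum>p'<4. adj4 bb 0 p p' * f 1 p') = (\<Sum>p'<4. adj4 bb 1 p p' * f 2 p')"
    "(\<Sum>p'<4. adj4 bb 2 p p' * f 2 p') = (\<Sum>p'<4. adj4 bb 0 p p' * f 0 p')"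
    "(\<Sum>p'<4. adj4 bb 1 p p' * f 0 p') = (\<Sum>p'<4. adj4 bb 2 p p' * f 1 p')"
    if "p < 4" for p
    using e[OF that] by (simp_all only: A[OF that])
  have p4: "p = 0 \<or> p = 1 \<or> p = 2 \<or> p = 3" using p by auto
  have "f \<gamma> p = 0"
  proof (cases bb)
    case True
    note ee = e'[unfolded sum_less_4]
    have "f 1 3 = f 2 1" "f 0 3 = 0" "f 0 1 = 0"
      using ee[of 0] by (simp_all add: True adj4_def edges4_def)
    moreover have "f 2 0 = 0" "f 2 2 = 0" "- f 0 0 = f 1 2"
      using ee[of 1] by (simp_all add: True adj4_def edges4_def)
    moreover have "f 2 3 = 0" "f 2 1 = 0" "- f 1 1 = f 0 3"
      using ee[of 2] by (simp_all add: True adj4_def edges4_def)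
    moreover have "f 1 0 = f 2 2" "f 0 0 = 0" "f 0 2 = 0"
      using ee[of 3] by (simp_all add: True adj4_def edges4_def)
    ultimately show ?thesis using p4 \<gamma> unfolding less_3_cases by (elim disjE) simp_all
  next
    case False
    note ee = e'[unfolded sum_less_4]
    have "f 1 1 = f 2 3" "f 0 1 = 0" "f 0 3 = 0"
      using ee[of 0] by (simp_all add: False adj4_def edges4_def)
    moreover have "f 1 0 = 0" "f 2 2 = - f 0 0" "f 1 2 = 0"
      using ee[of 1] by (simp_all add: False adj4_def edges4_def)
    moreover have "f 1 3 = 0" "- f 2 1 = f 0 3" "f 1 1 = 0"
      using ee[of 2] by (simp_all add: False adj4_def edges4_def)
    moreover have "f 1 2 = f 2 0" "f 0 2 = 0" "f 0 0 = 0"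
      using ee[of 3] by (simp_all add: False adj4_def edges4_def)
    ultimately show ?thesis using p4 \<gamma> unfolding less_3_cases by (elim disjE) simp_all
  qed
  then show ?thesis by (simp add: f_def kqp)
qed

lemma flattening_row_sums:
  fixes x :: "nat \<times> nat list \<Rightarrow> complex"
  shows "(\<Sum>\<gamma><3. \<Sum>k<s. flattening_entry x 0 \<gamma> j k * \<kappa> \<gamma> k) = (\<Sum>k<s. skew_entry x 0 j k * \<kappa> 1 k) - (\<Sum>k<s. skew_entry x 1 j k * \<kappa> 2 k)"
    "(\<Sum>\<gamma><3. \<Sum>k<s. flattening_entry x 1 \<gamma> j k * \<kappa> \<gamma> k) = (\<Sum>k<s. skew_entry x 2 j k * \<kappa> 2 k) - (\<Sum>k<s. skew_entry x 0 j k * \<kappa> 0 k)"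
    "(\<Sum>\<gamma><3. \<Sum>k<s. flattening_entry x 2 \<gamma> j k * \<kappa> \<gamma> k) = (\<Sum>k<s. skew_entry x 1 j k * \<kappa> 0 k) - (\<Sum>k<s. skew_entry x 2 j k * \<kappa> 1 k)"
proof -
  have sum3: "(\<Sum>k<3. g k) = g 0 + g 1 + g (2::nat)" for g :: "nat \<Rightarrow> complex"
    by (simp add: eval_nat_numeral)
  show "(\<Sum>\<gamma><3. \<Sum>k<s. flattening_entry x 0 \<gamma> j k * \<kappa> \<gamma> k) = (\<Sum>k<s. skew_entry x 0 j k * \<kappa> 1 k) - (\<Sum>k<s. skew_entry x 1 j k * \<kappa> 2 k)"
    "(\<Sum>\<gamma><3. \<Sum>k<s. flattening_entry x 1 \<gamma> j k * \<kappa> \<gamma> k) = (\<Sum>k<s. skew_entry x 2 j k * \<kappa> 2 k) - (\<Sum>k<s. skew_entry x 0 j k * \<kappa> 0 k)"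
    "(\<Sum>\<gamma><3. \<Sum>k<s. flattening_entry x 2 \<gamma> j k * \<kappa> \<gamma> k) = (\<Sum>k<s. skew_entry x 1 j k * \<kappa> 0 k) - (\<Sum>k<s. skew_entry x 2 j k * \<kappa> 1 k)"
    unfolding sum3 by (simp_all add: flattening_entry_def sum_negf)
qed

lemma flat_det_sparse_tensor:
  assumes \<pi>: "\<And>j. \<pi> (\<pi> j) = j" "\<And>j. j < s \<Longrightarrow> \<pi> j < s" and s: "s = 4 * l + 3"
  shows "flat_det s (sparse_tensor s tp \<pi>) \<noteq> 0"
proof (rule flat_det_nonzeroI)
  fix \<kappa> :: "nat \<Rightarrow> nat \<Rightarrow> complex" and \<gamma> k :: nat
  assume eq: "\<And>\<beta> j. \<beta> < 3 \<Longrightarrow> j < s \<Longrightarrow> (\<Sum>\<gamma><3. \<Sum>k<s. flattening_entry (sparse_tensor s tp \<pi>) \<beta> \<gamma> j k * \<kappa> \<gamma> k) = 0"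
    and \<gamma>: "\<gamma> < 3" and k: "k < s"
  have skew_entry: "skew_entry (sparse_tensor s tp \<pi>) c j k = adj tp c (\<pi> j) (\<pi> k)" if "c < 3" "j < s" "k < s" for c j k
  proof -
    have "(c, [j, k]) \<in> tensor_basis s" if "j < k" using that \<open>c < 3\<close> \<open>k < s\<close> by (simp add: tensor_basis_def)
    moreover have "(c, [k, j]) \<in> tensor_basis s" if "k < j" using that \<open>c < 3\<close> \<open>j < s\<close> by (simp add: tensor_basis_def)
    ultimately show ?thesis
      by (cases j k rule: linorder_cases) (simp_all add: skew_entry_def sparse_tensor_def adj_def)
  qed
  define A where "A c \<gamma> j = (\<Sum>k<s. adj tp c j k * \<kappa> \<gamma> (\<pi> k))" for c \<gamma> j :: nat
  have row: "(\<Sum>k<s. skew_entry (sparse_tensor s tp \<pi>) c (\<pi> j) k * \<kappa> \<gamma> k) = A c \<gamma> j" if "c < 3" "j < s" for c j \<gamma> :: nat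
  proof -
    have "(\<Sum>k<s. skew_entry (sparse_tensor s tp \<pi>) c (\<pi> j) k * \<kappa> \<gamma> k) = (\<Sum>k<s. adj tp c j (\<pi> k) * \<kappa> \<gamma> k)"
      using that by (intro sum.cong) (auto simp: skew_entry \<pi>)
    also have "\<dots> = A c \<gamma> j" unfolding A_def
      by (rule sum.reindex_bij_witness[of _ \<pi> \<pi>]) (auto simp: \<pi>)
    finally show ?thesis .
  qed
  have eq': "A 0 1 j = A 1 2 j" "A 2 2 j = A 0 0 j" "A 1 0 j = A 2 1 j" if "j < s" for j
  proof -
    have r: "A c \<gamma> j = (\<Sum>k<s. skew_entry (sparse_tensor s tp \<pi>) c (\<pi> j) k * \<kappa> \<gamma> k)" if "c < 3" for c \<gamma>
      using row[OF that \<open>j < s\<close>] by (rule sym)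
    have "\<pi> j < s" using \<pi>(2) that by blast
    then have z: "(\<Sum>\<gamma><3. \<Sum>k<s. flattening_entry (sparse_tensor s tp \<pi>) \<beta> \<gamma> (\<pi> j) k * \<kappa> \<gamma> k) = 0" if "\<beta> < 3" for \<beta>
      using eq[OF that] by blast
    show "A 0 1 j = A 1 2 j"
      using flattening_row_sums(1)[of "sparse_tensor s tp \<pi>" "\<pi> j" \<kappa> s] z[of 0] r[of 0 1] r[of 1 2] by simp
    show "A 2 2 j = A 0 0 j"
      using flattening_row_sums(2)[of "sparse_tensor s tp \<pi>" "\<pi> j" \<kappa> s] z[of 1] r[of 2 2] r[of 0 0] by simp
    show "A 1 0 j = A 2 1 j"
      using flattening_row_sums(3)[of "sparse_tensor s tp \<pi>" "\<pi> j" \<kappa> s] z[of 2] r[of 1 0] r[of 2 1] by simp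
  qed
  have "\<kappa> \<gamma> (\<pi> (\<pi> k)) = 0"
    by (rule adj_kernel[where \<kappa> = "\<lambda>\<gamma> k. \<kappa> \<gamma> (\<pi> k)" and tp = tp and l = l])
      (use eq' \<gamma> k \<pi> in \<open>simp_all add: A_def s\<close>)
  then show "\<kappa> \<gamma> k = 0" by (simp add: \<pi>)
qed

section \<open>Irreducibility of the determinant\<close>

text \<open>The first block of four is bipartite, with parts \<open>{3, 5}\<close> and \<open>{4, 6}\<close>: scaling the vectors
  of one part or those of the other has the same effect on the tensor.\<close>

lemma edge_parity:
  assumes "edge False c j k"
  shows "(if j = 3 then 1 else 0) + (if k = 3 then 1 else 0) + ((if j = 5 then 1 else 0) + (if k = 5 then 1 else 0)) =
    (if j = 4 then 1 else 0) + (if k = 4 then 1 else 0) + ((if j = 6 then 1 else 0) + (if k = 6 then 1 else (0::nat)))"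
proof (cases "j < 7 \<and> k < 7")
  case True
  then have "j \<in> {0,1,2,3,4,5,6}" "k \<in> {0,1,2,3,4,5,6}" by auto
  with assms show ?thesis by (auto simp: edge_def edges4_def)
next
  case False
  have "j \<ge> 7 \<and> k \<ge> 7 \<or> j < 3 \<and> k < 3"
  proof (cases "j < 3")
    case True
    then show ?thesis using assms by (auto simp: edge_def)
  next
    case f: False
    then have *: "3 \<le> k" "(j - 3) div 4 = (k - 3) div 4" using assms by (simp_all add: edge_def)
    show ?thesis
    proof (cases "j < 7")
      case True
      then have "(k - 3) div 4 = 0" using * by simp
      then have "k < 7" by linarith
      with True False show ?thesis by simp
    next
      case j: False
      then have "(k - 3) div 4 \<ge> 1" using *(2) by linarith
      then have "k \<ge> 7" by linarith
      with j show ?thesis by simp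
    qed
  qed
  then show ?thesis by auto
qed

text \<open>Exponents of a cube root of unity \<open>\<omega>\<close>: scaling each \<open>w\<^sub>j\<close> by \<open>\<omega>\<close> to its exponent and each
  \<open>v\<^sub>c\<close> by \<open>\<omega>\<^sup>c\<close> fixes the sparse tensor of type \<open>tp\<close>.\<close>

definition node_weight :: "bool \<Rightarrow> nat \<Rightarrow> nat" where
  "node_weight tp j = (if j < 3 then j else
     (if tp \<and> (j - 3) div 4 = 0 then [0, 2, 2, 0] else [0, 0, 1, 2]) ! ((j - 3) mod 4))"

lemma edge_node_weight:
  assumes "edge tp c j k"
  shows "3 dvd c + node_weight tp j + node_weight tp k"
proof (cases "j < 3")
  case True
  then show ?thesis using assms by (auto simp: edge_def node_weight_def; presburger)
next
  case False
  then have *: "3 \<le> k" "(j - 3) div 4 = (k - 3) div 4"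
    "(c, (j - 3) mod 4, (k - 3) mod 4) \<in> edges4 (tp \<and> (j - 3) div 4 = 0)"
    using assms unfolding edge_def if_not_P[OF False] by blast+
  define a where "a = (j - 3) mod 4"
  define d where "d = (k - 3) mod 4"
  define bb where "bb = (tp \<and> (j - 3) div 4 = 0)"
  have "(c, a, d) \<in> edges4 bb" using *(3) by (simp add: a_def d_def bb_def)
  moreover have "node_weight tp j = (if bb then [0, 2, 2, 0] else [0, 0, 1, 2]) ! a"
    using False by (simp add: node_weight_def a_def bb_def)
  moreover have "node_weight tp k = (if bb then [0, 2, 2, 0] else [0, 0, 1, 2]) ! d"
    using *(1,2) by (simp add: node_weight_def d_def bb_def)
  ultimately show ?thesis by (cases bb) (auto simp: edges4_def; presburger)+
qed

text \<open>The two types of the first block give exponents whose totals differ by 1. Comparing both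
  makes the common degree \<open>b j\<close> of a factor divisible by 3.\<close>

lemma sum_node_weight:
  assumes "7 \<le> s"
  shows "(\<Sum>j<s. node_weight True j) = Suc (\<Sum>j<s. node_weight False j)"
proof -
  have split: "(\<Sum>j<s. f j) = (\<Sum>j<7. f j) + (\<Sum>j\<in>{7..<s}. f j)" for f :: "nat \<Rightarrow> nat"
    using sum.atLeastLessThan_concat[of 0 7 s f] assms by (simp add: atLeast0LessThan)
  have "(\<Sum>j\<in>{7..<s}. node_weight True j) = (\<Sum>j\<in>{7..<s}. node_weight False j)"
  proof (rule sum.cong[OF refl])
    fix j assume "j \<in> {7..<s}"
    then have "(j - 3) div 4 \<noteq> 0" by auto
    then show "node_weight True j = node_weight False j" by (simp add: node_weight_def)
  qed
  moreover have "(\<Sum>j<7. node_weight True j) = Suc (\<Sum>j<7. node_weight False j)"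
  proof -
    have "{..<7::nat} = {0, 1, 2, 3, 4, 5, 6}" by auto
    then show ?thesis by (simp add: node_weight_def)
  qed
  ultimately show ?thesis by (simp only: split add_Suc)
qed

lemma sparse_tensor_nonzeroD:
  assumes "sparse_tensor s tp \<pi> w \<noteq> 0"
  shows "w \<in> tensor_basis s" "edge tp (fst w) (\<pi> (snd w ! 0)) (\<pi> (snd w ! 1)) \<or> edge tp (fst w) (\<pi> (snd w ! 1)) (\<pi> (snd w ! 0))"
  using assms by (auto simp: sparse_tensor_def adj_def split: if_splits)

lemma primitive_cube_root:
  obtains \<omega> :: complex where "\<omega> ^ 3 = 1" "\<forall>b. \<omega> ^ b = 1 \<longrightarrow> 3 dvd b"
proof
  define \<omega> :: complex where "\<omega> = Complex (- 1 / 2) (sqrt 3 / 2)"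
  have sq: "\<omega> ^ 2 = Complex (- 1 / 2) (- sqrt 3 / 2)"
    by (simp add: \<omega>_def power2_eq_square complex_eq_iff)
  show cube: "\<omega> ^ 3 = 1"
    unfolding power3_eq_cube power2_eq_square[symmetric] sq
    by (simp add: \<omega>_def complex_eq_iff)
  have n1: "\<omega> \<noteq> 1" by (simp add: \<omega>_def complex_eq_iff)
  have n2: "\<omega> ^ 2 \<noteq> 1" unfolding sq by (simp add: complex_eq_iff)
  show "\<forall>b. \<omega> ^ b = 1 \<longrightarrow> 3 dvd b"
  proof (intro allI impI)
  fix b assume b: "\<omega> ^ b = 1"
  have "\<omega> ^ b = \<omega> ^ (3 * (b div 3) + b mod 3)" by simp
  also have "\<dots> = \<omega> ^ (b mod 3)" by (simp only: power_add power_mult cube power_one mult_1)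
  finally have "\<omega> ^ (b mod 3) = 1" using b by simp
  moreover have "b mod 3 = 0 \<or> b mod 3 = 1 \<or> b mod 3 = 2" by linarith
  ultimately have "b mod 3 = 0" using n1 n2 by auto
  then show "3 dvd b" by auto
  qed
qed

text \<open>Let \<open>P\<close> be a factor of the determinant, so that it vanishes at no sparse tensor. Two torus
  elements with the same effect on a sparse tensor act on \<open>P\<close> by the same number. The parity
  relation of \<open>edge_parity\<close> for all transpositions of indices makes the degrees \<open>b j\<close> equal; the
  scaling of the block of three by \<open>-1\<close>, which fixes the tensor, makes three times the common
  degree even; and a primitive cube root of unity acting with the exponents \<open>node_weight\<close> makes
  the common degree divisible by 3.\<close>

lemma weights_multiple_of_6:
  fixes P :: "(nat \<times> nat list) cpoly"
  assumes l: "l \<ge> 1" and s: "s = 4 * l + 3"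
    and nz: "\<And>x. flat_det s x \<noteq> 0 \<Longrightarrow> peval x P \<noteq> 0"
    and W: "\<And>j. j < s \<Longrightarrow> has_weight (index_count j) (b j) P" and V: "has_weight fst A P"
  shows "\<exists>\<beta>. (\<forall>j<s. b j = \<beta>) \<and> 6 dvd \<beta>"
proof -
  have s7: "7 \<le> s" using l s by simp
  \<comment> \<open>The transpositions of 3 with \<open>i\<close>: they move every index into the first block of four.\<close>
  define tr where "tr i j = (if j = 3 then i else if j = i then 3 else j)" for i j :: nat
  have tr: "tr i (tr i j) = j" "i < s \<Longrightarrow> j < s \<Longrightarrow> tr i j < s" for i j
    using s7 by (auto simp: tr_def)
  have b_rel: "b (\<pi> 3) + b (\<pi> 5) = b (\<pi> 4) + b (\<pi> 6)"
    if \<pi>: "\<And>j. \<pi> (\<pi> j) = j" "\<And>j. j < s \<Longrightarrow> \<pi> j < s" for \<pi>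
  proof -
    let ?T = "sparse_tensor s False \<pi>"
    have nT: "peval ?T P \<noteq> 0" by (rule nz, rule flat_det_sparse_tensor[OF \<pi> s])
    have inj: "\<pi> j = \<pi> k \<longleftrightarrow> j = k" for j k using \<pi>(1) by metis
    have lt: "\<pi> 3 < s" "\<pi> 4 < s" "\<pi> 5 < s" "\<pi> 6 < s" using s7 \<pi>(2) by simp_all
    have wt: "index_count (\<pi> i) w = (if \<pi> (snd w ! 0) = i then 1 else 0) + (if \<pi> (snd w ! 1) = i then 1 else 0)" for i w
      using \<pi>(1) by (auto simp: index_count_def) 
    have "(\<lambda>w. (\<Prod>j\<in>{\<pi> 3, \<pi> 5}. 2 ^ index_count j w) * ?T w) = (\<lambda>w. (\<Prod>j\<in>{\<pi> 4, \<pi> 6}. 2 ^ index_count j w) * ?T w)"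
    proof
      fix w
      show "(\<Prod>j\<in>{\<pi> 3, \<pi> 5}. 2 ^ index_count j w) * ?T w = (\<Prod>j\<in>{\<pi> 4, \<pi> 6}. 2 ^ index_count j w) * ?T w"
      proof (cases "?T w = 0")
        case False
        have "index_count (\<pi> 3) w + index_count (\<pi> 5) w = index_count (\<pi> 4) w + index_count (\<pi> 6) w"
          using sparse_tensor_nonzeroD(2)[OF False] edge_parity unfolding wt by (metis add.commute)
        then have "(2::complex) ^ (index_count (\<pi> 3) w + index_count (\<pi> 5) w) = 2 ^ (index_count (\<pi> 4) w + index_count (\<pi> 6) w)" by simp
        then show ?thesis by (simp add: inj power_add)
      qed simp
    qed
    then have "(\<Prod>j\<in>{\<pi> 3, \<pi> 5}. 2 ^ b j) * peval ?T P = (\<Prod>j\<in>{\<pi> 4, \<pi> 6}. 2 ^ b j) * peval ?T P"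
    proof -
      assume eq: "(\<lambda>w. (\<Prod>j\<in>{\<pi> 3, \<pi> 5}. 2 ^ index_count j w) * ?T w) = (\<lambda>w. (\<Prod>j\<in>{\<pi> 4, \<pi> 6}. 2 ^ index_count j w) * ?T w)"
      have "(\<Prod>j\<in>{\<pi> 3, \<pi> 5}. 2 ^ b j) * peval ?T P = peval (\<lambda>w. (\<Prod>j\<in>{\<pi> 3, \<pi> 5}. 2 ^ index_count j w) * ?T w) P"
        by (rule has_weight_prod[symmetric]) (use W lt in auto)
      also have "\<dots> = peval (\<lambda>w. (\<Prod>j\<in>{\<pi> 4, \<pi> 6}. 2 ^ index_count j w) * ?T w) P" by (simp only: eq)
      also have "\<dots> = (\<Prod>j\<in>{\<pi> 4, \<pi> 6}. 2 ^ b j) * peval ?T P"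
        by (rule has_weight_prod) (use W lt in auto)
      finally show ?thesis .
    qed
    then have "(2::complex) ^ (b (\<pi> 3) + b (\<pi> 5)) = 2 ^ (b (\<pi> 4) + b (\<pi> 6))"
      using nT by (simp add: inj power_add)
    then have "(of_nat (2 ^ (b (\<pi> 3) + b (\<pi> 5))) :: complex) = of_nat (2 ^ (b (\<pi> 4) + b (\<pi> 6)))" by simp
    then have "(2::nat) ^ (b (\<pi> 3) + b (\<pi> 5)) = 2 ^ (b (\<pi> 4) + b (\<pi> 6))" by (simp only: of_nat_eq_iff)
    then show ?thesis by (simp add: power_inject_exp)
  qed
  have b3: "b (tr i 3) + b (tr i 5) = b (tr i 4) + b (tr i 6)" if "i < s" for i
    by (rule b_rel) (use tr that in auto)
  define \<beta> where "\<beta> = b 3"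
  have r3: "b 3 + b 5 = b 4 + b 6" using b3[of 3] s7 by (simp add: tr_def)
  have r4: "b 4 + b 5 = b 3 + b 6" using b3[of 4] s7 by (simp add: tr_def)
  have r6: "b 6 + b 5 = b 4 + b 3" using b3[of 6] s7 by (simp add: tr_def)
  have e: "b 4 = \<beta>" "b 6 = \<beta>" "b 5 = \<beta>" using r3 r4 r6 unfolding \<beta>_def by linarith+
  have all: "b j = \<beta>" if "j < s" for j
  proof (cases "j \<in> {3, 4, 5, 6}")
    case True
    then show ?thesis using e by (auto simp: \<beta>_def)
  next
    case False
    then have "b j + b 5 = b 4 + b 6" using b3[OF that] by (simp add: tr_def)
    then show ?thesis using e by simp
  qed
  have "even \<beta>"
  proof -
    let ?T = "sparse_tensor s False (\<lambda>j. j)"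
    have nT: "peval ?T P \<noteq> 0" by (rule nz, rule flat_det_sparse_tensor[OF _ _ s]) auto
    have "(\<lambda>w. (\<Prod>j\<in>{0, 1, 2}. (- 1) ^ index_count j w) * ?T w) = ?T"
    proof
      fix w
      show "(\<Prod>j\<in>{0, 1, 2}. (- 1) ^ index_count j w) * ?T w = ?T w"
      proof (cases "?T w = 0")
        case False
        define j where "j = snd w ! 0"
        define k where "k = snd w ! 1"
        have "edge False (fst w) j k \<or> edge False (fst w) k j"
          using sparse_tensor_nonzeroD(2)[OF False] by (simp add: j_def k_def)
        then have "j \<in> {0, 1, 2} \<and> k \<in> {0, 1, 2} \<or> j \<notin> {0, 1, 2} \<and> k \<notin> {0, 1, 2}"
          by (auto simp: edge_def split: if_splits)
        then have "(\<Prod>j\<in>{0, 1, 2}. (- 1) ^ index_count j w) = (1 :: complex)"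
          unfolding index_count_def j_def[symmetric] k_def[symmetric] by auto
        then show ?thesis by simp
      qed simp
    qed
    moreover have "peval (\<lambda>w. (\<Prod>j\<in>{0, 1, 2}. (- 1) ^ index_count j w) * ?T w) P =
        (\<Prod>j\<in>{0, 1, 2}. (- 1) ^ b j) * peval ?T P"
      by (rule has_weight_prod) (use W s7 in auto)
    ultimately have "(\<Prod>j\<in>{0, 1, 2}. (- 1) ^ b j) = (1 :: complex)" using nT by simp
    moreover have "b 0 = \<beta>" "b 1 = \<beta>" "b 2 = \<beta>" using all s7 by auto
    ultimately have "(- 1) ^ \<beta> * ((- 1) ^ \<beta> * (- 1) ^ \<beta>) = (1 :: complex)" by simp
    then show ?thesis by (cases "even \<beta>") auto
  qed
  moreover have "3 dvd \<beta>"
  proof -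
    obtain \<omega> :: complex where \<omega>: "\<omega> ^ 3 = 1" "\<forall>b. \<omega> ^ b = 1 \<longrightarrow> 3 dvd b" by (rule primitive_cube_root)
    have tot: "\<omega> ^ A * \<omega> ^ (\<beta> * (\<Sum>j<s. node_weight tp j)) = 1" for tp
    proof -
      let ?T = "sparse_tensor s tp (\<lambda>j. j)"
      have nT: "peval ?T P \<noteq> 0" by (rule nz, rule flat_det_sparse_tensor[OF _ _ s]) auto
      have "(\<lambda>w. \<omega> ^ fst w * ((\<Prod>j\<in>{..<s}. (\<omega> ^ node_weight tp j) ^ index_count j w) * ?T w)) = ?T"
      proof
        fix w
        show "\<omega> ^ fst w * ((\<Prod>j\<in>{..<s}. (\<omega> ^ node_weight tp j) ^ index_count j w) * ?T w) = ?T w"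
        proof (cases "?T w = 0")
          case False
          define j where "j = snd w ! 0"
          define k where "k = snd w ! 1"
          have jk: "j < s" "k < s" using sparse_tensor_nonzeroD(1)[OF False] by (auto simp: j_def k_def tensor_basis_def)
          have "3 dvd fst w + node_weight tp j + node_weight tp k"
            using sparse_tensor_nonzeroD(2)[OF False] edge_node_weight[of tp "fst w" j k] edge_node_weight[of tp "fst w" k j]
            by (auto simp: j_def k_def add.commute add.left_commute)
          then obtain m where m: "fst w + node_weight tp j + node_weight tp k = 3 * m" by (rule dvdE)
          have "(\<Prod>i\<in>{..<s}. (\<omega> ^ node_weight tp i) ^ index_count i w) =
              (\<Prod>i\<in>{..<s}. (if i = j then \<omega> ^ node_weight tp i else 1) * (if i = k then \<omega> ^ node_weight tp i else 1))"
            by (rule prod.cong[OF refl]) (auto simp: index_count_def j_def[symmetric] k_def[symmetric] power2_eq_square simp del: One_nat_def)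
          also have "\<dots> = \<omega> ^ node_weight tp j * \<omega> ^ node_weight tp k"
            using jk by (simp add: prod.distrib prod.delta)
          finally have "\<omega> ^ fst w * (\<Prod>i\<in>{..<s}. (\<omega> ^ node_weight tp i) ^ index_count i w) = \<omega> ^ (fst w + node_weight tp j + node_weight tp k)"
            by (simp add: power_add)
          also have "\<dots> = 1" by (simp only: m power_mult \<omega>(1) power_one)
          finally show ?thesis by (simp add: mult.assoc[symmetric])
        qed simp
      qed
      moreover have "peval (\<lambda>w. \<omega> ^ fst w * ((\<Prod>j\<in>{..<s}. (\<omega> ^ node_weight tp j) ^ index_count j w) * ?T w)) P =
          \<omega> ^ A * ((\<Prod>j\<in>{..<s}. (\<omega> ^ node_weight tp j) ^ b j) * peval ?T P)"
        using V W has_weight_prod[of "{..<s}" index_count b P "\<lambda>j. \<omega> ^ node_weight tp j" ?T]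
        by (simp add: has_weight_def)
      ultimately have "\<omega> ^ A * (\<Prod>j\<in>{..<s}. (\<omega> ^ node_weight tp j) ^ b j) = 1" using nT by simp
      moreover have "(\<Prod>j\<in>{..<s}. (\<omega> ^ node_weight tp j) ^ b j) = \<omega> ^ (\<beta> * (\<Sum>j<s. node_weight tp j))"
        by (simp add: all power_mult[symmetric] power_sum[symmetric] sum_distrib_left mult.commute)
      ultimately show ?thesis by simp
    qed
    have "\<omega> ^ A * \<omega> ^ (\<beta> * (\<Sum>j<s. node_weight False j)) * \<omega> ^ \<beta> = 1"
      using tot[of True] unfolding sum_node_weight[OF s7] by (simp add: power_add mult_ac)
    then have "\<omega> ^ \<beta> = 1" using tot[of False] by simp
    then show ?thesis using \<omega>(2) by blast
  qed
  ultimately have "6 dvd \<beta>" by presburger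
  with all show ?thesis by blast
qed

text \<open>Scaling all variables to 0 does not change the values of \<open>P\<close>.\<close>

lemma constant_if_weights_zero:
  fixes P :: "(nat \<times> nat list) cpoly"
  assumes W: "\<And>j. j < s \<Longrightarrow> has_weight (index_count j) 0 P" and O: "has_weight (outside_weight s) 0 P"
  shows "\<exists>c. P = Cst c"
proof -
  have "peval x P = peval (\<lambda>_. 0) P" for x
  proof -
    have "(\<lambda>w. 0 ^ outside_weight s w * ((\<Prod>j<s. 0 ^ index_count j w) * x w)) = (\<lambda>_. 0)"
    proof
      fix w
      show "0 ^ outside_weight s w * ((\<Prod>j<s. 0 ^ index_count j w) * x w) = 0"
      proof (cases "w \<in> tensor_basis s")
        case True
        then have "snd w ! 0 < s" by (auto simp: tensor_basis_def)
        moreover have "(0::complex) ^ index_count (snd w ! 0) w = 0" by (simp add: index_count_def)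
        ultimately have "(\<Prod>j<s. 0 ^ index_count j w) = (0::complex)" by (subst prod_zero_iff) auto
        then show ?thesis by simp
      qed (simp add: outside_weight_def)
    qed
    moreover have "peval (\<lambda>w. 0 ^ outside_weight s w * ((\<Prod>j<s. 0 ^ index_count j w) * x w)) P = peval x P"
      using O has_weight_prod[of "{..<s}" index_count "\<lambda>_. 0" P "\<lambda>_. 0" x] W by (simp add: has_weight_def)
    ultimately show ?thesis by simp
  qed
  then show ?thesis by (intro exI[of _ "peval (\<lambda>_. 0) P"] peval_eqI) simp
qed

text \<open>In each index of \<open>W\<close> the determinant has degree 6, and one of two factors has degree 0 by
  \<open>weights_multiple_of_6\<close>.\<close>

theorem flat_det_irreducible:
  fixes P Q :: "(nat \<times> nat list) cpoly"
  assumes l: "l \<ge> 1" and s: "s = 4 * l + 3" and D: "flat_det s pvar = P * Q"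
  shows "(\<exists>c. P = Cst c) \<or> (\<exists>c. Q = Cst c)"
proof -
  have "flat_det s (sparse_tensor s False (\<lambda>j. j)) \<noteq> 0" by (rule flat_det_sparse_tensor[OF _ _ s]) auto
  then have PQ0: "P * Q \<noteq> 0" using D peval_flat_det[of _ s] by (metis peval.hom_zero)
  have ev: "peval x (P * Q) = flat_det s x" for x using D peval_flat_det by metis
  have "\<forall>j. \<exists>b b'. j < s \<longrightarrow> b + b' = 6 \<and> has_weight (index_count j) b P \<and> has_weight (index_count j) b' Q"
  proof
    fix j
    show "\<exists>b b'. j < s \<longrightarrow> b + b' = 6 \<and> has_weight (index_count j) b P \<and> has_weight (index_count j) b' Q"
    proof (cases "j < s")
      case True
      obtain n1 n2 where "n1 + n2 = 6" "has_weight (index_count j) n1 P" "has_weight (index_count j) n2 Q"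
        by (rule weight_factors[OF PQ0, of "index_count j" 6]) (use flat_det_scale_W[OF True] in \<open>simp_all add: ev\<close>)
      then show ?thesis by blast
    qed simp
  qed
  then obtain b b' where b: "\<And>j. j < s \<Longrightarrow> b j + b' j = 6" "\<And>j. j < s \<Longrightarrow> has_weight (index_count j) (b j) P"
    "\<And>j. j < s \<Longrightarrow> has_weight (index_count j) (b' j) Q" by metis
  obtain A A' where A: "has_weight fst A P" "has_weight fst A' Q"
    by (rule weight_factors[OF PQ0, of fst "3 * s"]) (use flat_det_scale_V in \<open>simp_all add: ev\<close>)
  obtain z z' where z: "z + z' = 0" "has_weight (outside_weight s) z P" "has_weight (outside_weight s) z' Q"
  proof (rule weight_factors[OF PQ0, of "outside_weight s" 0])
    fix t :: complex and x
    show "peval (\<lambda>v. t ^ outside_weight s v * x v) (P * Q) = t ^ 0 * peval x (P * Q)"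
      unfolding ev by (simp, rule flat_det_cong) (simp add: outside_weight_def)
  qed
  have nz: "flat_det s x \<noteq> 0 \<Longrightarrow> peval x P \<noteq> 0" "flat_det s x \<noteq> 0 \<Longrightarrow> peval x Q \<noteq> 0" for x
    using ev[of x] by (auto simp: peval_simps)
  obtain \<beta> where \<beta>: "\<forall>j<s. b j = \<beta>" "6 dvd \<beta>"
    using weights_multiple_of_6[OF l s nz(1) b(2) A(1)] by blast
  have "\<beta> \<le> 6" using b(1)[of 0] \<beta>(1) s by auto
  with \<beta>(2) have "\<beta> = 0 \<or> \<beta> = 6" by (auto simp: dvd_def)
  then show ?thesis
  proof
    assume "\<beta> = 0"
    then have "\<exists>c. P = Cst c"
      by (intro constant_if_weights_zero[of s]) (use b(2) \<beta>(1) z in auto)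
    then show ?thesis ..
  next
    assume "\<beta> = 6"
    then have "b' j = 0" if "j < s" for j using b(1)[OF that] \<beta>(1) that by simp
    then have "\<exists>c. Q = Cst c"
      using b(3) z by (intro constant_if_weights_zero[of s]) auto
    then show ?thesis ..
  qed
qed

section \<open>Infinitesimal non-defectivity\<close>

text \<open>A configuration is a tuple of rank one tensors \<open>v i \<otimes> (a i \<and> b i)\<close>, given by the three
  families \<open>(v, a, b)\<close>.\<close>

type_synonym config = "(nat \<Rightarrow> nat \<Rightarrow> complex) \<times> (nat \<Rightarrow> nat \<Rightarrow> complex) \<times> (nat \<Rightarrow> nat \<Rightarrow> complex)"

text \<open>A functional on \<open>V \<otimes> \<And>\<^sup>2 W\<close> is a triple of skew forms \<open>\<theta> (c, j, k)\<close>, indexed by the basis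
  vectors \<open>v\<^sub>c\<close>. It annihilates the tangent space to the rank one tensors at \<open>v \<otimes> (a \<and> b)\<close> iff
  \<open>\<theta>\<^sub>c (a, b) = 0\<close> for all \<open>c\<close>, and the forms \<open>\<theta>\<^sub>v (a, _)\<close> and \<open>\<theta>\<^sub>v (b, _)\<close> are 0. The last
  condition sets one coordinate to 0; it removes the one-dimensional space of functionals that a
  hypersurface allows. Since conditions are functions of the configuration, they can be restricted
  to a line of configurations.\<close>

definition tangent_conds :: "nat \<Rightarrow> nat \<Rightarrow> (config \<Rightarrow> (nat \<times> nat \<times> nat \<Rightarrow> complex) \<Rightarrow> complex) set" where
  "tangent_conds s r = 
     {\<lambda>(v, a, b) \<theta>. \<theta> (c, j, k) + \<theta> (c, k, j) | c j k. c < 3 \<and> j < s \<and> k < s} \<union>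
     {\<lambda>(v, a, b) \<theta>. \<Sum>j<s. \<Sum>k<s. a i j * (b i k * \<theta> (c, j, k)) | i c. i < r \<and> c < 3} \<union>
     {\<lambda>(v, a, b) \<theta>. \<Sum>c<3. \<Sum>j<s. v i c * (a i j * \<theta> (c, j, k)) | i k. i < r \<and> k < s} \<union>
     {\<lambda>(v, a, b) \<theta>. \<Sum>c<3. \<Sum>j<s. v i c * (b i j * \<theta> (c, j, k)) | i k. i < r \<and> k < s} \<union>
     {\<lambda>_ \<theta>. \<theta> (2, 1, 3)}"

text \<open>At the rank one tensors of \<open>p\<close> the functionals that annihilate all tangent spaces form a
  space of dimension at most 1, detected by the coordinate \<open>(2, 1, 3)\<close>.\<close>

definition nondefective :: "nat \<Rightarrow> nat \<Rightarrow> config \<Rightarrow> bool" where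
  "nondefective s r p \<longleftrightarrow> (\<forall>\<theta>. (\<forall>F\<in>tangent_conds s r. F p \<theta> = 0) \<longrightarrow> (\<forall>k\<in>{..<3} \<times> {..<s} \<times> {..<s}. \<theta> k = 0))"

text \<open>The conditions that remain for the mixed coordinates of a functional when four vectors are
  added to \<open>W\<close>. In \<open>nondefective_step\<close> the unknown \<open>z (e, m, _)\<close> is the row of \<open>\<theta>\<^sub>m\<close> at a new
  index; the rows at the other new indices are 0 or the negatives of these. The indices 1 and 5 in
  the last condition are those of the old vectors that enter the third new rank one tensor.\<close>

definition gluing_conds :: "nat \<Rightarrow> nat \<Rightarrow> (config \<Rightarrow> (nat \<times> nat \<times> nat \<Rightarrow> complex) \<Rightarrow> complex) set" where
  "gluing_conds s r = 
     {\<lambda>(v, a, b) z. (\<Sum>j<s. v i 1 * (a i j * z (e, 1, j))) + (\<Sum>j<s. v i 2 * (a i j * z (e, 2, j))) | i e. i < r \<and> e < 2} \<union>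
     {\<lambda>(v, a, b) z. (\<Sum>j<s. v i 1 * (b i j * z (e, 1, j))) + (\<Sum>j<s. v i 2 * (b i j * z (e, 2, j))) | i e. i < r \<and> e < 2} \<union>
     {\<lambda>(v, a, b) z. (\<Sum>j<s. v i 0 * (a i j * z (e, 0, j))) - (\<Sum>j<s. v i 2 * (a i j * z (e, 2, j))) | i e. i < r \<and> e < 2} \<union>
     {\<lambda>(v, a, b) z. (\<Sum>j<s. v i 0 * (b i j * z (e, 0, j))) - (\<Sum>j<s. v i 2 * (b i j * z (e, 2, j))) | i e. i < r \<and> e < 2} \<union>
     {\<lambda>_ z. z (0, m, 5) - z (1, m, 1) | m. m < 3}"

definition gluable :: "nat \<Rightarrow> nat \<Rightarrow> config \<Rightarrow> bool" where
  "gluable s r p \<longleftrightarrow> (\<forall>z. (\<forall>F\<in>gluing_conds s r. F p z = 0) \<longrightarrow> (\<forall>k\<in>{..<2} \<times> {..<3} \<times> {..<s}. z k = 0))"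

definition polyfun :: "(complex \<Rightarrow> complex) \<Rightarrow> bool" where
  "polyfun g \<longleftrightarrow> (\<exists>p. \<forall>u. g u = poly p u)"

text \<open>Linear forms in \<open>x\<close> whose coefficients are polynomial in \<open>u\<close>.\<close>

definition polylin :: "'k set \<Rightarrow> (complex \<Rightarrow> ('k \<Rightarrow> complex) \<Rightarrow> complex) \<Rightarrow> bool" where
  "polylin A f \<longleftrightarrow> (\<exists>\<rho>. \<forall>u x. f u x = (\<Sum>k\<in>A. poly (\<rho> k) u * x k))"

lemma polyfun_linear: "polyfun (\<lambda>u. c + u * d)"
  unfolding polyfun_def by (rule exI[of _ "[:c, d:]"]) simp

lemma polylin_proj:
  assumes "finite A" "k \<in> A"
  shows "polylin A (\<lambda>u x. x k)"
  unfolding polylin_def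
proof (intro exI allI)
  fix u and x :: "'a \<Rightarrow> complex"
  have "(\<Sum>j\<in>A. poly (if j = k then 1 else 0) u * x j) = (\<Sum>j\<in>A. if j = k then x j else 0)"
    by (rule sum.cong) auto
  then show "x k = (\<Sum>j\<in>A. poly (if j = k then 1 else 0) u * x j)" using assms by simp
qed

lemma polylin_add: "polylin A f \<Longrightarrow> polylin A g \<Longrightarrow> polylin A (\<lambda>u x. f u x + g u x)"
proof -
  assume "polylin A f" "polylin A g"
  then obtain \<rho> \<sigma> where "\<forall>u x. f u x = (\<Sum>k\<in>A. poly (\<rho> k) u * x k)" "\<forall>u x. g u x = (\<Sum>k\<in>A. poly (\<sigma> k) u * x k)"
    unfolding polylin_def by (elim exE) 
  then show ?thesis unfolding polylin_def
    by (intro exI[of _ "\<lambda>k. \<rho> k + \<sigma> k"]) (simp add: distrib_right sum.distrib)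
qed

lemma polylin_scale: "polyfun c \<Longrightarrow> polylin A f \<Longrightarrow> polylin A (\<lambda>u x. c u * f u x)"
proof -
  assume "polyfun c" "polylin A f"
  then obtain p \<rho> where "\<forall>u. c u = poly p u" "\<forall>u x. f u x = (\<Sum>k\<in>A. poly (\<rho> k) u * x k)"
    unfolding polylin_def polyfun_def by (elim exE) 
  then show ?thesis unfolding polylin_def
    by (intro exI[of _ "\<lambda>k. p * \<rho> k"]) (simp add: sum_distrib_left mult.assoc)
qed

lemma polylin_diff: "polylin A f \<Longrightarrow> polylin A g \<Longrightarrow> polylin A (\<lambda>u x. f u x - g u x)"
proof -
  assume f: "polylin A f" and g: "polylin A g"
  have "polyfun (\<lambda>u. - 1)" using polyfun_linear[of "- 1" 0] by simp
  from polylin_add[OF f polylin_scale[OF this g]] show ?thesis by simp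
qed

lemma polylin_0: "polylin A (\<lambda>u x. 0)"
  unfolding polylin_def by (rule exI[of _ "\<lambda>_. 0"]) simp

lemma polylin_sum: "(\<And>i. i \<in> J \<Longrightarrow> polylin A (f i)) \<Longrightarrow> polylin A (\<lambda>u x. \<Sum>i\<in>J. f i u x)"
  by (induction J rule: infinite_finite_induct) (auto intro: polylin_0 polylin_add)

lemma generic_injectivity_polylin:
  assumes A: "finite A" and F: "\<And>F. F \<in> \<F> \<Longrightarrow> polylin A F"
    and inj: "\<forall>x. (\<forall>F\<in>\<F>. F u0 x = 0) \<longrightarrow> (\<forall>k\<in>A. x k = 0)"
  shows "\<exists>\<Delta>. poly \<Delta> u0 \<noteq> 0 \<and> (\<forall>u. poly \<Delta> u \<noteq> 0 \<longrightarrow> (\<forall>x. (\<forall>F\<in>\<F>. F u x = 0) \<longrightarrow> (\<forall>k\<in>A. x k = 0)))"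
proof -
  have "\<forall>F\<in>\<F>. \<exists>\<rho>. \<forall>u x. F u x = (\<Sum>k\<in>A. poly (\<rho> k) u * x k)"
    using F unfolding polylin_def by blast
  from bchoice[OF this] obtain \<rho> where \<rho>: "\<forall>F\<in>\<F>. \<forall>u x. F u x = (\<Sum>k\<in>A. poly (\<rho> F k) u * x k)" by (elim exE)
  have eq: "(\<forall>F\<in>\<rho> ` \<F>. (\<Sum>k\<in>A. poly (F k) u * x k) = 0) \<longleftrightarrow> (\<forall>F\<in>\<F>. F u x = 0)" for u x
    using \<rho> by simp
  show ?thesis using generic_injectivity[OF A, of "\<rho> ` \<F>" u0] inj unfolding eq by blast
qed

definition line :: "config \<Rightarrow> config \<Rightarrow> complex \<Rightarrow> config" where
  "line p q u = (let ln = (\<lambda>f g i j. f i j + u * (g i j - f i j)) in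
     (ln (fst p) (fst q), ln (fst (snd p)) (fst (snd q)), ln (snd (snd p)) (snd (snd q))))"

lemma line_0: "line p q 0 = p" and line_1: "line p q 1 = q"
  by (auto simp: line_def Let_def)

lemma tangent_conds_polylin:
  assumes "F \<in> tangent_conds s r" "4 \<le> s"
  shows "polylin ({..<3} \<times> {..<s} \<times> {..<s}) (\<lambda>u. F (line p q u))"
proof -
  obtain v a b where p: "p = (v, a, b)" by (cases p)
  obtain v' a' b' where q: "q = (v', a', b')" by (cases q)
  show ?thesis using assms unfolding tangent_conds_def
    by (elim UnE CollectE exE conjE)
      (auto simp: line_def p q intro!: polylin_sum polylin_add polylin_scale polylin_proj polyfun_linear)
qed

lemma gluing_conds_polylin:
  assumes "F \<in> gluing_conds s r" "6 \<le> s"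
  shows "polylin ({..<2} \<times> {..<3} \<times> {..<s}) (\<lambda>u. F (line p q u))"
proof -
  obtain v a b where p: "p = (v, a, b)" by (cases p)
  obtain v' a' b' where q: "q = (v', a', b')" by (cases q)
  show ?thesis using assms unfolding gluing_conds_def
    by (elim UnE CollectE exE conjE)
      (auto simp: line_def p q intro!: polylin_sum polylin_add polylin_diff polylin_scale polylin_proj polyfun_linear)
qed

text \<open>Both properties say that a linear system with polynomial coefficients has only the zero
  solution. On the line that joins a configuration of each kind, each of them fails at finitely
  many points only.\<close>

lemma nondefective_and_gluable:
  assumes g: "nondefective s r p" and t: "gluable s r q" and s: "6 \<le> s"
  shows "\<exists>p'. nondefective s r p' \<and> gluable s r p'"
proof -
  have "\<exists>\<Delta>. poly \<Delta> 0 \<noteq> 0 \<and> (\<forall>u. poly \<Delta> u \<noteq> 0 \<longrightarrow> (\<forall>x. (\<forall>F\<in>(\<lambda>F u. F (line p q u)) ` tangent_conds s r. F u x = 0) \<longrightarrow>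
      (\<forall>k\<in>{..<3} \<times> {..<s} \<times> {..<s}. x k = 0)))"
    by (rule generic_injectivity_polylin) (use s g in \<open>auto simp: tangent_conds_polylin line_0 nondefective_def\<close>)
  then obtain \<Delta> where \<Delta>: "poly \<Delta> 0 \<noteq> 0" "\<And>u. poly \<Delta> u \<noteq> 0 \<Longrightarrow> nondefective s r (line p q u)"
    unfolding nondefective_def by auto
  have "\<exists>\<Delta>. poly \<Delta> 1 \<noteq> 0 \<and> (\<forall>u. poly \<Delta> u \<noteq> 0 \<longrightarrow> (\<forall>x. (\<forall>F\<in>(\<lambda>F u. F (line p q u)) ` gluing_conds s r. F u x = 0) \<longrightarrow>
      (\<forall>k\<in>{..<2} \<times> {..<3} \<times> {..<s}. x k = 0)))"
    by (rule generic_injectivity_polylin) (use s t in \<open>auto simp: gluing_conds_polylin line_1 gluable_def\<close>)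
  then obtain \<Delta>' where \<Delta>': "poly \<Delta>' 1 \<noteq> 0" "\<And>u. poly \<Delta>' u \<noteq> 0 \<Longrightarrow> gluable s r (line p q u)"
    unfolding gluable_def by auto
  have "\<Delta> * \<Delta>' \<noteq> 0" using \<Delta>(1) \<Delta>'(1) by auto
  then obtain u where "poly (\<Delta> * \<Delta>') u \<noteq> 0" using exists_poly_nonzero by blast
  then show ?thesis using \<Delta>(2)[of u] \<Delta>'(2)[of u] by (intro exI[of _ "line p q u"]) simp
qed

definition ind :: "nat set \<Rightarrow> nat \<Rightarrow> complex" where
  "ind X j = of_bool (j \<in> X)"

lemma sum_ind:
  assumes "X \<subseteq> {..<n}"
  shows "(\<Sum>j<n. ind X j * f j) = sum f X"
proof -
  have "(\<Sum>j<n. ind X j * f j) = (\<Sum>j\<in>X. ind X j * f j)"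
    by (rule sum.mono_neutral_right) (use assms in \<open>auto simp: ind_def\<close>)
  also have "\<dots> = sum f X" by (rule sum.cong) (auto simp: ind_def)
  finally show ?thesis .
qed

lemma ball_compr:
  "(\<forall>F\<in>{f i |i. P i}. Q F) \<longleftrightarrow> (\<forall>i. P i \<longrightarrow> Q (f i))"
  "(\<forall>F\<in>{f2 i j |i j. P2 i j}. Q F) \<longleftrightarrow> (\<forall>i j. P2 i j \<longrightarrow> Q (f2 i j))"
  "(\<forall>F\<in>{f3 i j k |i j k. P3 i j k}. Q F) \<longleftrightarrow> (\<forall>i j k. P3 i j k \<longrightarrow> Q (f3 i j k))"
  by blast+

lemma tangent_conds_iff:
  "(\<forall>F\<in>tangent_conds s r. F (v, a, b) \<theta> = 0) \<longleftrightarrow>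
     (\<forall>c j k. c < 3 \<longrightarrow> j < s \<longrightarrow> k < s \<longrightarrow> \<theta> (c, j, k) = - \<theta> (c, k, j)) \<and>
     (\<forall>i c. i < r \<longrightarrow> c < 3 \<longrightarrow> (\<Sum>j<s. a i j * (\<Sum>k<s. b i k * \<theta> (c, j, k))) = 0) \<and>
     (\<forall>i k. i < r \<longrightarrow> k < s \<longrightarrow> (\<Sum>c<3. v i c * (\<Sum>j<s. a i j * \<theta> (c, j, k))) = 0) \<and>
     (\<forall>i k. i < r \<longrightarrow> k < s \<longrightarrow> (\<Sum>c<3. v i c * (\<Sum>j<s. b i j * \<theta> (c, j, k))) = 0) \<and>
     \<theta> (2, 1, 3) = 0"
  unfolding tangent_conds_def ball_Un ball_compr
  by (simp only: prod.case sum_distrib_left eq_neg_iff_add_eq_0 conj_assoc imp_conjL ball_simps simp_thms)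

lemma gluing_conds_iff:
  "(\<forall>F\<in>gluing_conds s r. F (v, a, b) z = 0) \<longleftrightarrow>
     (\<forall>i e. i < r \<longrightarrow> e < 2 \<longrightarrow> v i 1 * (\<Sum>j<s. a i j * z (e, 1, j)) + v i 2 * (\<Sum>j<s. a i j * z (e, 2, j)) = 0) \<and>
     (\<forall>i e. i < r \<longrightarrow> e < 2 \<longrightarrow> v i 1 * (\<Sum>j<s. b i j * z (e, 1, j)) + v i 2 * (\<Sum>j<s. b i j * z (e, 2, j)) = 0) \<and>
     (\<forall>i e. i < r \<longrightarrow> e < 2 \<longrightarrow> v i 0 * (\<Sum>j<s. a i j * z (e, 0, j)) - v i 2 * (\<Sum>j<s. a i j * z (e, 2, j)) = 0) \<and>
     (\<forall>i e. i < r \<longrightarrow> e < 2 \<longrightarrow> v i 0 * (\<Sum>j<s. b i j * z (e, 0, j)) - v i 2 * (\<Sum>j<s. b i j * z (e, 2, j)) = 0) \<and>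
     (\<forall>m. m < 3 \<longrightarrow> z (0, m, 5) = z (1, m, 1))"
  unfolding gluing_conds_def ball_Un ball_compr
  by (simp only: prod.case sum_distrib_left right_minus_eq conj_assoc imp_conjL ball_simps simp_thms)

definition ext_v :: "nat \<Rightarrow> (nat \<Rightarrow> nat \<Rightarrow> complex) \<Rightarrow> (nat \<Rightarrow> nat \<Rightarrow> complex) \<Rightarrow> nat \<Rightarrow> nat \<Rightarrow> complex" where
  "ext_v r v nv i = (if i < r then v i else nv (i - r))"

text \<open>Old vectors get the coordinate 0 at the four new indices \<open>s, \<dots>, s + 3\<close>; new vectors are
  indicators of sets of indices.\<close>

definition ext_a :: "nat \<Rightarrow> nat \<Rightarrow> (nat \<Rightarrow> nat \<Rightarrow> complex) \<Rightarrow> (nat \<Rightarrow> nat set) \<Rightarrow> nat \<Rightarrow> nat \<Rightarrow> complex" where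
  "ext_a s r a A i j = (if i < r then (if j < s then a i j else 0) else ind (A (i - r)) j)"

lemma sum_ext_old:
  assumes "i < r"
  shows "(\<Sum>j<s + 4. ext_a s r a A i j * f j) = (\<Sum>j<s. a i j * f j)"
proof -
  have "(\<Sum>j<s + 4. ext_a s r a A i j * f j) = (\<Sum>j<s. ext_a s r a A i j * f j)"
    by (rule sum.mono_neutral_right) (use assms in \<open>auto simp: ext_a_def\<close>)
  also have "\<dots> = (\<Sum>j<s. a i j * f j)"
    by (rule sum.cong) (use assms in \<open>auto simp: ext_a_def\<close>)
  finally show ?thesis .
qed

lemma sum_ext_new:
  assumes "A i \<subseteq> {..<s + 4}"
  shows "(\<Sum>j<s + 4. ext_a s r a A (r + i) j * f j) = sum f (A i)"
  using sum_ind[OF assms, of f] by (simp add: ext_a_def)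

lemma sum_three: "(\<Sum>c<3. f c) = f 0 + f 1 + f (2::nat)" for f :: "nat \<Rightarrow> complex"
  by (simp add: eval_nat_numeral)

text \<open>The base configuration for \<open>s = 7\<close> has the planes \<open>\<langle>e\<^sub>0, e\<^sub>1\<rangle>\<close>, \<open>\<langle>e\<^sub>2, e\<^sub>3\<rangle>\<close>, \<open>\<langle>e\<^sub>4, e\<^sub>5\<rangle>\<close>,
  \<open>\<langle>e\<^sub>2 + e\<^sub>4, e\<^sub>6\<rangle>\<close> and \<open>\<langle>e\<^sub>1 + e\<^sub>3 + e\<^sub>5, e\<^sub>0 + e\<^sub>6\<rangle>\<close>, with the vectors \<open>v\<^sub>0\<close>, \<open>v\<^sub>1\<close>, \<open>v\<^sub>2\<close>,
  \<open>v\<^sub>0 + v\<^sub>1\<close> and \<open>v\<^sub>0 + v\<^sub>1 + v\<^sub>2\<close> of \<open>V\<close>.\<close>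

definition base_a :: "nat \<Rightarrow> nat set" where
  "base_a i = (if i = 0 then {0} else if i = 1 then {2} else if i = 2 then {4} else if i = 3 then {2, 4} else {1, 3, 5})"

definition base_b :: "nat \<Rightarrow> nat set" where
  "base_b i = (if i = 0 then {1} else if i = 1 then {3} else if i = 2 then {5} else if i = 3 then {6} else {0, 6})"

definition base_v :: "nat \<Rightarrow> nat set" where
  "base_v i = (if i = 3 then {0, 1} else if i = 4 then {0, 1, 2} else {i})"

lemma base_bounds: "base_a i \<subseteq> {..<7}" "base_b i \<subseteq> {..<7}" "i < 5 \<Longrightarrow> base_v i \<subseteq> {..<3}"
  by (auto simp: base_a_def base_b_def base_v_def)

lemma skew_zero: "x = - x \<Longrightarrow> x = (0::complex)"
  unfolding complex_eq_iff by simp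

lemma less_7_cases: "(k::nat) < 7 \<longleftrightarrow> k = 0 \<or> k = 1 \<or> k = 2 \<or> k = 3 \<or> k = 4 \<or> k = 5 \<or> k = 6"
  by auto

lemma skew_array_zero:
  fixes p :: "nat \<Rightarrow> nat \<Rightarrow> complex"
  assumes "\<And>j k. j < 7 \<Longrightarrow> k < 7 \<Longrightarrow> p j k = - p k j"
    and "\<And>k. 0 < k \<Longrightarrow> k < 7 \<Longrightarrow> p 0 k = 0" "\<And>k. 1 < k \<Longrightarrow> k < 7 \<Longrightarrow> p 1 k = 0" "\<And>k. 2 < k \<Longrightarrow> k < 7 \<Longrightarrow> p 2 k = 0"
      "\<And>k. 3 < k \<Longrightarrow> k < 7 \<Longrightarrow> p 3 k = 0" "\<And>k. 4 < k \<Longrightarrow> k < 7 \<Longrightarrow> p 4 k = 0" "p 5 6 = 0"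
    and "j < 7" "k < 7"
  shows "p j k = 0"
proof -
  have up: "p j k = 0" if "j < k" "k < 7" for j k
  proof -
    have "j = 0 \<or> j = 1 \<or> j = 2 \<or> j = 3 \<or> j = 4 \<or> j = 5 \<and> k = 6" using that by auto
    then show ?thesis using assms(2-7) that by auto
  qed
  show ?thesis
  proof (cases j k rule: linorder_cases)
    case less
    then show ?thesis using up assms by blast
  next
    case equal
    then show ?thesis using assms(1)[of j j] assms(8) skew_zero by blast
  next
    case greater
    then show ?thesis using up[of k j] assms(1)[of j k] assms(8,9) by simp
  qed
qed

text \<open>Write \<open>p\<close>, \<open>q\<close>, \<open>r\<close> for the three skew forms. The tensors with \<open>v\<^sub>0\<close>, \<open>v\<^sub>1\<close> and \<open>v\<^sub>2\<close> make
  two rows of each form vanish; the remaining conditions then give the other entries one after the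
  other.\<close>

lemma nondefective_base: "nondefective 7 5 (\<lambda>i. ind (base_v i), \<lambda>i. ind (base_a i), \<lambda>i. ind (base_b i))"
  unfolding nondefective_def
proof (intro allI impI ballI)
  fix \<theta> and x :: "nat \<times> nat \<times> nat"
  assume "\<forall>F\<in>tangent_conds 7 5. F (\<lambda>i. ind (base_v i), \<lambda>i. ind (base_a i), \<lambda>i. ind (base_b i)) \<theta> = 0"
    and x: "x \<in> {..<3} \<times> {..<7} \<times> {..<7}"
  then have G: "\<forall>F\<in>tangent_conds 7 5. F (\<lambda>i. ind (base_v i), \<lambda>i. ind (base_a i), \<lambda>i. ind (base_b i)) \<theta> = 0"
    by blast
  note G = G[unfolded tangent_conds_iff]
  have g1: "\<theta> (c, j, k) = - \<theta> (c, k, j)" if "c < 3" "j < 7" "k < 7" for c j k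
    using G that by blast
  have g2: "(\<Sum>j\<in>base_a i. \<Sum>k\<in>base_b i. \<theta> (c, j, k)) = 0" if "i < 5" "c < 3" for i c
    using G[THEN conjunct2, THEN conjunct1, rule_format, OF that]
    by (simp only: sum_ind[OF base_bounds(1)] sum_ind[OF base_bounds(2)])
  have g3: "(\<Sum>c\<in>base_v i. \<Sum>j\<in>base_a i. \<theta> (c, j, k)) = 0" if "i < 5" "k < 7" for i k
    using G[THEN conjunct2, THEN conjunct2, THEN conjunct1, rule_format, OF that]
    by (simp only: sum_ind[OF base_bounds(1)] sum_ind[OF base_bounds(3)[OF that(1)]])
  have g4: "(\<Sum>c\<in>base_v i. \<Sum>j\<in>base_b i. \<theta> (c, j, k)) = 0" if "i < 5" "k < 7" for i k
    using G[THEN conjunct2, THEN conjunct2, THEN conjunct2, THEN conjunct1, rule_format, OF that]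
    by (simp only: sum_ind[OF base_bounds(2)] sum_ind[OF base_bounds(3)[OF that(1)]])
  have g5: "\<theta> (2, 1, 3) = 0" using G by blast
  define p where "p j k = \<theta> (0, j, k)" for j k
  define q where "q j k = \<theta> (1, j, k)" for j k
  define r where "r j k = \<theta> (2, j, k)" for j k
  have fold: "\<theta> (0, j, k) = p j k" "\<theta> (1, j, k) = q j k" "\<theta> (Suc 0, j, k) = q j k" "\<theta> (2, j, k) = r j k" for j k
    by (simp_all add: p_def q_def r_def)
  have sk: "p j k = - p k j" "q j k = - q k j" "r j k = - r k j" if "j < 7" "k < 7" for j k
    unfolding p_def q_def r_def by (rule g1, simp_all add: that)+
  have sk': "p j k = - p k j" "q j k = - q k j" "r j k = - r k j" if "k < j" "j < 7" for j k
    by (rule sk, use that in simp_all)+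
  have dg: "p j j = 0" "q j j = 0" "r j j = 0" if "j < 7" for j
    using sk[OF that that] skew_zero by blast+
  have z0: "p 0 k = 0" "p 1 k = 0" "q 2 k = 0" "q 3 k = 0" "r 4 k = 0" "r 5 k = 0" if "k < 7" for k
    using that g3[of 0 k] g4[of 0 k] g3[of 1 k] g4[of 1 k] g3[of 2 k] g4[of 2 k]
    by (simp_all add: base_v_def base_a_def base_b_def fold)
  have z0': "p k 0 = 0" "p k 1 = 0" "q k 2 = 0" "q k 3 = 0" "r k 4 = 0" "r k 5 = 0" if "k < 7" for k
    using z0[OF that] sk[OF that, of 0] sk[OF that, of 1] sk[OF that, of 2] sk[OF that, of 3]
      sk[OF that, of 4] sk[OF that, of 5] by simp_all
  have i0: "q 0 1 = 0" "r 0 1 = 0" and i1: "p 2 3 = 0" "r 2 3 = 0" and i2: "p 4 5 = 0" "q 4 5 = 0"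
    using g2[of 0 1] g2[of 0 2] g2[of 1 0] g2[of 1 2] g2[of 2 0] g2[of 2 1]
    by (simp_all add: base_a_def base_b_def fold)
  have i3: "p 2 6 + p 4 6 = 0" "q 2 6 + q 4 6 = 0" "r 2 6 + r 4 6 = 0"
    using g2[of 3 0] g2[of 3 1] g2[of 3 2] by (simp_all add: base_a_def base_b_def fold)
  have i4: "p 1 0 + (p 3 0 + p 5 0) + (p 1 6 + (p 3 6 + p 5 6)) = 0"
    using g2[of 4 0] by (simp add: base_a_def base_b_def fold sum.distrib)
  have K4a: "p 2 k + q 2 k + (p 4 k + q 4 k) = 0" and K4b: "p 6 k + q 6 k = 0" if "k < 7" for k
    using that g3[of 3 k] g4[of 3 k] by (simp_all add: base_v_def base_a_def base_b_def fold)
  have K5a: "p 1 k + (q 1 k + r 1 k) + (p 3 k + (q 3 k + r 3 k) + (p 5 k + (q 5 k + r 5 k))) = 0"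
    and K5b: "p 0 k + (q 0 k + r 0 k) + (p 6 k + (q 6 k + r 6 k)) = 0" if "k < 7" for k
    using that g3[of 4 k] g4[of 4 k] by (simp_all add: base_v_def base_a_def base_b_def fold)
  have r13: "r 1 3 = 0" using g5 by (simp add: fold)
  note S = sk' dg z0[unfolded One_nat_def] z0'[unfolded One_nat_def] i0[unfolded One_nat_def] i1 i2 r13[unfolded One_nat_def]
  have a: "q 0 6 = 0" "q (Suc 0) 6 = 0" "p 2 6 = 0" "p 3 6 = 0"
    using K4b[of 0] K4b[of 1] K4b[of 2] K4b[of 3] by (simp_all add: S)
  have b: "p 4 6 = 0" "q 4 6 = 0" "r 2 6 = 0" using i3 by (simp_all add: S a)
  have c: "q 0 4 = 0" "q (Suc 0) 4 = 0" "p 2 4 = 0" "p 3 4 = 0" "p 2 5 = 0"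
    using K4a[of 0] K4a[of 1] K4a[of 2] K4a[of 3] K4a[of 5] by (simp_all add: S a b)
  have d: "r (Suc 0) 6 = 0" "r 0 2 = 0" using K5b[of 1] K5b[of 2] by (simp_all add: S a b c)
  have e: "q 0 5 = 0"
  proof -
    have "- p 5 6 = q 5 6" using K4b[of 5] by (simp add: S) 
    then show ?thesis using K5b[of 5] by (simp add: S a b c d)
  qed
  have f: "r 0 6 = 0" using K5b[of 6] by (simp add: S a b c d e)
  have h: "r 0 3 = 0" using K5a[of 0] by (simp add: S a b c d e f)
  have h': "r 3 6 = 0" using K5b[of 3] by (simp add: S a b c d e f h)
  have i: "r (Suc 0) 2 = 0" using K5a[of 2] by (simp add: S a b c d e f h h')
  have j: "p 3 5 = 0" "q (Suc 0) 5 = 0" using K5a[of 3] K5a[of 1] by (simp_all add: S a b c d e f h h' i)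
  have k: "p 5 6 = 0" using i4 by (simp add: S a b c d e f h h' i j)
  have l: "q 5 6 = 0" using K4b[of 5] k by (simp add: S)
  note ZZ = z0[unfolded One_nat_def] z0'[unfolded One_nat_def] i0[unfolded One_nat_def] i1 i2
    r13[unfolded One_nat_def] a b c d e f h h' i j k l
  have up: "0 < k \<Longrightarrow> k < 7 \<Longrightarrow> k = 1 \<or> k = 2 \<or> k = 3 \<or> k = 4 \<or> k = 5 \<or> k = 6"
    "1 < k \<Longrightarrow> k < 7 \<Longrightarrow> k = 2 \<or> k = 3 \<or> k = 4 \<or> k = 5 \<or> k = 6"
    "2 < k \<Longrightarrow> k < 7 \<Longrightarrow> k = 3 \<or> k = 4 \<or> k = 5 \<or> k = 6"
    "3 < k \<Longrightarrow> k < 7 \<Longrightarrow> k = 4 \<or> k = 5 \<or> k = 6"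
    "4 < k \<Longrightarrow> k < 7 \<Longrightarrow> k = 5 \<or> k = 6" for k :: nat by auto
  have "p j k = 0" if "j < 7" "k < 7" for j k
  proof (rule skew_array_zero[OF sk(1) _ _ _ _ _ _ that])
    show "p 0 k = 0" if "0 < k" "k < 7" for k
      using up(1)[OF that] by (elim disjE; simp add: ZZ)
    show "p 1 k = 0" if "1 < k" "k < 7" for k
      using up(2)[OF that] by (elim disjE; simp add: ZZ)
    show "p 2 k = 0" if "2 < k" "k < 7" for k
      using up(3)[OF that] by (elim disjE; simp add: ZZ)
    show "p 3 k = 0" if "3 < k" "k < 7" for k
      using up(4)[OF that] by (elim disjE; simp add: ZZ)
    show "p 4 k = 0" if "4 < k" "k < 7" for k
      using up(5)[OF that] by (elim disjE; simp add: ZZ)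
    show "p 5 6 = 0" by (simp add: ZZ)
  qed
  moreover have "q j k = 0" if "j < 7" "k < 7" for j k
  proof (rule skew_array_zero[OF sk(2) _ _ _ _ _ _ that])
    show "q 0 k = 0" if "0 < k" "k < 7" for k
      using up(1)[OF that] by (elim disjE; simp add: ZZ)
    show "q 1 k = 0" if "1 < k" "k < 7" for k
      using up(2)[OF that] by (elim disjE; simp add: ZZ)
    show "q 2 k = 0" if "2 < k" "k < 7" for k
      using up(3)[OF that] by (elim disjE; simp add: ZZ)
    show "q 3 k = 0" if "3 < k" "k < 7" for k
      using up(4)[OF that] by (elim disjE; simp add: ZZ)
    show "q 4 k = 0" if "4 < k" "k < 7" for k
      using up(5)[OF that] by (elim disjE; simp add: ZZ)
    show "q 5 6 = 0" by (simp add: ZZ)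
  qed
  moreover have "r j k = 0" if "j < 7" "k < 7" for j k
  proof (rule skew_array_zero[OF sk(3) _ _ _ _ _ _ that])
    show "r 0 k = 0" if "0 < k" "k < 7" for k
      using up(1)[OF that] by (elim disjE; simp add: ZZ)
    show "r 1 k = 0" if "1 < k" "k < 7" for k
      using up(2)[OF that] by (elim disjE; simp add: ZZ)
    show "r 2 k = 0" if "2 < k" "k < 7" for k
      using up(3)[OF that] by (elim disjE; simp add: ZZ)
    show "r 3 k = 0" if "3 < k" "k < 7" for k
      using up(4)[OF that] by (elim disjE; simp add: ZZ)
    show "r 4 k = 0" if "4 < k" "k < 7" for k
      using up(5)[OF that] by (elim disjE; simp add: ZZ)
    show "r 5 6 = 0" by (simp add: ZZ)
  qed
  moreover obtain c' j' k' where "x = (c', j', k')" by (cases x)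
  moreover from this have "c' = 0 \<or> c' = 1 \<or> c' = 2" "j' < 7" "k' < 7" using x by auto
  ultimately show "\<theta> x = 0" by (auto simp: fold)
qed

text \<open>For a vector of \<open>V\<close> with the coordinate \<open>i\<close> equal to 0 and the other two equal to 1, the
  gluing conditions say that the two unknowns other than \<open>z (e, i, _)\<close> vanish at \<open>a\<close> and \<open>b\<close>. The
  first three tensors are of this form.\<close>

definition gluing_base_v :: "nat \<Rightarrow> nat \<Rightarrow> complex" where
  "gluing_base_v i c = (if i = 4 then of_nat (c + 1) else if i = 3 then 1 else if c = i then 0 else 1)"

text \<open>The five planes span the space, and the conditions other than the last one leave a single
  free parameter \<open>z (e, 2, 5)\<close> for each \<open>e\<close>. The condition that joins \<open>e = 0\<close> with \<open>e = 1\<close> removes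
  both parameters.\<close>

lemma gluable_base: "gluable 7 5 (gluing_base_v, \<lambda>i. ind (base_a i), \<lambda>i. ind (base_b i))"
  unfolding gluable_def
proof (intro allI impI ballI)
  fix z and x :: "nat \<times> nat \<times> nat"
  assume "\<forall>F\<in>gluing_conds 7 5. F (gluing_base_v, \<lambda>i. ind (base_a i), \<lambda>i. ind (base_b i)) z = 0"
    and x: "x \<in> {..<2} \<times> {..<3} \<times> {..<7}"
  then have g: 
    "\<And>i e. i < 5 \<Longrightarrow> e < 2 \<Longrightarrow> gluing_base_v i 1 * (\<Sum>j\<in>base_a i. z (e, 1, j)) + gluing_base_v i 2 * (\<Sum>j\<in>base_a i. z (e, 2, j)) = 0"
    "\<And>i e. i < 5 \<Longrightarrow> e < 2 \<Longrightarrow> gluing_base_v i 1 * (\<Sum>j\<in>base_b i. z (e, 1, j)) + gluing_base_v i 2 * (\<Sum>j\<in>base_b i. z (e, 2, j)) = 0"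
    "\<And>i e. i < 5 \<Longrightarrow> e < 2 \<Longrightarrow> gluing_base_v i 0 * (\<Sum>j\<in>base_a i. z (e, 0, j)) - gluing_base_v i 2 * (\<Sum>j\<in>base_a i. z (e, 2, j)) = 0"
    "\<And>i e. i < 5 \<Longrightarrow> e < 2 \<Longrightarrow> gluing_base_v i 0 * (\<Sum>j\<in>base_b i. z (e, 0, j)) - gluing_base_v i 2 * (\<Sum>j\<in>base_b i. z (e, 2, j)) = 0"
    "\<And>m. m < 3 \<Longrightarrow> z (0, m, 5) = z (1, m, 1)"
    unfolding gluing_conds_iff by (simp_all add: sum_ind base_bounds)
  have main: "z (e, 0, j) = 0 \<or> j = 1" "z (e, 1, j) = 0 \<or> j = 3" "z (e, 2, j) = 0 \<or> j = 5"
    "z (e, 0, 1) = 3 * z (e, 2, 5)" "2 * z (e, 1, 3) = - 3 * z (e, 2, 5)"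
    if e: "e < 2" and "j < 7" for e j
  proof -
    define p where "p j = z (e, 0, j)" for j
    define q where "q j = z (e, 1, j)" for j
    define r where "r j = z (e, 2, j)" for j
    have fold: "z (e, 0, j) = p j" "z (e, 1, j) = q j" "z (e, Suc 0, j) = q j" "z (e, 2, j) = r j" for j
      by (simp_all add: p_def q_def r_def)
    note D = gluing_base_v_def base_a_def base_b_def fold
    have c0: "r 0 = 0" "r (Suc 0) = 0" "q 0 = 0" "q (Suc 0) = 0"
      using g(1)[of 0 e] g(2)[of 0 e] g(3)[of 0 e] g(4)[of 0 e] e by (simp_all add: D)
    have c1: "r 2 = 0" "r 3 = 0" "p 2 = 0" "p 3 = 0"
      using g(1)[of 1 e] g(2)[of 1 e] g(3)[of 1 e] g(4)[of 1 e] e by (simp_all add: D)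
    have c2: "q 4 = 0" "q 5 = 0" "p 4 = 0" "p 5 = 0"
      using g(1)[of 2 e] g(2)[of 2 e] g(3)[of 2 e] g(4)[of 2 e] e by (simp_all add: D)
    have c3: "r 4 = 0" "p 6 = r 6" using g(3)[of 3 e] g(4)[of 3 e] e by (simp_all add: D c0 c1 c2)
    have c3': "q 2 = 0" "q 6 = - r 6" using g(1)[of 3 e] g(2)[of 3 e] e by (simp_all add: D c0 c1 c2 c3 eq_neg_iff_add_eq_0)
    have c4: "r 6 = 0" using g(2)[of 4 e] e by (simp add: D c0 c1 c2 c3 c3')
    then have c4': "p 0 = 0" using g(4)[of 4 e] e by (simp add: D c0 c1 c2 c3 c3')
    have c5: "2 * q 3 + 3 * r 5 = 0" "p (Suc 0) = 3 * r 5"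
      using g(1)[of 4 e] g(3)[of 4 e] e by (simp_all add: D c0 c1 c2 c3 c3' c4 c4')
    show "z (e, 0, j) = 0 \<or> j = 1" "z (e, 1, j) = 0 \<or> j = 3" "z (e, 2, j) = 0 \<or> j = 5"
      using \<open>j < 7\<close> unfolding less_7_cases fold by (auto simp: c0 c1 c2 c3 c3' c4 c4')
    show "z (e, 0, 1) = 3 * z (e, 2, 5)" "2 * z (e, 1, 3) = - 3 * z (e, 2, 5)"
      using c5 unfolding fold by (simp_all add: eq_neg_iff_add_eq_0)
  qed
  have "z (0, 2, 5) = 0" using g(5)[of 2] main(3)[of 1 1] by simp
  moreover have "z (1, 2, 5) = 0" using g(5)[of 0] main(1)[of 0 5] main(4)[of 1 0] by simp
  ultimately have t: "z (e, 2, 5) = 0" if "e < 2" for e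
    using that by (cases "e = 0") (auto simp: less_2_cases_iff)
  obtain e m j where ej: "x = (e, m, j)" by (cases x)
  then have b: "e < 2" "m = 0 \<or> m = 1 \<or> m = 2" "j < 7" using x by auto
  show "z x = 0"
    using main[OF b(1,3)] main(4,5)[OF b(1,3)] t[OF b(1)] b(2) unfolding ej by auto
qed

definition gluing_new_v :: "nat \<Rightarrow> nat \<Rightarrow> complex" where
  "gluing_new_v i c = (if c = i then 0 else 1)"

text \<open>The three new planes \<open>\<langle>e\<^sub>s, e\<^sub>s\<^sub>+\<^sub>1\<rangle>\<close>, \<open>\<langle>e\<^sub>s\<^sub>+\<^sub>2, e\<^sub>s\<^sub>+\<^sub>3\<rangle>\<close> and the diagonal plane \<open>\<langle>e\<^sub>s +
  e\<^sub>s\<^sub>+\<^sub>2, e\<^sub>s\<^sub>+\<^sub>1 + e\<^sub>s\<^sub>+\<^sub>3\<rangle>\<close> with the vectors \<open>gluing_new_v\<close> kill the unknowns at the new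
  indices, one unknown after the other.\<close>

lemma gluable_step:
  assumes t: "gluable s r (v, a, b)" and s: "7 \<le> s"
  shows "\<exists>p. gluable (s + 4) (r + 3) p"
proof -
  define A where "A i = (if i = 0 then {s} else if i = 1 then {s + 2} else {s, s + 2})" for i :: nat
  define B where "B i = (if i = 0 then {s + 1} else if i = 1 then {s + 3} else {s + 1, s + 3})" for i :: nat
  have AB: "A i \<subseteq> {..<s + 4}" "B i \<subseteq> {..<s + 4}" for i by (auto simp: A_def B_def)
  let ?v = "ext_v r v gluing_new_v" and ?a = "ext_a s r a A" and ?b = "ext_a s r b B"
  have "gluable (s + 4) (r + 3) (?v, ?a, ?b)"
    unfolding gluable_def
  proof (intro allI impI ballI)
    fix z and x :: "nat \<times> nat \<times> nat"
    assume z: "\<forall>F\<in>gluing_conds (s + 4) (r + 3). F (?v, ?a, ?b) z = 0"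
      and x: "x \<in> {..<2} \<times> {..<3} \<times> {..<s + 4}"
    note g = z[unfolded gluing_conds_iff]
    note t1 = g[THEN conjunct1, rule_format]
      and t2 = g[THEN conjunct2, THEN conjunct1, rule_format]
      and t3 = g[THEN conjunct2, THEN conjunct2, THEN conjunct1, rule_format]
      and t4 = g[THEN conjunct2, THEN conjunct2, THEN conjunct2, THEN conjunct1, rule_format]
    have "\<forall>F\<in>gluing_conds s r. F (v, a, b) z = 0"
      unfolding gluing_conds_iff
    proof (intro conjI allI impI)
      fix i e :: nat assume ie: "i < r" "e < 2"
      then have v: "?v i = v i" "i < r + 3" by (simp_all add: ext_v_def)
      show "v i 1 * (\<Sum>j<s. a i j * z (e, 1, j)) + v i 2 * (\<Sum>j<s. a i j * z (e, 2, j)) = 0"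
        "v i 1 * (\<Sum>j<s. b i j * z (e, 1, j)) + v i 2 * (\<Sum>j<s. b i j * z (e, 2, j)) = 0"
        "v i 0 * (\<Sum>j<s. a i j * z (e, 0, j)) - v i 2 * (\<Sum>j<s. a i j * z (e, 2, j)) = 0"
        "v i 0 * (\<Sum>j<s. b i j * z (e, 0, j)) - v i 2 * (\<Sum>j<s. b i j * z (e, 2, j)) = 0"
        using t1[OF v(2) ie(2)] t2[OF v(2) ie(2)] t3[OF v(2) ie(2)] t4[OF v(2) ie(2)]
        by (simp_all only: v(1) sum_ext_old[OF ie(1)])
    qed (use g in blast)
    then have old: "\<forall>k\<in>{..<2} \<times> {..<3} \<times> {..<s}. z k = 0" using t unfolding gluable_def by blast
    have new: "gluing_new_v i 1 * (\<Sum>j\<in>A i. z (e, 1, j)) + gluing_new_v i 2 * (\<Sum>j\<in>A i. z (e, 2, j)) = 0"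
      "gluing_new_v i 1 * (\<Sum>j\<in>B i. z (e, 1, j)) + gluing_new_v i 2 * (\<Sum>j\<in>B i. z (e, 2, j)) = 0"
      "gluing_new_v i 0 * (\<Sum>j\<in>A i. z (e, 0, j)) - gluing_new_v i 2 * (\<Sum>j\<in>A i. z (e, 2, j)) = 0"
      "gluing_new_v i 0 * (\<Sum>j\<in>B i. z (e, 0, j)) - gluing_new_v i 2 * (\<Sum>j\<in>B i. z (e, 2, j)) = 0"
      if ie: "i < 3" "e < 2" for i e
    proof -
      have v: "?v (r + i) = gluing_new_v i" "r + i < r + 3" using ie by (simp_all add: ext_v_def)
      show "gluing_new_v i 1 * (\<Sum>j\<in>A i. z (e, 1, j)) + gluing_new_v i 2 * (\<Sum>j\<in>A i. z (e, 2, j)) = 0"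
        "gluing_new_v i 1 * (\<Sum>j\<in>B i. z (e, 1, j)) + gluing_new_v i 2 * (\<Sum>j\<in>B i. z (e, 2, j)) = 0"
        "gluing_new_v i 0 * (\<Sum>j\<in>A i. z (e, 0, j)) - gluing_new_v i 2 * (\<Sum>j\<in>A i. z (e, 2, j)) = 0"
        "gluing_new_v i 0 * (\<Sum>j\<in>B i. z (e, 0, j)) - gluing_new_v i 2 * (\<Sum>j\<in>B i. z (e, 2, j)) = 0"
        using t1[OF v(2) ie(2)] t2[OF v(2) ie(2)] t3[OF v(2) ie(2)] t4[OF v(2) ie(2)]
        by (simp_all only: v(1) sum_ext_new[OF AB(1)] sum_ext_new[OF AB(2)])
    qed
    obtain e m j where ej: "x = (e, m, j)" by (cases x)
    then have b: "e < 2" "m = 0 \<or> m = 1 \<or> m = 2" "j < s + 4" using x by auto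
    have 1: "z (e, 2, s) = 0" "z (e, 1, s) = 0" "z (e, 2, s + 1) = 0" "z (e, 1, s + 1) = 0"
      using new[of 0 e] b(1) by (simp_all add: gluing_new_v_def A_def B_def)
    have 2: "z (e, 2, s + 2) = 0" "z (e, 0, s + 2) = 0" "z (e, 2, s + 3) = 0" "z (e, 0, s + 3) = 0"
      using new[of 1 e] b(1) by (simp_all add: gluing_new_v_def A_def B_def)
    have 3: "z (e, 1, s + 2) = 0" "z (e, 0, s) = 0" "z (e, 1, s + 3) = 0" "z (e, 0, s + 1) = 0"
      using new[of 2 e] b(1) 1 2 by (simp_all add: gluing_new_v_def A_def B_def)
    show "z x = 0"
    proof (cases "j < s")
      case True
      then show ?thesis using old b ej by auto
    next
      case False
      then have "j = s \<or> j = s + 1 \<or> j = s + 2 \<or> j = s + 3" using b(3) by auto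
      then show ?thesis using b(2) unfolding ej by (elim disjE) (simp_all only: 1 2 3)
    qed
  qed
  then show ?thesis ..
qed

lemma gluable_exists: "l \<ge> 1 \<Longrightarrow> \<exists>p. gluable (4 * l + 3) (3 * l + 2) p"
proof (induction l rule: nat_induct_at_least)
  case base
  show ?case using gluable_base by (auto simp: numeral_eq_Suc)
next
  case (Suc l)
  then obtain v a b where "gluable (4 * l + 3) (3 * l + 2) (v, a, b)" by (metis prod_cases3)
  from gluable_step[OF this] Suc show ?case by (simp add: algebra_simps)
qed

text \<open>The new rank one tensors are \<open>v\<^sub>0 \<otimes> (e\<^sub>s \<and> e\<^sub>s\<^sub>+\<^sub>1)\<close>, \<open>v\<^sub>1 \<otimes> (e\<^sub>s\<^sub>+\<^sub>2 \<and> e\<^sub>s\<^sub>+\<^sub>3)\<close> and \<open>v\<^sub>2 \<otimes>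
  ((e\<^sub>s + e\<^sub>s\<^sub>+\<^sub>2 + e\<^sub>1) \<and> (e\<^sub>s\<^sub>+\<^sub>1 + e\<^sub>s\<^sub>+\<^sub>3 + e\<^sub>5))\<close>. A functional \<open>\<theta>\<close> that satisfies all
  conditions satisfies the old conditions on the old coordinates, where it vanishes by induction.
  The new tensors with \<open>v\<^sub>0\<close> and \<open>v\<^sub>1\<close> kill half of the rows of \<open>\<theta>\<^sub>0\<close> and \<open>\<theta>\<^sub>1\<close> at new indices,
  and the one with \<open>v\<^sub>2\<close> identifies the rows of \<open>\<theta>\<^sub>2\<close> up to sign. What is left of the mixed
  coordinates satisfies the gluing conditions, and is 0. The coordinates at two new indices then
  vanish as well.\<close>

lemma nondefective_step:
  assumes t: "gluable s r (v, a, b)" and gd: "nondefective s r (v, a, b)" and s: "7 \<le> s"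
  shows "\<exists>p. nondefective (s + 4) (r + 3) p"
proof -
  define A where "A i = (if i = 0 then {s} else if i = 1 then {s + 2} else {s, s + 2, 1})" for i :: nat
  define B where "B i = (if i = 0 then {s + 1} else if i = 1 then {s + 3} else {s + 1, s + 3, 5})" for i :: nat
  have AB: "A i \<subseteq> {..<s + 4}" "B i \<subseteq> {..<s + 4}" for i using s by (auto simp: A_def B_def)
  let ?v = "ext_v r v (\<lambda>i. ind {i})" and ?a = "ext_a s r a A" and ?b = "ext_a s r b B"
  have "nondefective (s + 4) (r + 3) (?v, ?a, ?b)"
    unfolding nondefective_def
  proof (intro allI impI ballI)
    fix \<theta> and x :: "nat \<times> nat \<times> nat"
    assume \<theta>: "\<forall>F\<in>tangent_conds (s + 4) (r + 3). F (?v, ?a, ?b) \<theta> = 0"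
      and x: "x \<in> {..<3} \<times> {..<s + 4} \<times> {..<s + 4}"
    note g = \<theta>[unfolded tangent_conds_iff]
    have sk: "\<theta> (c, j, k) = - \<theta> (c, k, j)" if "c < 3" "j < s + 4" "k < s + 4" for c j k
      using g that by blast
    have old_iso: "(\<Sum>j<s. a i j * (\<Sum>k<s. b i k * \<theta> (c, j, k))) = 0" if "i < r" "c < 3" for i c
    proof -
      have "i < r + 3" using that by simp
      then have "(\<Sum>j<s + 4. ?a i j * (\<Sum>k<s + 4. ?b i k * \<theta> (c, j, k))) = 0" using g that(2) by blast
      then show ?thesis by (simp only: sum_ext_old[OF that(1)])
    qed
    have old: "(\<Sum>c<3. v i c * (\<Sum>j<s. a i j * \<theta> (c, j, k))) = 0"
      "(\<Sum>c<3. v i c * (\<Sum>j<s. b i j * \<theta> (c, j, k))) = 0" if "i < r" "k < s + 4" for i k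
    proof -
      have v: "?v i = v i" using that by (simp add: ext_v_def)
      have "i < r + 3" using that by simp
      then have "(\<Sum>c<3. ?v i c * (\<Sum>j<s + 4. ?a i j * \<theta> (c, j, k))) = 0"
        "(\<Sum>c<3. ?v i c * (\<Sum>j<s + 4. ?b i j * \<theta> (c, j, k))) = 0" using g that(2) by blast+
      then show "(\<Sum>c<3. v i c * (\<Sum>j<s. a i j * \<theta> (c, j, k))) = 0"
        "(\<Sum>c<3. v i c * (\<Sum>j<s. b i j * \<theta> (c, j, k))) = 0" by (simp_all only: sum_ext_old[OF that(1)] v)
    qed
    have new_iso: "(\<Sum>j\<in>A i. \<Sum>k\<in>B i. \<theta> (c, j, k)) = 0" if "i < 3" "c < 3" for i c
    proof -
      have "r + i < r + 3" using that by simp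
      then have "(\<Sum>j<s + 4. ?a (r + i) j * (\<Sum>k<s + 4. ?b (r + i) k * \<theta> (c, j, k))) = 0" using g that(2) by blast
      then show ?thesis by (simp only: sum_ext_new[OF AB(1)] sum_ext_new[OF AB(2)])
    qed
    have new: "(\<Sum>j\<in>A i. \<theta> (i, j, k)) = 0" "(\<Sum>j\<in>B i. \<theta> (i, j, k)) = 0" if "i < 3" "k < s + 4" for i k
    proof -
      have v: "?v (r + i) = ind {i}" by (simp add: ext_v_def)
      have i: "{i} \<subseteq> {..<3}" using that by simp
      have "r + i < r + 3" using that by simp
      then have "(\<Sum>c<3. ?v (r + i) c * (\<Sum>j<s + 4. ?a (r + i) j * \<theta> (c, j, k))) = 0"
        "(\<Sum>c<3. ?v (r + i) c * (\<Sum>j<s + 4. ?b (r + i) j * \<theta> (c, j, k))) = 0" using g that(2) by blast+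
      then show "(\<Sum>j\<in>A i. \<theta> (i, j, k)) = 0" "(\<Sum>j\<in>B i. \<theta> (i, j, k)) = 0"
        by (simp_all add: sum_ext_new[OF AB(1)] sum_ext_new[OF AB(2)] v sum_ind[OF i])
    qed
    have "\<forall>F\<in>tangent_conds s r. F (v, a, b) \<theta> = 0"
      unfolding tangent_conds_iff
    proof (intro conjI allI impI)
      show "\<theta> (c, j, k) = - \<theta> (c, k, j)" if "c < 3" "j < s" "k < s" for c j k
        by (rule sk) (use that in simp_all)
      show "(\<Sum>c<3. v i c * (\<Sum>j<s. a i j * \<theta> (c, j, k))) = 0" if "i < r" "k < s" for i k
        by (rule old(1)) (use that in simp_all)
      show "(\<Sum>c<3. v i c * (\<Sum>j<s. b i j * \<theta> (c, j, k))) = 0" if "i < r" "k < s" for i k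
        by (rule old(2)) (use that in simp_all)
      show "\<theta> (2, 1, 3) = 0" using g by blast
    qed (rule old_iso)
    then have W: "\<theta> (c, j, k) = 0" if "c < 3" "j < s" "k < s" for c j k
      using gd that unfolding nondefective_def by auto
    have dist: "s \<noteq> 1" "s \<noteq> 5" "1 < s" "5 < s" using s by auto
    have n0: "\<theta> (0, s, k) = 0" "\<theta> (0, s + 1, k) = 0" "\<theta> (1, s + 2, k) = 0" "\<theta> (1, s + 3, k) = 0" if "k < s + 4" for k
      using new[of 0 k] new[of 1 k] that by (simp_all add: A_def B_def)
    have n0': "\<theta> (0, k, s) = 0" "\<theta> (0, k, s + 1) = 0" "\<theta> (1, k, s + 2) = 0" "\<theta> (1, k, s + 3) = 0" if "k < s + 4" for k
      using n0[OF that] sk[of 0 k s] sk[of 0 k "s + 1"] sk[of 1 k "s + 2"] sk[of 1 k "s + 3"] that by simp_all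
    have n2: "\<theta> (2, s, k) + (\<theta> (2, s + 2, k) + \<theta> (2, 1, k)) = 0"
      "\<theta> (2, s + 1, k) + (\<theta> (2, s + 3, k) + \<theta> (2, 5, k)) = 0" if "k < s + 4" for k
      using new[of 2 k] that dist by (simp_all add: A_def B_def)
    have is0: "\<theta> (c, s, s + 1) = 0" "\<theta> (c, s + 2, s + 3) = 0" if "c < 3" for c
      using new_iso[of 0 c] new_iso[of 1 c] that by (simp_all add: A_def B_def)
    have is2: "\<theta> (c, s, s + 1) + (\<theta> (c, s, s + 3) + \<theta> (c, s, 5)) +
        (\<theta> (c, s + 2, s + 1) + (\<theta> (c, s + 2, s + 3) + \<theta> (c, s + 2, 5)) +
        (\<theta> (c, 1, s + 1) + (\<theta> (c, 1, s + 3) + \<theta> (c, 1, 5)))) = 0" if "c < 3" for c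
      using new_iso[of 2 c] that dist by (simp add: A_def B_def add_ac)
    \<comment> \<open>The rows at new indices that the new tensors do not make 0; those of \<open>\<theta>\<^sub>2\<close> come in pairs
      that differ in sign only, and one of each pair is taken.\<close>
    define z where "z = (\<lambda>(e, m, j). \<theta> (m, if m = 0 then s + 2 + e else s + e, j))"
    have z: "z (e, 0, j) = \<theta> (0, s + 2 + e, j)" "z (e, 1, j) = \<theta> (1, s + e, j)" "z (e, 2, j) = \<theta> (2, s + e, j)" for e j
      by (simp_all add: z_def)
    have n2z: "\<theta> (2, s + 2 + e, j) = - \<theta> (2, s + e, j)" if "e < 2" "j < s" for e j
    proof -
      have "e = 0 \<or> e = 1" using that by auto
      then show ?thesis using n2[of j] W[of 2 1 j] W[of 2 5 j] that dist
        by (auto simp: eq_neg_iff_add_eq_0 add.commute numeral_3_eq_3)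
    qed
    have "\<forall>F\<in>gluing_conds s r. F (v, a, b) z = 0"
    proof -
      have tw: "v i 1 * (\<Sum>j<s. f j * z (e, 1, j)) + v i 2 * (\<Sum>j<s. f j * z (e, 2, j)) = 0 \<and>
          v i 0 * (\<Sum>j<s. f j * z (e, 0, j)) - v i 2 * (\<Sum>j<s. f j * z (e, 2, j)) = 0"
        if o: "\<And>k. k < s + 4 \<Longrightarrow> (\<Sum>c<3. v i c * (\<Sum>j<s. f j * \<theta> (c, j, k))) = 0" and e: "e < 2" for i e f
      proof -
        have e': "e = 0 \<or> e = 1" using e by auto
        have flip: "(\<Sum>j<s. f j * \<theta> (c, j, k)) = - (\<Sum>j<s. f j * \<theta> (c, k, j))" if "c < 3" "k < s + 4" for c k
          unfolding sum_negf[symmetric]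
        proof (rule sum.cong[OF refl])
          fix j assume "j \<in> {..<s}"
          then have "\<theta> (c, j, k) = - \<theta> (c, k, j)" by (intro sk) (use that in simp_all)
          then show "f j * \<theta> (c, j, k) = - (f j * \<theta> (c, k, j))" by (simp only: mult_minus_right)
        qed
        have "(\<Sum>j<s. f j * \<theta> (0, s + e, j)) = 0"
          by (rule sum.neutral) (use e' n0 in auto)
        moreover have "(\<Sum>j<s. f j * \<theta> (1, s + 2 + e, j)) = 0"
          by (rule sum.neutral) (use e' n0 in \<open>auto simp: numeral_3_eq_3 numeral_2_eq_2\<close>)
        moreover have "(\<Sum>j<s. f j * \<theta> (2, s + 2 + e, j)) = - (\<Sum>j<s. f j * \<theta> (2, s + e, j))"
          unfolding sum_negf[symmetric] by (rule sum.cong[OF refl]) (use n2z[OF e] in simp)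
        moreover have "s + e < s + 4" "s + 2 + e < s + 4" using e by auto
        ultimately show ?thesis
          using o[of "s + e"] o[of "s + 2 + e"] unfolding z sum_three
          by (simp add: flip add_eq_0_iff)
      qed
      have zz: "z (0, m, 5) = z (1, m, 1)" if m3: "m < 3" for m
      proof -
        have "m = 0 \<or> m = 1 \<or> m = 2" using m3 by auto
        then show ?thesis
        proof (elim disjE)
          assume 1: "m = 0"
          have "\<theta> (0, s + 2, 5) + \<theta> (0, 1, s + 3) = 0"
            using is2[of 0] n0 n0' is0 W[of 0 1 5] dist by simp
          then show ?thesis using sk[of 0 1 "s + 3"] dist unfolding 1 z by (simp add: numeral_3_eq_3)
        next
          assume 2: "m = 1"
          have "\<theta> (1, s, 5) + \<theta> (1, 1, s + 1) = 0"
            using is2[of 1] n0 n0' is0 W[of 1 1 5] dist by simp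
          then show ?thesis using sk[of 1 1 "s + 1"] dist unfolding 2 z by simp
        next
          assume 3: "m = 2"
          have "\<theta> (2, s + 2, s + 1) + \<theta> (2, 1, s + 1) = 0" using n2(1)[of "s + 1"] is0[of 2] by simp
          moreover have "\<theta> (2, s + 1, s + 2) + \<theta> (2, 5, s + 2) = 0"
            using n2(2)[of "s + 2"] is0[of 2] sk[of 2 "s + 3" "s + 2"] by simp
          moreover have "\<theta> (2, 5, s + 2) = \<theta> (2, s, 5)"
            using n2z[of 0 5] sk[of 2 5 "s + 2"] dist by simp
          moreover have "\<theta> (2, s + 2, s + 1) = - \<theta> (2, s + 1, s + 2)" "\<theta> (2, 1, s + 1) = - \<theta> (2, s + 1, 1)"
            using sk[of 2 "s + 2" "s + 1"] sk[of 2 1 "s + 1"] dist by auto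
          ultimately show ?thesis unfolding 3 z by (simp add: add_eq_0_iff)
        qed
      qed
      show ?thesis unfolding gluing_conds_iff using tw[OF old(1)] tw[OF old(2)] zz by simp
    qed
    then have zz: "\<forall>k\<in>{..<2} \<times> {..<3} \<times> {..<s}. z k = 0" using t unfolding gluable_def by blast
    have zero: "\<theta> (0, s + 2, j) = 0" "\<theta> (0, s + 3, j) = 0" "\<theta> (1, s, j) = 0" "\<theta> (1, s + 1, j) = 0"
      "\<theta> (2, s, j) = 0" "\<theta> (2, s + 1, j) = 0" "\<theta> (2, s + 2, j) = 0" "\<theta> (2, s + 3, j) = 0" if "j < s" for j
    proof -
      have *: "z (0, 0, j) = 0" "z (1, 0, j) = 0" "z (0, 1, j) = 0" "z (1, 1, j) = 0" "z (0, 2, j) = 0" "z (1, 2, j) = 0"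
        using zz that by auto
      note *[unfolded z]
      then show "\<theta> (0, s + 2, j) = 0" "\<theta> (0, s + 3, j) = 0" "\<theta> (1, s, j) = 0" "\<theta> (1, s + 1, j) = 0"
        "\<theta> (2, s, j) = 0" "\<theta> (2, s + 1, j) = 0" by (simp_all add: numeral_3_eq_3)
      then show "\<theta> (2, s + 2, j) = 0" "\<theta> (2, s + 3, j) = 0" using n2z[of 0 j] n2z[of 1 j] that
        by (simp_all add: numeral_3_eq_3)
    qed
    have CW: "\<theta> (c, k, j) = 0" if "c < 3" "s \<le> k" "k < s + 4" "j < s" for c j k
    proof -
      have "c = 0 \<or> c = 1 \<or> c = 2" "k = s \<or> k = s + 1 \<or> k = s + 2 \<or> k = s + 3" using that by auto
      then show ?thesis using zero[OF \<open>j < s\<close>] n0[of j] \<open>j < s\<close> by auto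
    qed
    have WC: "\<theta> (c, j, k) = 0" if "c < 3" "s \<le> k" "k < s + 4" "j < s" for c j k
      using CW[OF that] sk[of c j k] that by simp
    have CC2: "\<theta> (2, s, s + 2) = 0" "\<theta> (2, s, s + 3) = 0" "\<theta> (2, s + 1, s + 2) = 0" "\<theta> (2, s + 1, s + 3) = 0"
    proof -
      have d0: "\<theta> (2, k, k) = 0" if "k < s + 4" for k by (rule skew_zero, rule sk) (use that in simp_all)
      have w: "\<theta> (2, 1, k) = 0" "\<theta> (2, 5, k) = 0" if "s \<le> k" "k < s + 4" for k using WC[of 2 k] that dist by simp_all
      have "\<theta> (2, s + 1, s) = 0" using is0(1)[of 2] sk[of 2 "s + 1" s] by simp
      then have "\<theta> (2, s + 2, s) = 0" "\<theta> (2, s + 3, s) = 0"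
        using n2[of s] d0[of s] w[of s] by simp_all
      then show "\<theta> (2, s, s + 2) = 0" "\<theta> (2, s, s + 3) = 0"
        using sk[of 2 s "s + 2"] sk[of 2 s "s + 3"] by simp_all
      have "\<theta> (2, s + 2, s + 1) = 0" "\<theta> (2, s + 3, s + 1) = 0"
        using n2[of "s + 1"] d0[of "s + 1"] w[of "s + 1"] is0(1)[of 2] by simp_all
      then show "\<theta> (2, s + 1, s + 2) = 0" "\<theta> (2, s + 1, s + 3) = 0"
        using sk[of 2 "s + 1" "s + 2"] sk[of 2 "s + 1" "s + 3"] by simp_all
    qed
    have CCu: "\<theta> (c, j, k) = 0" if "c < 3" "s \<le> j" "j < k" "k < s + 4" for c j k
    proof -
      have "c = 0 \<or> c = 1 \<or> c = 2"
        "j = s \<and> k = s + 1 \<or> j = s \<and> k = s + 2 \<or> j = s \<and> k = s + 3 \<or> j = s + 1 \<and> k = s + 2 \<or>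
         j = s + 1 \<and> k = s + 3 \<or> j = s + 2 \<and> k = s + 3" using that by auto
      then show ?thesis using CC2 is0 n0[of k] n0'[of j] that by (elim disjE) auto
    qed
    have CC: "\<theta> (c, j, k) = 0" if "c < 3" "s \<le> j" "s \<le> k" "j < s + 4" "k < s + 4" for c j k
    proof (cases j k rule: linorder_cases)
      case less
      then show ?thesis using CCu that by blast
    next
      case equal
      have "\<theta> (c, j, j) = 0" by (rule skew_zero, rule sk) (use that in simp_all)
      then show ?thesis using equal by simp
    next
      case greater
      then show ?thesis using CCu[of c k j] sk[of c j k] that by simp
    qed
    obtain c j k where ck: "x = (c, j, k)" by (cases x)
    then have b: "c < 3" "j < s + 4" "k < s + 4" using x by auto
    show "\<theta> x = 0" unfolding ck
      using W[OF b(1)] WC[OF b(1)] CW[OF b(1)] CC[OF b(1)] b(2,3) by (cases "j < s"; cases "k < s") (simp_all add: not_less)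
  qed
  then show ?thesis ..
qed

theorem nondefective_exists: "l \<ge> 1 \<Longrightarrow> \<exists>p. nondefective (4 * l + 3) (3 * l + 2) p"
proof (induction l rule: nat_induct_at_least)
  case base
  show ?case using nondefective_base by (auto simp: numeral_eq_Suc)
next
  case (Suc l)
  then obtain p where "nondefective (4 * l + 3) (3 * l + 2) p" by blast
  moreover obtain q where "gluable (4 * l + 3) (3 * l + 2) q" using gluable_exists Suc by blast
  moreover have "6 \<le> 4 * l + 3" using Suc.hyps by simp
  ultimately obtain p' where "nondefective (4 * l + 3) (3 * l + 2) p' \<and> gluable (4 * l + 3) (3 * l + 2) p'"
    using nondefective_and_gluable by blast
  then obtain v a b where "nondefective (4 * l + 3) (3 * l + 2) (v, a, b)" "gluable (4 * l + 3) (3 * l + 2) (v, a, b)"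
    by (metis prod_cases3)
  from nondefective_step[OF this(2,1)] Suc show ?case by (simp add: algebra_simps)
qed

section \<open>Polynomials vanishing on tensors of bounded rank\<close>

lemma sum_tensor_basis:
  fixes f :: "nat \<times> nat list \<Rightarrow> complex"
  shows "(\<Sum>w\<in>tensor_basis s. f w) = (\<Sum>c<3. \<Sum>j<s. \<Sum>k<s. if j < k then f (c, [j, k]) else 0)"
proof -
  let ?T = "{(c :: nat, j, k). c < 3 \<and> j < k \<and> k < s}"
  have "(\<Sum>w\<in>tensor_basis s. f w) = (\<Sum>(c, j, k)\<in>?T. f (c, [j, k]))"
    by (rule sum.reindex_bij_witness[of _ "\<lambda>(c, j, k). (c, [j, k])" "\<lambda>(c, js). (c, js ! 0, js ! 1)"])
      (auto simp: tensor_basis_def)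
  also have "\<dots> = (\<Sum>(c, j, k)\<in>{..<3} \<times> {..<s} \<times> {..<s}. if j < k then f (c, [j, k]) else 0)"
    by (rule sum.mono_neutral_cong_left) (auto split: if_splits)
  also have "\<dots> = (\<Sum>c<3. \<Sum>j<s. \<Sum>k<s. if j < k then f (c, [j, k]) else 0)"
    by (simp add: sum.cartesian_product)
  finally show ?thesis .
qed

text \<open>The pairing with \<open>v \<otimes> (a \<and> b)\<close> as an unrestricted triple sum, linear in each of \<open>v\<close>, \<open>a\<close> and
  \<open>b\<close>.\<close>

lemma pairing_rank_one:
  fixes \<theta> :: "nat \<times> nat list \<Rightarrow> complex"
  shows "(\<Sum>w\<in>tensor_basis s. \<theta> w * rank_one v a b w) = (\<Sum>c<3. \<Sum>j<s. \<Sum>k<s. v c * (a j * (b k * skew_entry \<theta> c j k)))"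
proof -
  have inner: "(\<Sum>j<s. \<Sum>k<s. if j < k then \<theta> (c, [j, k]) * rank_one v a b (c, [j, k]) else 0) =
      (\<Sum>j<s. \<Sum>k<s. v c * (a j * (b k * skew_entry \<theta> c j k)))" for c
  proof -
    have "(\<Sum>j<s. \<Sum>k<s. if j < k then \<theta> (c, [j, k]) * rank_one v a b (c, [j, k]) else 0) =
        (\<Sum>j<s. \<Sum>k<s. if j < k then \<theta> (c, [j, k]) * (v c * (a j * b k)) else 0) -
        (\<Sum>j<s. \<Sum>k<s. if j < k then \<theta> (c, [j, k]) * (v c * (a k * b j)) else 0)"
      unfolding sum_subtractf[symmetric] by (intro sum.cong refl) (simp add: rank_one_def algebra_simps)
    also have "(\<Sum>j<s. \<Sum>k<s. if j < k then \<theta> (c, [j, k]) * (v c * (a k * b j)) else 0) =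
        (\<Sum>j<s. \<Sum>k<s. if k < j then \<theta> (c, [k, j]) * (v c * (a j * b k)) else 0)"
      by (rule sum.swap)
    finally show ?thesis
      unfolding sum_subtractf[symmetric]
      by (simp only:) (intro sum.cong refl, simp add: skew_entry_def algebra_simps)
  qed
  show ?thesis unfolding sum_tensor_basis by (intro sum.cong refl inner)
qed

lemma sum_unit_dir: "k < (n::nat) \<Longrightarrow> (\<Sum>j<n. unit_dir k j * f j) = f k"
  by (simp add: unit_dir_def if_distrib[of "\<lambda>x. x * _"] cong: if_cong)

text \<open>Each of the three families of tangent vectors arises by varying one of the factors \<open>v\<close>, \<open>a\<close>,
  \<open>b\<close>.\<close>

definition kills_tangents :: "nat \<Rightarrow> nat \<Rightarrow> config \<Rightarrow> (nat \<times> nat list \<Rightarrow> complex) \<Rightarrow> bool" where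
  "kills_tangents s r p \<theta> \<longleftrightarrow> (\<forall>i<r. \<forall>\<zeta>.
     (\<Sum>w\<in>tensor_basis s. \<theta> w * rank_one \<zeta> (fst (snd p) i) (snd (snd p) i) w) = 0 \<and>
     (\<Sum>w\<in>tensor_basis s. \<theta> w * rank_one (fst p i) \<zeta> (snd (snd p) i) w) = 0 \<and>
     (\<Sum>w\<in>tensor_basis s. \<theta> w * rank_one (fst p i) (fst (snd p) i) \<zeta> w) = 0)"

lemma nondefective_kills_tangents:
  assumes g: "nondefective s r p" and k: "kills_tangents s r p \<theta>" and pt: "\<theta> (2, [1, 3]) = 0"
    and w: "w \<in> tensor_basis s"
  shows "\<theta> w = 0"
proof -
  obtain v a b where p: "p = (v, a, b)" by (cases p)
  define \<theta>' where "\<theta>' = (\<lambda>(c, j, k). skew_entry \<theta> c j k)"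
  have skew: "skew_entry \<theta> c j k = - skew_entry \<theta> c k j" for c j k by (simp add: skew_entry_def)
  have "\<forall>F\<in>tangent_conds s r. F (v, a, b) \<theta>' = 0"
    unfolding tangent_conds_iff
  proof (intro conjI allI impI)
    show "\<theta>' (c, j, k) = - \<theta>' (c, k, j)" for c j k
      unfolding \<theta>'_def prod.case by (rule skew)
    show "(\<Sum>j<s. a i j * (\<Sum>k<s. b i k * \<theta>' (c, j, k))) = 0" if "i < r" "c < 3" for i c
    proof -
      have "(\<Sum>c'<3. \<Sum>j<s. \<Sum>k<s. unit_dir c c' * (a i j * (b i k * skew_entry \<theta> c' j k))) = 0"
        using k that unfolding kills_tangents_def p pairing_rank_one by simp
      then have "(\<Sum>c'<3. unit_dir c c' * (\<Sum>j<s. \<Sum>k<s. a i j * (b i k * skew_entry \<theta> c' j k))) = 0"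
        by (simp only: sum_distrib_left)
      then have "(\<Sum>j<s. \<Sum>k<s. a i j * (b i k * skew_entry \<theta> c j k)) = 0"
        by (simp only: sum_unit_dir[OF that(2)])
      then show ?thesis by (simp only: \<theta>'_def prod.case sum_distrib_left)
    qed
    show "(\<Sum>c<3. v i c * (\<Sum>j<s. a i j * \<theta>' (c, j, k))) = 0" if "i < r" "k < s" for i k
    proof -
      have "(\<Sum>c<3. \<Sum>j<s. \<Sum>k'<s. v i c * (a i j * (unit_dir k k' * skew_entry \<theta> c j k'))) = 0"
        using \<open>kills_tangents s r p \<theta>\<close> that unfolding kills_tangents_def p pairing_rank_one by simp
      then have "(\<Sum>c<3. v i c * (\<Sum>j<s. a i j * (\<Sum>k'<s. unit_dir k k' * skew_entry \<theta> c j k'))) = 0"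
        by (simp only: sum_distrib_left)
      then show ?thesis by (simp only: sum_unit_dir[OF that(2)] \<theta>'_def prod.case)
    qed
    show "(\<Sum>c<3. v i c * (\<Sum>j<s. b i j * \<theta>' (c, j, k))) = 0" if "i < r" "k < s" for i k
    proof -
      have "(\<Sum>c<3. \<Sum>j<s. \<Sum>k'<s. v i c * (unit_dir k j * (b i k' * skew_entry \<theta> c j k'))) = 0"
        using \<open>kills_tangents s r p \<theta>\<close> that unfolding kills_tangents_def p pairing_rank_one by simp
      then have "(\<Sum>c<3. v i c * (\<Sum>j<s. unit_dir k j * (\<Sum>k'<s. b i k' * skew_entry \<theta> c j k'))) = 0"
        by (simp only: sum_distrib_left)
      then have "(\<Sum>c<3. v i c * (\<Sum>k'<s. b i k' * skew_entry \<theta> c k k')) = 0"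
        by (simp only: sum_unit_dir[OF that(2)])
      moreover have "(\<Sum>j<s. b i j * skew_entry \<theta> c j k) = - (\<Sum>k'<s. b i k' * skew_entry \<theta> c k k')" for c
        unfolding sum_negf[symmetric] mult_minus_right[symmetric]
        by (intro sum.cong refl arg_cong2[where f = "(*)"] skew)
      ultimately show ?thesis
        by (simp only: \<theta>'_def prod.case mult_minus_right sum_negf) simp
    qed
    show "\<theta>' (2, 1, 3) = 0" using pt by (simp add: \<theta>'_def skew_entry_def)
  qed
  then have z: "\<forall>k\<in>{..<3} \<times> {..<s} \<times> {..<s}. \<theta>' k = 0" using g unfolding nondefective_def p by blast
  obtain c j k where w': "w = (c, [j, k])" "c < 3" "j < k" "k < s" using w by (auto simp: tensor_basis_def)
  then have "\<theta>' (c, j, k) = 0" using z by auto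
  then show ?thesis using w' by (simp add: \<theta>'_def skew_entry_def)
qed

text \<open>A direction on which the essentially unique functional \<open>\<theta>0\<close> that kills the tangent spaces
  does not vanish. It exists outside the zeros of \<open>D\<close> because a product of nonzero polynomials is
  nonzero.\<close>

lemma transversal_direction:
  fixes D :: "(nat \<times> nat list) cpoly"
  assumes g: "nondefective s r p" and s: "4 \<le> s" and D: "D \<noteq> 0"
  shows "\<exists>b. peval b D \<noteq> 0 \<and> (\<forall>\<theta>. kills_tangents s r p \<theta> \<longrightarrow> (\<Sum>w\<in>tensor_basis s. \<theta> w * b w) = 0 \<longrightarrow> (\<forall>w\<in>tensor_basis s. \<theta> w = 0))"
proof (cases "\<exists>\<theta>. kills_tangents s r p \<theta> \<and> \<theta> (2, [1, 3]) \<noteq> 0")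
  case False
  obtain b where "peval b D \<noteq> 0" using peval_nonzero[OF D] by blast
  then show ?thesis using False nondefective_kills_tangents[OF g] by blast
next
  case True
  then obtain \<theta>0 where \<theta>0: "kills_tangents s r p \<theta>0" "\<theta>0 (2, [1, 3]) \<noteq> 0" by blast
  define L where "L = (\<Sum>w\<in>tensor_basis s. Cst (\<theta>0 w) * pvar w)"
  have L: "peval x L = (\<Sum>w\<in>tensor_basis s. \<theta>0 w * x w)" for x by (simp add: L_def peval_simps)
  have pt: "(2, [1, 3]) \<in> tensor_basis s" using s by (auto simp: tensor_basis_def)
  have "peval (\<lambda>w. if w = (2, [1, 3]) then 1 else 0) L = \<theta>0 (2, [1, 3])"
  proof -
    have "(\<Sum>w\<in>tensor_basis s. \<theta>0 w * (if w = (2, [1, 3]) then 1 else 0)) =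
        (\<Sum>w\<in>tensor_basis s. if w = (2, [1, 3]) then \<theta>0 w else 0)"
      by (rule sum.cong) auto
    then show ?thesis unfolding L using pt sum.delta[OF finite_tensor_basis[of s], of "(2, [1, 3])" \<theta>0] by simp
  qed
  then have "L \<noteq> 0" using \<theta>0(2) by auto
  then have "L * D \<noteq> 0" using D by simp
  then obtain b where b: "peval b (L * D) \<noteq> 0" using peval_nonzero by blast
  show ?thesis
  proof (intro exI[of _ b] conjI allI impI ballI)
    show "peval b D \<noteq> 0" using b by (auto simp: peval_simps)
    fix \<theta> w assume \<theta>: "kills_tangents s r p \<theta>" "(\<Sum>w\<in>tensor_basis s. \<theta> w * b w) = 0" and w: "w \<in> tensor_basis s"
    define c where "c = \<theta> (2, [1, 3]) / \<theta>0 (2, [1, 3])"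
    define \<theta>1 where "\<theta>1 w = \<theta> w - c * \<theta>0 w" for w
    have lin: "(\<Sum>w\<in>tensor_basis s. \<theta>1 w * x w) = (\<Sum>w\<in>tensor_basis s. \<theta> w * x w) - c * (\<Sum>w\<in>tensor_basis s. \<theta>0 w * x w)" for x
      by (simp add: \<theta>1_def left_diff_distrib sum_subtractf sum_distrib_left mult.assoc)
    have "kills_tangents s r p \<theta>1" using \<theta>(1) \<theta>0(1) unfolding kills_tangents_def lin by simp
    moreover have "\<theta>1 (2, [1, 3]) = 0" using \<theta>0(2) by (simp add: \<theta>1_def c_def)
    ultimately have z: "\<theta>1 w = 0" if "w \<in> tensor_basis s" for w using nondefective_kills_tangents[OF g] that by blast
    have "(\<Sum>w\<in>tensor_basis s. \<theta>1 w * b w) = 0" by (rule sum.neutral) (simp add: z)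
    then have "c * peval b L = 0" unfolding lin L using \<theta>(2) by simp
    then have "c = 0" using b by (auto simp: peval_simps)
    then show "\<theta> w = 0" using z[OF w] by (simp add: \<theta>1_def)
  qed
qed

lemma poly_rank_one:
  "poly (rank_one F G K w) u = rank_one (\<lambda>j. poly (F j) u) (\<lambda>j. poly (G j) u) (\<lambda>j. poly (K j) u) w"
  by (simp add: rank_one_def split: prod.split)

lemma rank_one_add:
  "rank_one (\<lambda>c. v c + e * z c) a b w = rank_one v a b w + e * rank_one z a b w"
  "rank_one v (\<lambda>c. a c + e * z c) b w = rank_one v a b w + e * rank_one v z b w"
  "rank_one v a (\<lambda>c. b c + e * z c) w = rank_one v a b w + e * rank_one v a z w"
  by (simp_all add: rank_one_def algebra_simps split: prod.split)

text \<open>Any sum of \<open>r\<close> terms is joined to the sum of the terms of the configuration \<open>p\<close> by moving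
  the factors linearly; the tangent vectors along this curve arise by replacing one factor by a
  constant one.\<close>

lemma rank_le_dominance:
  assumes ann: "\<forall>\<theta>. kills_tangents s r p \<theta> \<longrightarrow> (\<Sum>w\<in>tensor_basis s. \<theta> w * d w) = 0 \<longrightarrow> (\<forall>w\<in>tensor_basis s. \<theta> w = 0)"
    and h: "\<And>x t. (\<lambda>w. x w + t * d w) \<in> rank_le r s \<Longrightarrow> peval x h = 0"
  shows "h = 0"
proof (rule dominance[OF finite_tensor_basis _ _ _ h])
  obtain v0 a0 b0 where p: "p = (v0, a0, b0)" by (cases p)
  show "rank_le r s \<noteq> {}" unfolding rank_le_def by (auto intro!: exI[of _ "\<lambda>w. \<Sum>i<r. rank_one (v0 i) (a0 i) (b0 i) w"])
  show "y \<in> rank_le r s" if "x \<in> rank_le r s" "\<And>v. v \<in> tensor_basis s \<Longrightarrow> x v = y v" for x y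
    using that unfolding rank_le_def by auto
  fix y assume "y \<in> rank_le r s"
  then obtain v1 a1 b1 where y: "\<And>w. w \<in> tensor_basis s \<Longrightarrow> y w = (\<Sum>i<r. rank_one (v1 i) (a1 i) (b1 i) w)"
    by (auto simp: rank_le_def)
  define ln where "ln c e = [:c, e - c:]" for c e :: complex
  define V where "V i j = ln (v0 i j) (v1 i j)" for i j
  define A where "A i j = ln (a0 i j) (a1 i j)" for i j
  define K where "K i j = ln (b0 i j) (b1 i j)" for i j
  define q where "q w = (if w \<in> tensor_basis s then \<Sum>i<r. rank_one (V i) (A i) (K i) w else [:y w:])" for w
  define cs where "cs \<zeta> j = [:\<zeta> j:]" for \<zeta> :: "nat \<Rightarrow> complex" and j
  define TT where "TT = {rank_one (cs \<zeta>) (A i) (K i) | i \<zeta>. i < r} \<union> {rank_one (V i) (cs \<zeta>) (K i) | i \<zeta>. i < r} \<union>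
    {rank_one (V i) (A i) (cs \<zeta>) | i \<zeta>. i < r}"
  have ln: "poly (ln c e) 0 = c" "poly (ln c e) 1 = e" for c e by (simp_all add: ln_def)
  have q1: "poly (q w) 1 = y w" for w
    by (simp add: q_def poly_sum poly_rank_one V_def A_def K_def ln y)
  have mem: "(\<lambda>w. poly (q w) u + \<epsilon> * z w) \<in> rank_le r s"
    if "\<And>w. w \<in> tensor_basis s \<Longrightarrow> (\<Sum>i<r. rank_one (\<lambda>j. poly (V i j) u) (\<lambda>j. poly (A i j) u) (\<lambda>j. poly (K i j) u) w) + \<epsilon> * z w =
        (\<Sum>i<r. rank_one (v i) (a i) (b i) w)" for u \<epsilon> z v a b
    unfolding rank_le_def using that
    by (intro CollectI exI[of _ v] exI[of _ a] exI[of _ b]) (simp add: q_def poly_sum poly_rank_one)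
  have upd: "(\<Sum>i<r. F i) + z = (\<Sum>i<r. if i = i0 then F i + z else F i)" if "i0 < r" for F :: "nat \<Rightarrow> complex" and z i0
  proof -
    have "(\<Sum>i<r. if i = i0 then F i + z else F i) = (\<Sum>i<r. F i + (if i = i0 then z else 0))"
      by (rule sum.cong) auto
    then show ?thesis using that by (simp add: sum.distrib)
  qed
  have tan: "(\<lambda>w. poly (q w) u + \<epsilon> * poly (\<tau> w) u) \<in> rank_le r s" if "\<tau> \<in> TT" for \<tau> u \<epsilon>
  proof -
    let ?v = "\<lambda>i j. poly (V i j) u" and ?a = "\<lambda>i j. poly (A i j) u" and ?b = "\<lambda>i j. poly (K i j) u"
    consider i \<zeta> where "i < r" "\<tau> = rank_one (cs \<zeta>) (A i) (K i)" | i \<zeta> where "i < r" "\<tau> = rank_one (V i) (cs \<zeta>) (K i)"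
      | i \<zeta> where "i < r" "\<tau> = rank_one (V i) (A i) (cs \<zeta>)" using \<open>\<tau> \<in> TT\<close> unfolding TT_def by blast
    then show ?thesis
    proof cases
      case 1
      show ?thesis
        by (rule mem[where v = "\<lambda>i' j. if i' = i then ?v i j + \<epsilon> * \<zeta> j else ?v i' j" and a = ?a and b = ?b])
          (simp add: 1 poly_rank_one cs_def upd[OF 1(1)] if_distrib, intro sum.cong refl, simp add: rank_one_add)
    next
      case 2
      show ?thesis
        by (rule mem[where a = "\<lambda>i' j. if i' = i then ?a i j + \<epsilon> * \<zeta> j else ?a i' j" and v = ?v and b = ?b])
          (simp add: 2 poly_rank_one cs_def upd[OF 2(1)] if_distrib, intro sum.cong refl, simp add: rank_one_add)
    next
      case 3
      show ?thesis
        by (rule mem[where b = "\<lambda>i' j. if i' = i then ?b i j + \<epsilon> * \<zeta> j else ?b i' j" and v = ?v and a = ?a])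
          (simp add: 3 poly_rank_one cs_def upd[OF 3(1)] if_distrib, intro sum.cong refl, simp add: rank_one_add)
    qed
  qed
  have q3: "(\<lambda>w. poly (q w) u) \<in> rank_le r s" for u
  proof -
    have "(\<lambda>w. poly (q w) u + 0 * (\<lambda>_. 0) w) \<in> rank_le r s"
      by (rule mem[where v = "\<lambda>i j. poly (V i j) u" and a = "\<lambda>i j. poly (A i j) u" and b = "\<lambda>i j. poly (K i j) u"]) simp
    then show ?thesis by simp
  qed
  have an: "\<forall>w\<in>tensor_basis s. \<theta> w = 0"
    if k: "\<forall>\<tau>\<in>TT. (\<Sum>w\<in>tensor_basis s. \<theta> w * poly (\<tau> w) 0) = 0" and "(\<Sum>w\<in>tensor_basis s. \<theta> w * d w) = 0" for \<theta>
  proof -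
    have "kills_tangents s r p \<theta>"
      unfolding kills_tangents_def
    proof (intro allI impI conjI)
      fix i \<zeta> assume i: "i < r"
      have "rank_one (cs \<zeta>) (A i) (K i) \<in> TT" "rank_one (V i) (cs \<zeta>) (K i) \<in> TT" "rank_one (V i) (A i) (cs \<zeta>) \<in> TT"
        using i unfolding TT_def by blast+
      from this[THEN k[rule_format]]
      show "(\<Sum>w\<in>tensor_basis s. \<theta> w * rank_one \<zeta> (fst (snd p) i) (snd (snd p) i) w) = 0"
        "(\<Sum>w\<in>tensor_basis s. \<theta> w * rank_one (fst p i) \<zeta> (snd (snd p) i) w) = 0"
        "(\<Sum>w\<in>tensor_basis s. \<theta> w * rank_one (fst p i) (fst (snd p) i) \<zeta> w) = 0"
        by (simp_all add: poly_rank_one p cs_def V_def A_def K_def ln)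
    qed
    then show ?thesis using ann that(2) by blast
  qed
  show "\<exists>q TT. (\<forall>w. poly (q w) 1 = y w) \<and>
      (\<forall>\<tau>\<in>TT. \<forall>u \<epsilon>. (\<lambda>w. poly (q w) u + \<epsilon> * poly (\<tau> w) u) \<in> rank_le r s) \<and>
      (\<forall>u. (\<lambda>w. poly (q w) u) \<in> rank_le r s) \<and>
      (\<forall>\<theta>. (\<forall>\<tau>\<in>TT. (\<Sum>w\<in>tensor_basis s. \<theta> w * poly (\<tau> w) 0) = 0) \<and> (\<Sum>w\<in>tensor_basis s. \<theta> w * d w) = 0 \<longrightarrow>
        (\<forall>w\<in>tensor_basis s. \<theta> w = 0))"
    by (rule exI[of _ q], rule exI[of _ TT], intro conjI allI ballI impI)
      (use q1 tan q3 an in blast)+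
qed

text \<open>The transversal direction at a nondefective configuration serves as the direction \<open>b\<close> of
  \<open>dvd_of_vanishing\<close>.\<close>

theorem flat_det_dvd:
  fixes f :: "(nat \<times> nat list) cpoly"
  assumes l: "l \<ge> 1" and s: "s = 4 * l + 3" and r: "r = 3 * l + 2"
    and f: "\<And>x. x \<in> rank_le r s \<Longrightarrow> peval x f = 0"
  shows "flat_det s pvar dvd f"
proof -
  obtain p where p: "nondefective s r p" using nondefective_exists[OF l] s r by blast
  have "flat_det s (sparse_tensor s False (\<lambda>j. j)) \<noteq> 0" by (rule flat_det_sparse_tensor[OF _ _ s]) auto
  then have D0: "flat_det s pvar \<noteq> (0 :: (nat \<times> nat list) cpoly)" using peval_flat_det[of _ s] by (metis peval.hom_zero)
  have "4 \<le> s" using l s by simp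
  from transversal_direction[OF p this D0] obtain d where d: "peval d (flat_det s pvar) \<noteq> 0"
    "\<forall>\<theta>. kills_tangents s r p \<theta> \<longrightarrow> (\<Sum>w\<in>tensor_basis s. \<theta> w * d w) = 0 \<longrightarrow> (\<forall>w\<in>tensor_basis s. \<theta> w = 0)" by (elim exE conjE)
  show ?thesis
  proof (rule dvd_of_vanishing[where S = "rank_le r s" and b = d and n = "3 * s"])
    show "mdeg m = 3 * s" if "m \<in> keys (flat_det s pvar :: (nat \<times> nat list) cpoly)" for m
      using flat_det_homogeneous[of s] that by (simp add: homogeneous_of_degree_mdeg)
    show "peval d (flat_det s pvar) \<noteq> 0" by (rule d)
    show "\<exists>p. (\<forall>v. poly (p v) 0 = x v) \<and> (\<forall>v. poly (p v) 1 = y v) \<and> (\<forall>u. (\<lambda>v. poly (p v) u) \<in> rank_le r s)"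
      if "x \<in> rank_le r s" "y \<in> rank_le r s" for x y using that by (rule rank_le_connected)
    show "peval x (flat_det s pvar) = 0" if "x \<in> rank_le r s" for x
      unfolding peval_flat_det by (rule flat_det_rank_le[OF that]) (use r s in simp)
    show "h = 0" if "\<And>x t. (\<lambda>v. x v + t * d v) \<in> rank_le r s \<Longrightarrow> peval x h = 0" for h
      by (rule rank_le_dominance[OF d(2) that])
    show "(\<exists>c. P = Cst c) \<or> (\<exists>c. Q = Cst c)" if "flat_det s pvar = P * Q" for P Q
      by (rule flat_det_irreducible[OF l s that])
  qed (rule f)
qed

section \<open>Points of rank exactly r\<close>

text \<open>If \<open>f\<close> is nonzero at \<open>x\<close> and \<open>g\<close> at \<open>y\<close>, then both restrict to nonzero univariate
  polynomials on a polynomial curve from \<open>x\<close> to \<open>y\<close>, and so does their product.\<close>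

lemma rank_le_prime:
  assumes fg: "\<And>x. x \<in> rank_le r s \<Longrightarrow> peval x (f * g) = 0"
  shows "(\<forall>x\<in>rank_le r s. peval x f = 0) \<or> (\<forall>x\<in>rank_le r s. peval x g = 0)"
proof (rule ccontr)
  assume "\<not> ?thesis"
  then obtain x y where x: "x \<in> rank_le r s" "peval x f \<noteq> 0" and y: "y \<in> rank_le r s" "peval y g \<noteq> 0" by blast
  obtain p where p: "\<And>v. poly (p v) 0 = x v" "\<And>v. poly (p v) 1 = y v" "\<And>u. (\<lambda>v. poly (p v) u) \<in> rank_le r s"
    using rank_le_connected[OF x(1) y(1)] by blast
  define \<phi> where "\<phi> = psubst (\<lambda>a. [:a:]) p"
  have ev: "poly (\<phi> h) u = peval (\<lambda>v. poly (p v) u) h" for h u unfolding \<phi>_def by (rule poly_psubst)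
  have "poly (\<phi> f * \<phi> g) u = 0" for u
    using fg[OF p(3)[of u]] by (simp add: ev peval_simps)
  then have "\<phi> f * \<phi> g = 0" using poly_all_0_iff_0 by blast
  moreover have "poly (\<phi> f) 0 \<noteq> 0" using x by (simp add: ev p)
  moreover have "poly (\<phi> g) 1 \<noteq> 0" using y by (simp add: ev p)
  ultimately show False by auto
qed

lemma rank_le_cong: "x \<in> rank_le k s \<Longrightarrow> (\<And>w. w \<in> tensor_basis s \<Longrightarrow> x w = y w) \<Longrightarrow> y \<in> rank_le k s"
  unfolding rank_le_def by auto

lemma rank_le_add:
  assumes "x \<in> rank_le k s" "y \<in> rank_le m s"
  shows "(\<lambda>w. x w + y w) \<in> rank_le (k + m) s"
proof -
  obtain v a b where x: "\<And>w. w \<in> tensor_basis s \<Longrightarrow> x w = (\<Sum>i<k. rank_one (v i) (a i) (b i) w)"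
    using assms(1) by (auto simp: rank_le_def)
  obtain v' a' b' where y: "\<And>w. w \<in> tensor_basis s \<Longrightarrow> y w = (\<Sum>i<m. rank_one (v' i) (a' i) (b' i) w)"
    using assms(2) by (auto simp: rank_le_def)
  define cat where "cat f g i = (if i < k then f i else g (i - k))" for f g :: "nat \<Rightarrow> nat \<Rightarrow> complex" and i
  have "(\<Sum>i<k + m. rank_one (cat v v' i) (cat a a' i) (cat b b' i) w) = x w + y w" if "w \<in> tensor_basis s" for w
  proof -
    have "(\<Sum>i<k + m. rank_one (cat v v' i) (cat a a' i) (cat b b' i) w) =
        (\<Sum>i<k. rank_one (cat v v' i) (cat a a' i) (cat b b' i) w) +
        (\<Sum>i<m. rank_one (cat v v' (k + i)) (cat a a' (k + i)) (cat b b' (k + i)) w)"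
      by (induction m) (simp_all add: add.assoc)
    also have "\<dots> = x w + y w" using that by (simp add: x y cat_def)
    finally show ?thesis .
  qed
  then show ?thesis unfolding rank_le_def
    by (intro CollectI exI[of _ "cat v v'"] exI[of _ "cat a a'"] exI[of _ "cat b b'"]) simp
qed

lemma zero_in_rank_le: "(\<lambda>_. 0) \<in> rank_le k s"
  unfolding rank_le_def rank_one_def by (intro CollectI exI[of _ "\<lambda>_ _. 0"]) auto

lemma rank_le_mono: "x \<in> rank_le k s \<Longrightarrow> k \<le> m \<Longrightarrow> x \<in> rank_le m s"
  using rank_le_add[OF _ zero_in_rank_le, of x k s "m - k"] by simp

lemma rank_one_in_rank_le: "rank_one v a b \<in> rank_le 1 s"
  unfolding rank_le_def by (intro CollectI exI[of _ "\<lambda>_. v"] exI[of _ "\<lambda>_. a"] exI[of _ "\<lambda>_. b"]) simp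

lemma rank_le_scale:
  assumes "x \<in> rank_le k s"
  shows "(\<lambda>w. c * x w) \<in> rank_le k s"
proof -
  obtain v a b where x: "\<And>w. w \<in> tensor_basis s \<Longrightarrow> x w = (\<Sum>i<k. rank_one (v i) (a i) (b i) w)"
    using assms by (auto simp: rank_le_def)
  have "c * rank_one v a b w = rank_one (\<lambda>i. c * v i) a b w" for v a b w
    by (simp add: rank_one_def mult.assoc split: prod.split)
  then show ?thesis unfolding rank_le_def
    by (intro CollectI exI[of _ "\<lambda>i j. c * v i j"] exI[of _ a] exI[of _ b]) (simp add: x sum_distrib_left)
qed

text \<open>Every tensor is the sum of its coordinates times basis vectors.\<close>

lemma rank_le_card_basis: "x \<in> rank_le (card (tensor_basis s)) s"
proof -
  have "(\<lambda>w. if w \<in> A then x w else 0) \<in> rank_le (card A) s" if "finite A" "A \<subseteq> tensor_basis s" for A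
    using that
  proof (induction A)
    case empty
    then show ?case using zero_in_rank_le by simp
  next
    case (insert w A)
    then obtain c j k where w: "w = (c, [j, k])" "j < k" by (auto simp: tensor_basis_def)
    let ?d = "rank_one (\<lambda>i. x w * unit_dir c i) (unit_dir j) (unit_dir k)"
    have d: "?d w' = (if w' = w then x w else 0)" if "w' \<in> tensor_basis s" for w'
      using that w by (auto simp: tensor_basis_def rank_one_def unit_dir_def split: if_splits)
    have "(\<lambda>w'. (if w' \<in> A then x w' else 0) + ?d w') \<in> rank_le (card A + 1) s"
      using insert by (intro rank_le_add rank_one_in_rank_le) auto
    then have "(\<lambda>w'. if w' \<in> insert w A then x w' else 0) \<in> rank_le (card A + 1) s"
      by (rule rank_le_cong) (use d insert.hyps in auto)
    then show ?case using insert.hyps by simp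
  qed
  from this[OF finite_tensor_basis order_refl] show ?thesis by (rule rank_le_cong) simp
qed

definition restrict_coords :: "nat \<Rightarrow> (nat \<times> nat list \<Rightarrow> complex) \<Rightarrow> nat \<times> nat list \<Rightarrow> complex" where
  "restrict_coords s x w = (if w \<in> tensor_basis s then x w else 0)"

lemma det_2_mat: "det (mat 2 2 f) = f (0, 0) * f (1, 1) - f (0, 1) * f (1, 0)"
  for f :: "nat \<times> nat \<Rightarrow> complex"
proof -
  have "det (mat 2 2 f) = (\<Sum>j<2. mat 2 2 f $$ (0, j) * cofactor (mat 2 2 f) 0 j)"
    by (rule laplace_expansion_row) auto
  also have "\<dots> = f (0, 0) * cofactor (mat 2 2 f) 0 0 + f (0, 1) * cofactor (mat 2 2 f) 0 1"
    by (simp add: eval_nat_numeral)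
  also have "cofactor (mat 2 2 f) 0 0 = f (1, 1)"
    by (simp add: cofactor_def mat_delete_def det_single)
  also have "cofactor (mat 2 2 f) 0 1 = - f (1, 0)"
    by (simp add: cofactor_def mat_delete_def det_single)
  finally show ?thesis by simp
qed

lemma tensor_wedge_eq:
  "tensor_wedge 2 1 n v [a, b] = restrict_coords (Suc n) (rank_one (\<lambda>i. v $ i) (\<lambda>j. a $ j) (\<lambda>j. b $ j))"
proof
  fix w :: "nat \<times> nat list"
  obtain i js where w: "w = (i, js)" by (cases w)
  show "tensor_wedge 2 1 n v [a, b] w = restrict_coords (Suc n) (rank_one (\<lambda>i. v $ i) (\<lambda>j. a $ j) (\<lambda>j. b $ j)) w"
    by (simp add: w tensor_wedge_def restrict_coords_def segre_grassmann_basis_eq[unfolded One_nat_def] rank_one_def det_2_mat[unfolded One_nat_def] numeral_2_eq_2[symmetric])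
qed

lemma proj_point_self: "x \<in> proj_point x"
  unfolding proj_point_def by (rule CollectI, rule exI[of _ 1]) simp

lemma segre_pointD:
  assumes "proj_point x \<in> segre_grassmann 2 1 n"
  shows "x \<in> rank_le 1 (Suc n)"
proof -
  obtain v ws where vw: "proj_point x = proj_point (tensor_wedge 2 1 n v ws)" "length ws = 2"
    using assms unfolding segre_grassmann_def by auto
  then obtain a b where ws: "ws = [a, b]" by (cases ws; cases "tl ws") auto
  have "x \<in> proj_point (tensor_wedge 2 1 n v ws)" using proj_point_self[of x] vw(1) by simp
  then obtain c where c: "x = (\<lambda>w. c * restrict_coords (Suc n) (rank_one (\<lambda>i. v $ i) (\<lambda>j. a $ j) (\<lambda>j. b $ j)) w)"
    unfolding proj_point_def ws tensor_wedge_eq by auto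
  show "x \<in> rank_le 1 (Suc n)"
    by (rule rank_le_cong[OF rank_le_scale[OF rank_one_in_rank_le[of "\<lambda>i. v $ i" "\<lambda>j. a $ j" "\<lambda>j. b $ j"], of c]])
      (simp add: c restrict_coords_def)
qed

text \<open>A scalar multiple of a point of the cone is absorbed into its factor in \<open>V\<close>, so
  representatives do not matter.\<close>

lemma is_sum_of_rank_le:
  assumes "is_sum_of (segre_grassmann 2 1 n) k x"
  shows "x \<in> rank_le k (Suc n)"
proof -
  obtain y where y: "\<And>i. i < k \<Longrightarrow> proj_point (y i) \<in> segre_grassmann 2 1 n" "x = (\<lambda>v. \<Sum>i<k. y i v)"
    using assms unfolding is_sum_of_def by blast
  have "(\<lambda>v. \<Sum>i<m. y i v) \<in> rank_le m (Suc n)" if "m \<le> k" for m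
    using that
  proof (induction m)
    case 0
    then show ?case using zero_in_rank_le by simp
  next
    case (Suc m)
    then have "(\<lambda>v. (\<Sum>i<m. y i v) + y m v) \<in> rank_le (m + 1) (Suc n)"
      using segre_pointD[OF y(1)] by (intro rank_le_add) auto
    then show ?case by simp
  qed
  then show ?thesis using y(2) by simp
qed

lemma lin_indep_pair:
  fixes a b :: "nat \<Rightarrow> complex"
  assumes jk: "j < d" "k < d" "a j * b k - a k * b j \<noteq> 0"
  shows "lin_indep_family d [vec d a, vec d b]"
proof -
  interpret vec_space "TYPE(complex)" d .
  have ne: "vec d a \<noteq> vec d b"
  proof
    assume eq: "vec d a = vec d b"
    have "a i = b i" if "i < d" for i using arg_cong[OF eq, of "\<lambda>v. vec_index v i"] that by simp
    then show False using jk by (simp add: mult.commute)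
  qed
  have "\<not> lin_dep {vec d a, vec d b}"
  proof
    assume ld: "lin_dep {vec d a, vec d b}"
    have car: "{vec d a, vec d b} \<subseteq> carrier_vec d" by auto
    obtain f v where f: "lincomb f {vec d a, vec d b} = 0\<^sub>v d" "v \<in> {vec d a, vec d b}" "f v \<noteq> 0"
      using finite_lin_dep[OF _ ld] car by auto
    have lc: "f (vec d a) * a i + f (vec d b) * b i = 0" if "i < d" for i
    proof -
      have "lincomb f {vec d a, vec d b} $ i = (\<Sum>x\<in>{vec d a, vec d b}. f x * x $ i)"
        by (rule lincomb_index[OF that car])
      then show ?thesis using f(1) ne that by simp
    qed
    define \<alpha> where "\<alpha> = f (vec d a)"
    define \<beta> where "\<beta> = f (vec d b)"
    have e: "\<alpha> * a j + \<beta> * b j = 0" "\<alpha> * a k + \<beta> * b k = 0"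
      using lc[OF jk(1)] lc[OF jk(2)] by (simp_all add: \<alpha>_def \<beta>_def)
    have "\<alpha> * (a j * b k - a k * b j) = (\<alpha> * a j + \<beta> * b j) * b k - (\<alpha> * a k + \<beta> * b k) * b j"
      by (simp add: algebra_simps)
    then have "\<alpha> = 0" using e jk(3) by simp
    have "\<beta> * (a j * b k - a k * b j) = (\<alpha> * a k + \<beta> * b k) * a j - (\<alpha> * a j + \<beta> * b j) * a k"
      by (simp add: algebra_simps)
    then have "\<beta> = 0" using e jk(3) by simp
    with \<open>\<alpha> = 0\<close> f(2,3) show False by (auto simp: \<alpha>_def \<beta>_def)
  qed
  then show ?thesis using ne by (simp add: lin_indep_family_def)
qed

lemma segre_pointI:
  assumes ne: "restrict_coords (Suc n) (rank_one v a b) \<noteq> (\<lambda>_. 0)"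
  shows "proj_point (restrict_coords (Suc n) (rank_one v a b)) \<in> segre_grassmann 2 1 n"
proof -
  obtain w where w: "restrict_coords (Suc n) (rank_one v a b) w \<noteq> 0" using ne by (meson ext)
  then obtain c j k where cjk: "w = (c, [j, k])" "c < 3" "j < k" "k < Suc n"
    by (auto simp: restrict_coords_def tensor_basis_def split: if_splits)
  then have nz: "v c \<noteq> 0" "a j * b k - a k * b j \<noteq> 0"
    using w by (auto simp: restrict_coords_def rank_one_def split: if_splits)
  have eq: "tensor_wedge 2 1 n (vec 3 v) [vec (Suc n) a, vec (Suc n) b] = restrict_coords (Suc n) (rank_one v a b)"
    unfolding tensor_wedge_eq by (rule ext) (auto simp: restrict_coords_def tensor_basis_def rank_one_def)
  have "vec 3 v \<noteq> 0\<^sub>v (2 + 1)"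
  proof
    assume "vec 3 v = 0\<^sub>v (2 + 1)"
    then have "vec 3 v $ c = 0\<^sub>v (2 + 1) $ c" by simp
    then show False using cjk nz by simp
  qed
  moreover have "lin_indep_family (n + 1) [vec (Suc n) a, vec (Suc n) b]"
    using lin_indep_pair[of j "Suc n" k a b] cjk nz by simp
  ultimately show ?thesis unfolding segre_grassmann_def
    by (intro CollectI exI[of _ "vec 3 v"] exI[of _ "[vec (Suc n) a, vec (Suc n) b]"]) (simp add: eq[unfolded One_nat_def])
qed

text \<open>Zero terms do not represent points of projective space, and leaving them out may decrease
  the number of summands.\<close>

lemma rank_le_is_sum_of:
  assumes "x \<in> rank_le k (Suc n)"
  shows "\<exists>m\<le>k. is_sum_of (segre_grassmann 2 1 n) m (restrict_coords (Suc n) x)"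
proof -
  let ?X = "segre_grassmann 2 1 n"
  obtain v a b where x: "\<And>w. w \<in> tensor_basis (Suc n) \<Longrightarrow> x w = (\<Sum>i<k. rank_one (v i) (a i) (b i) w)"
    using assms by (auto simp: rank_le_def)
  have sums: "\<exists>m\<le>k'. is_sum_of ?X m (\<lambda>w. \<Sum>i<k'. restrict_coords (Suc n) (rank_one (v i) (a i) (b i)) w)" for k'
  proof (induction k')
    case 0
    then show ?case by (simp add: is_sum_of_def)
  next
    case (Suc k')
    then obtain m where m: "m \<le> k'" "is_sum_of ?X m (\<lambda>w. \<Sum>i<k'. restrict_coords (Suc n) (rank_one (v i) (a i) (b i)) w)" by blast
    let ?T = "restrict_coords (Suc n) (rank_one (v k') (a k') (b k'))"
    show ?case
    proof (cases "?T = (\<lambda>_. 0)")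
      case True
      then have "?T w = 0" for w by (rule fun_cong)
      then show ?thesis using m by (intro exI[of _ m]) simp
    next
      case False
      obtain y where y: "\<And>i. i < m \<Longrightarrow> proj_point (y i) \<in> ?X"
        "(\<lambda>w. \<Sum>i<k'. restrict_coords (Suc n) (rank_one (v i) (a i) (b i)) w) = (\<lambda>w. \<Sum>i<m. y i w)"
        using m(2) unfolding is_sum_of_def by blast
      have y2: "(\<Sum>i<k'. restrict_coords (Suc n) (rank_one (v i) (a i) (b i)) w) = (\<Sum>i<m. y i w)" for w
        using y(2) by (rule fun_cong)
      have "is_sum_of ?X (Suc m) (\<lambda>w. \<Sum>i<Suc k'. restrict_coords (Suc n) (rank_one (v i) (a i) (b i)) w)"
        unfolding is_sum_of_def
        by (rule exI[of _ "y(m := ?T)"]) (use y(1) segre_pointI[OF False] y2 in \<open>auto simp: less_Suc_eq\<close>)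
      then show ?thesis using m(1) by (intro exI[of _ "Suc m"]) simp
    qed
  qed
  have "restrict_coords (Suc n) x = (\<lambda>w. \<Sum>i<k. restrict_coords (Suc n) (rank_one (v i) (a i) (b i)) w)"
    by (rule ext) (simp add: restrict_coords_def x)
  then show ?thesis using sums[of k] by (simp only:)
qed

lemma restrict_coords_in_coord_space: "restrict_coords s x \<in> coord_space (tensor_basis s)"
  by (simp add: restrict_coords_def coord_space_def)

text \<open>For the least \<open>m\<close> such that some sum of \<open>m\<close> terms has nonzero determinant, write such a sum
  as \<open>x0 + y\<close> with \<open>y\<close> the last \<open>m - r\<close> terms. The polynomial \<open>M x = D (x + y)\<close> vanishes at all
  sums of fewer than \<open>r\<close> terms by the choice of \<open>m\<close>, and not at \<open>x0\<close>. So \<open>f M\<close> vanishes at all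
  sums of \<open>r\<close> terms, and by primality \<open>f\<close> does.\<close>

lemma vanishes_on_rank_le:
  fixes f :: "(nat \<times> nat list) cpoly"
  assumes l: "l \<ge> 1" and n: "n = 4 * l + 2" and r: "r = 3 * l + 2"
    and f: "in_vars (tensor_basis (Suc n)) f"
    and van: "\<And>x. x \<in> coord_space (tensor_basis (Suc n)) - {\<lambda>_. 0} \<Longrightarrow> has_rank (segre_grassmann 2 1 n) r x \<Longrightarrow> peval x f = 0"
    and x: "x \<in> rank_le r (Suc n)"
  shows "peval x f = 0"
proof -
  let ?s = "Suc n" and ?X = "segre_grassmann 2 1 n"
  have s: "?s = 4 * l + 3" using n by simp
  have "flat_det ?s (sparse_tensor ?s False (\<lambda>j. j)) \<noteq> 0" by (rule flat_det_sparse_tensor[OF _ _ s]) auto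
  then have "\<exists>k. \<exists>x\<in>rank_le k ?s. flat_det ?s x \<noteq> 0" using rank_le_card_basis by blast
  define m where "m = (LEAST k. \<exists>x\<in>rank_le k ?s. flat_det ?s x \<noteq> 0)"
  have m: "\<exists>x\<in>rank_le m ?s. flat_det ?s x \<noteq> 0" unfolding m_def by (rule LeastI_ex) fact
  have min: "flat_det ?s x = 0" if "x \<in> rank_le k ?s" "k < m" for x k
    using that not_less_Least[of k "\<lambda>k. \<exists>x\<in>rank_le k ?s. flat_det ?s x \<noteq> 0"] unfolding m_def by blast
  have rm: "r < m"
  proof (rule ccontr)
    assume "\<not> r < m"
    obtain x where x: "x \<in> rank_le m ?s" "flat_det ?s x \<noteq> 0" using m by blast
    have "x \<in> rank_le r ?s" by (rule rank_le_mono[OF x(1)]) (use \<open>\<not> r < m\<close> in simp)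
    then have "flat_det ?s x = 0" by (rule flat_det_rank_le) (use n r in simp)
    with x show False by simp
  qed
  obtain x1 where x1: "x1 \<in> rank_le m ?s" "flat_det ?s x1 \<noteq> 0" using m by blast
  then obtain v a b where x1': "\<And>w. w \<in> tensor_basis ?s \<Longrightarrow> x1 w = (\<Sum>i<m. rank_one (v i) (a i) (b i) w)"
    by (auto simp: rank_le_def)
  define x0 where "x0 w = (\<Sum>i<r. rank_one (v i) (a i) (b i) w)" for w
  define y where "y w = (\<Sum>i<m - r. rank_one (v (r + i)) (a (r + i)) (b (r + i)) w)" for w
  have x0S: "x0 \<in> rank_le r ?s" unfolding rank_le_def
    by (intro CollectI exI[of _ v] exI[of _ a] exI[of _ b]) (simp add: x0_def)
  have yS: "y \<in> rank_le (m - r) ?s" unfolding rank_le_def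
    by (intro CollectI exI[of _ "\<lambda>i. v (r + i)"] exI[of _ "\<lambda>i. a (r + i)"] exI[of _ "\<lambda>i. b (r + i)"]) (simp add: y_def)
  have split: "(\<Sum>i<r + d. F i) = (\<Sum>i<r. F i) + (\<Sum>i<d. F (r + i))" for F :: "nat \<Rightarrow> complex" and d
    by (induction d) (simp_all add: add.assoc)
  have "x1 w = x0 w + y w" if "w \<in> tensor_basis ?s" for w
    using split[of "\<lambda>i. rank_one (v i) (a i) (b i) w" "m - r"] rm that by (simp add: x1' x0_def y_def)
  then have Dx0: "flat_det ?s (\<lambda>w. x0 w + y w) \<noteq> 0" using flat_det_cong[of ?s x1 "\<lambda>w. x0 w + y w"] x1(2) by simp
  define M where "M = psubst (Poly_Mapping.single 0) (\<lambda>w. pvar w + Cst (y w)) (flat_det ?s pvar)"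
  have evM: "peval z M = flat_det ?s (\<lambda>w. z w + y w)" for z
  proof -
    have "peval z (psubst (Poly_Mapping.single 0) (\<lambda>w. pvar w + Cst (y w)) g) = peval (\<lambda>w. z w + y w) g" for g
      by (rule hom_eqI[where \<phi> = "\<lambda>g. peval z (psubst (Poly_Mapping.single 0) (\<lambda>w. pvar w + Cst (y w)) g)"],
          rule comp_hom[OF peval_hom psubst_hom[OF Cst_hom]], rule peval_hom)
        (simp_all add: psubst_Cst[OF Cst_hom] psubst_pvar[OF Cst_hom] peval_simps)
    then show ?thesis by (simp add: M_def peval_flat_det)
  qed
  have "peval z (f * M) = 0" if z: "z \<in> rank_le r ?s" for z
  proof (cases "peval z M = 0")
    case False
    have low: "k = r" if "restrict_coords ?s z \<in> rank_le k ?s" "k \<le> r" for k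
    proof (rule ccontr)
      assume "k \<noteq> r"
      have "z \<in> rank_le k ?s" by (rule rank_le_cong[OF that(1)]) (simp add: restrict_coords_def)
      then have "(\<lambda>w. z w + y w) \<in> rank_le (k + (m - r)) ?s" using yS by (rule rank_le_add)
      then have "flat_det ?s (\<lambda>w. z w + y w) = 0" by (rule min) (use \<open>k \<noteq> r\<close> that(2) rm in simp)
      then show False using False by (simp add: evM)
    qed
    obtain k where k: "k \<le> r" "is_sum_of ?X k (restrict_coords ?s z)" using rank_le_is_sum_of[OF z] by blast
    then have "k = r" using low is_sum_of_rank_le by blast
    have "has_rank ?X r (restrict_coords ?s z)" unfolding has_rank_def
    proof (intro conjI allI impI notI)
      show "is_sum_of ?X r (restrict_coords ?s z)" using k \<open>k = r\<close> by simp
      fix r' assume "r' < r" "is_sum_of ?X r' (restrict_coords ?s z)"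
      then show False using low[OF is_sum_of_rank_le, of r'] by simp
    qed
    moreover have "restrict_coords ?s z \<noteq> (\<lambda>_. 0)"
    proof
      assume "restrict_coords ?s z = (\<lambda>_. 0)"
      then have "restrict_coords ?s z \<in> rank_le 0 ?s" using zero_in_rank_le by simp
      then show False using low[of 0] r by simp
    qed
    ultimately have "peval (restrict_coords ?s z) f = 0" using restrict_coords_in_coord_space by (intro van) auto
    moreover have "peval (restrict_coords ?s z) f = peval z f" by (rule peval_cong[OF f]) (simp add: restrict_coords_def)
    ultimately show ?thesis by (simp add: peval_simps)
  qed (simp add: peval_simps)
  from rank_le_prime[OF this] have "(\<forall>x\<in>rank_le r ?s. peval x f = 0) \<or> (\<forall>x\<in>rank_le r ?s. peval x M = 0)" .
  then show ?thesis using x x0S Dx0 evM by auto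
qed

section \<open>The secant hypersurface\<close>

lemma poly_ring_simps [simp]:
  "carrier (poly_ring B) = {f. in_vars B f}" "monoid.mult (poly_ring B) = (*)" "add (poly_ring B) = (+)"
  "one (poly_ring B) = 1" "zero (poly_ring B) = 0"
  by (simp_all add: poly_ring_def in_vars_def)

lemma poly_ring_cring: "cring (poly_ring B)"
proof (rule cringI)
  show "abelian_group (poly_ring B)"
  proof (rule abelian_groupI)
    fix f assume "f \<in> carrier (poly_ring B)"
    then show "\<exists>g\<in>carrier (poly_ring B). g \<oplus>\<^bsub>poly_ring B\<^esub> f = \<zero>\<^bsub>poly_ring B\<^esub>"
      by (intro bexI[of _ "- f"]) (auto intro: in_vars_uminus)
  qed (auto intro: in_vars_add simp: add_ac)
  show "comm_monoid (poly_ring B)"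
    by (rule comm_monoidI) (auto intro: in_vars_mult simp: mult_ac)
qed (simp add: algebra_simps)

text \<open>A quotient of polynomials in the variables \<open>B\<close> can be taken in these variables: put the
  other variables equal to 0.\<close>

lemma quotient_in_vars:
  fixes f D :: "'v::linorder cpoly"
  assumes "in_vars B f" "in_vars B D" "D \<noteq> 0" "D dvd f"
  obtains w where "in_vars B w" "f = D * w"
proof -
  obtain w0 where w0: "f = D * w0" using assms(4) by (rule dvdE)
  let ?h = "\<lambda>v. if v \<in> B then pvar v else 0"
  define w where "w = psubst (Poly_Mapping.single 0) ?h w0"
  have ev: "peval x (psubst (Poly_Mapping.single 0) ?h g) = peval (\<lambda>v. if v \<in> B then x v else 0) g" for x g
    by (rule hom_eqI[where \<phi> = "\<lambda>g. peval x (psubst (Poly_Mapping.single 0) ?h g)"],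
        rule comp_hom[OF peval_hom psubst_hom[OF Cst_hom]], rule peval_hom)
      (simp_all add: psubst_Cst[OF Cst_hom] psubst_pvar[OF Cst_hom])
  have "f = D * w"
  proof (rule peval_eqI)
    fix x :: "'v \<Rightarrow> complex"
    let ?x = "\<lambda>v. if v \<in> B then x v else 0"
    have "peval x f = peval ?x f" by (rule peval_cong[OF assms(1)]) simp
    also have "\<dots> = peval ?x D * peval ?x w0" by (simp only: w0 peval.hom_mult)
    also have "peval ?x D = peval x D" by (rule peval_cong[OF assms(2)]) simp
    also have "peval ?x w0 = peval x w" by (simp only: w_def ev)
    finally show "peval x f = peval x (D * w)" by (simp only: peval.hom_mult)
  qed
  moreover have "in_vars B w" unfolding w_def
    by (rule psubst_closed[where B = UNIV and P = "in_vars B"])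
      (auto intro: in_vars_add in_vars_mult in_vars_pvar simp: in_vars_def[of UNIV])
  ultimately show thesis by (rule that[rotated])
qed

theorem theorem5p3:
  fixes l :: nat
  assumes "l \<ge> 1"
  shows
    "let B = segre_grassmann_basis 2 1 (4 * l + 2);
         \<sigma> = secant_variety B (3 * l + 2) (segre_grassmann 2 1 (4 * l + 2));
         d = det (exterior_flattening (4 * l + 3) pvar)
     in zariski_irreducible B \<sigma> \<and> hypersurface B \<sigma> \<and>
        primeideal (homogeneous_ideal B \<sigma>) (poly_ring B) \<and>
        homogeneous_ideal B \<sigma> = Idl\<^bsub>poly_ring B\<^esub> {d}"
proof -
  define n where "n = 4 * l + 2"
  define s where "s = 4 * l + 3"
  define r where "r = 3 * l + 2"
  have sn: "s = Suc n" by (simp add: s_def n_def)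
  define X where "X = segre_grassmann 2 1 n"
  define B where "B = tensor_basis s"
  define D :: "(nat \<times> nat list) cpoly" where "D = flat_det s pvar"
  define R where "R = {proj_point p | p. p \<in> coord_space B - {\<lambda>_. 0} \<and> has_rank X r p}"
  interpret poly_ring: cring "poly_ring B" by (rule poly_ring_cring)

  have D_B: "in_vars B D" unfolding B_def D_def by (rule flat_det_in_vars)
  have D_hom: "homogeneous_of_degree (3 * s) D" unfolding D_def by (rule flat_det_homogeneous)
  have D0: "D \<noteq> 0"
    using flat_det_sparse_tensor[of "\<lambda>j. j" s l False] peval_flat_det[of _ s] unfolding D_def s_def
    by (metis peval.hom_zero)
  have D_secS: "peval x D = 0" if "x \<in> rank_le r s" for x
    using flat_det_rank_le[OF that] unfolding D_def peval_flat_det by (simp add: r_def s_def)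

  have dvd_secS: "D dvd f" if "\<And>x. x \<in> rank_le r s \<Longrightarrow> peval x f = 0" for f
    unfolding D_def using assms s_def r_def that by (rule flat_det_dvd)
  have dvd_R: "D dvd f" if f: "in_vars B f" "\<And>P. P \<in> R \<Longrightarrow> vanishes_at f P" for f
  proof (rule dvd_secS)
    fix x assume x: "x \<in> rank_le r s"
    show "peval x f = 0"
    proof (rule vanishes_on_rank_le[OF assms n_def r_def])
      show "in_vars (tensor_basis (Suc n)) f" using f(1) by (simp add: B_def sn)
      show "x \<in> rank_le r (Suc n)" using x by (simp add: sn)
      fix p assume p: "p \<in> coord_space (tensor_basis (Suc n)) - {\<lambda>_. 0}" "has_rank (segre_grassmann 2 1 n) r p"
      then have "proj_point p \<in> R" unfolding R_def X_def B_def sn by blast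
      then show "peval p f = 0" using f(2) proj_point_self unfolding vanishes_at_def by blast
    qed
  qed

  have locus: "zariski_closure B R = zero_locus B {D}"
    unfolding zariski_closure_def
  proof (rule hull_unique)
    show "R \<subseteq> zero_locus B {D}"
    proof
      fix P assume "P \<in> R"
      then obtain p where p: "P = proj_point p" "p \<in> coord_space B - {\<lambda>_. 0}" "has_rank X r p"
        unfolding R_def by blast
      have "p \<in> rank_le r s"
        using p(3) is_sum_of_rank_le unfolding has_rank_def X_def sn by blast
      then have "vanishes_at D P" unfolding vanishes_at_def p(1) proj_point_def
        using D_secS[OF rank_le_scale] by blast
      then show "P \<in> zero_locus B {D}" using p unfolding zero_locus_def proj_space_def by blast
    qed
    have "D \<in> homogeneous_polys B" using D_B D_hom
      unfolding homogeneous_polys_def by auto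
    then show "zariski_closed B (zero_locus B {D})" unfolding zariski_closed_def by blast
    fix Z assume Z: "R \<subseteq> Z" "zariski_closed B Z"
    then obtain S where S: "S \<subseteq> homogeneous_polys B" "Z = zero_locus B S"
      unfolding zariski_closed_def by blast
    have "vanishes_at f P" if "f \<in> S" "P \<in> zero_locus B {D}" for f P
    proof -
      have "D dvd f"
        by (rule dvd_R) (use S Z(1) that(1) in \<open>auto simp: homogeneous_polys_def zero_locus_def\<close>)
      then obtain w where "f = D * w" by (rule dvdE)
      then show ?thesis using that(2) by (simp add: vanishes_at_def zero_locus_def peval_simps)
    qed
    then show "zero_locus B {D} \<subseteq> Z" unfolding S(2) by (auto simp: zero_locus_def)
  qed

  have R_sub: "R \<subseteq> zero_locus B {D}"
    unfolding locus[symmetric] zariski_closure_def by (rule hull_subset)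

  have Idl_D: "Idl\<^bsub>poly_ring B\<^esub> {D} = {f. in_vars B f \<and> D dvd f}"
  proof -
    have "Idl\<^bsub>poly_ring B\<^esub> {D} = {w * D | w. in_vars B w}"
      using poly_ring.cgenideal_eq_genideal[of D] D_B by (simp add: cgenideal_def)
    also have "\<dots> = {f. in_vars B f \<and> D dvd f}"
    proof (intro equalityI subsetI)
      fix f assume "f \<in> {f. in_vars B f \<and> D dvd f}"
      then obtain w where "in_vars B w" "f = D * w" using quotient_in_vars[OF _ D_B D0] by blast
      then show "f \<in> {w * D | w. in_vars B w}" by (auto simp: mult.commute)
    qed (use D_B in \<open>auto intro: in_vars_mult\<close>)
    finally show ?thesis .
  qed
  have D_ideal: "ideal (Idl\<^bsub>poly_ring B\<^esub> {D}) (poly_ring B)"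
    by (rule poly_ring.genideal_ideal) (simp add: D_B)

  have ideal_eq: "homogeneous_ideal B (zero_locus B {D}) = Idl\<^bsub>poly_ring B\<^esub> {D}"
    unfolding homogeneous_ideal_def
  proof (rule equalityI)
    let ?G = "{f \<in> homogeneous_polys B. \<forall>P\<in>zero_locus B {D}. vanishes_at f P}"
    have "?G \<subseteq> Idl\<^bsub>poly_ring B\<^esub> {D}"
    proof
      fix f assume f: "f \<in> ?G"
      then have "in_vars B f" by (simp add: homogeneous_polys_def)
      moreover from this have "D dvd f" by (rule dvd_R) (use f R_sub in blast)
      ultimately show "f \<in> Idl\<^bsub>poly_ring B\<^esub> {D}" by (simp add: Idl_D)
    qed
    then show "Idl\<^bsub>poly_ring B\<^esub> ?G \<subseteq> Idl\<^bsub>poly_ring B\<^esub> {D}"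
      by (rule poly_ring.genideal_minimal[OF D_ideal])
    have "D \<in> ?G" using D_B D_hom
      by (auto simp: homogeneous_polys_def zero_locus_def)
    moreover have G: "?G \<subseteq> carrier (poly_ring B)" by (auto simp: homogeneous_polys_def)
    ultimately have "{D} \<subseteq> Idl\<^bsub>poly_ring B\<^esub> ?G" using poly_ring.genideal_self[OF G] by blast
    then show "Idl\<^bsub>poly_ring B\<^esub> {D} \<subseteq> Idl\<^bsub>poly_ring B\<^esub> ?G"
      by (rule poly_ring.genideal_minimal[OF poly_ring.genideal_ideal[OF G]])
  qed

  have prime: "primeideal (Idl\<^bsub>poly_ring B\<^esub> {D}) (poly_ring B)"
  proof (rule primeidealI[OF D_ideal poly_ring_cring])
    have "\<not> D dvd 1"
    proof
      assume "D dvd 1"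
      then obtain w where "1 = D * w" by (rule dvdE)
      from arg_cong[OF this, of "peval (\<lambda>_. 0)"] show False
        using D_secS[OF zero_in_rank_le] by (simp add: peval.hom_mult)
    qed
    then have "1 \<notin> Idl\<^bsub>poly_ring B\<^esub> {D}" by (simp add: Idl_D)
    then show "carrier (poly_ring B) \<noteq> Idl\<^bsub>poly_ring B\<^esub> {D}" by auto
  next
    fix f g assume fg: "f \<in> carrier (poly_ring B)" "g \<in> carrier (poly_ring B)"
      "f \<otimes>\<^bsub>poly_ring B\<^esub> g \<in> Idl\<^bsub>poly_ring B\<^esub> {D}"
    then have "D dvd f * g" by (simp add: Idl_D)
    then obtain w where "f * g = D * w" by (rule dvdE)
    then have "(\<forall>x\<in>rank_le r s. peval x f = 0) \<or> (\<forall>x\<in>rank_le r s. peval x g = 0)"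
      by (intro rank_le_prime) (simp only: peval.hom_mult D_secS mult_zero_left)
    then show "f \<in> Idl\<^bsub>poly_ring B\<^esub> {D} \<or> g \<in> Idl\<^bsub>poly_ring B\<^esub> {D}"
      using fg(1,2) dvd_secS by (auto simp: Idl_D)
  qed

  have hyper: "hypersurface B (zero_locus B {D})" unfolding hypersurface_def
  proof (intro bexI exI conjI)
    show "0 < 3 * s" by (simp add: s_def)
  qed (use D0 D_hom D_B in auto)

  have irred: "zariski_irreducible B (zero_locus B {D})"
  proof -
    \<comment> \<open>A point of rank at most \<open>r\<close> at which this coordinate is nonzero has a restriction to the
      basis that represents a point of projective space.\<close>
    let ?w = "(0, [0, 1]) :: nat \<times> nat list"
    let ?e = "rank_one (unit_dir 0) (unit_dir 0) (unit_dir 1)"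
    have wB: "?w \<in> B" by (simp add: B_def tensor_basis_def s_def)
    have e: "?e \<in> rank_le r s" by (rule rank_le_mono[OF rank_one_in_rank_le]) (simp add: r_def)
    have we: "peval ?e (pvar ?w) \<noteq> 0" by (simp add: rank_one_def unit_dir_def)
    have pt: "proj_point (restrict_coords s x) \<in> zero_locus B {D}" if x: "x \<in> rank_le r s" "peval x (pvar ?w) \<noteq> 0" for x
    proof -
      have "restrict_coords s x ?w \<noteq> 0" using x(2) wB by (simp add: restrict_coords_def B_def)
      then have "restrict_coords s x \<noteq> (\<lambda>_. 0)" by (auto dest: fun_cong[of _ _ ?w])
      moreover have "restrict_coords s x \<in> coord_space B" unfolding B_def by (rule restrict_coords_in_coord_space)
      moreover have "restrict_coords s x \<in> rank_le r s" by (rule rank_le_cong[OF x(1)]) (simp add: restrict_coords_def)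
      then have "vanishes_at D (proj_point (restrict_coords s x))" unfolding vanishes_at_def proj_point_def
        using D_secS[OF rank_le_scale] by blast
      ultimately show ?thesis unfolding zero_locus_def proj_space_def by blast
    qed
    have out: "\<exists>f. in_vars B f \<and> (\<forall>P\<in>Z. vanishes_at f P) \<and> (\<exists>x\<in>rank_le r s. peval x f \<noteq> 0)"
      if Z: "zariski_closed B Z" "\<not> zero_locus B {D} \<subseteq> Z" for Z
    proof -
      obtain S where S: "S \<subseteq> homogeneous_polys B" "Z = zero_locus B S"
        using Z(1) unfolding zariski_closed_def by blast
      obtain P where P: "P \<in> zero_locus B {D}" "P \<notin> Z" using Z(2) by blast
      have "P \<in> proj_space B" using P(1) by (simp add: zero_locus_def)
      then obtain f where "f \<in> S" "\<not> vanishes_at f P" using P(2) S(2) by (auto simp: zero_locus_def)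
      note Pf = P(1) this
      have "\<not> D dvd f"
      proof
        assume "D dvd f"
        then obtain w where "f = D * w" by (rule dvdE)
        then show False using Pf(1,3) by (simp add: vanishes_at_def zero_locus_def peval_simps)
      qed
      then have "\<exists>x\<in>rank_le r s. peval x f \<noteq> 0" using dvd_secS by blast
      moreover have "in_vars B f" using S(1) Pf(2) by (auto simp: homogeneous_polys_def)
      moreover have "\<forall>P\<in>Z. vanishes_at f P" using S(2) Pf(2) by (simp add: zero_locus_def)
      ultimately show ?thesis by blast
    qed
    show ?thesis unfolding zariski_irreducible_def
    proof (intro conjI allI impI)
      show "zero_locus B {D} \<noteq> {}" using pt[OF e we] by blast
      fix Z1 Z2 assume Z: "zariski_closed B Z1 \<and> zariski_closed B Z2 \<and> zero_locus B {D} \<subseteq> Z1 \<union> Z2"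
      show "zero_locus B {D} \<subseteq> Z1 \<or> zero_locus B {D} \<subseteq> Z2"
      proof (rule ccontr)
        assume neg: "\<not> ?thesis"
        obtain f where f: "in_vars B f" "\<forall>P\<in>Z1. vanishes_at f P" "\<exists>x\<in>rank_le r s. peval x f \<noteq> 0"
          using out[of Z1] Z neg by blast
        obtain g where g: "in_vars B g" "\<forall>P\<in>Z2. vanishes_at g P" "\<exists>x\<in>rank_le r s. peval x g \<noteq> 0"
          using out[of Z2] Z neg by blast
        have "\<exists>x\<in>rank_le r s. peval x (f * g) \<noteq> 0" using rank_le_prime[of r s f g] f(3) g(3) by blast
        then obtain x where x: "x \<in> rank_le r s" "peval x (f * g * pvar ?w) \<noteq> 0"
          using rank_le_prime[of r s "f * g" "pvar ?w"] e we by blast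
        then have nz: "peval x f \<noteq> 0" "peval x g \<noteq> 0" "peval x (pvar ?w) \<noteq> 0"
          by (simp_all add: peval_simps)
        let ?P = "proj_point (restrict_coords s x)"
        have nv: "\<not> vanishes_at h ?P" if "in_vars B h" "peval x h \<noteq> 0" for h
        proof -
          have "peval (restrict_coords s x) h = peval x h"
            by (rule peval_cong[OF that(1)]) (simp add: restrict_coords_def B_def)
          with that(2) have "peval (restrict_coords s x) h \<noteq> 0" by simp
          then show ?thesis using proj_point_self unfolding vanishes_at_def by blast
        qed
        have "\<not> vanishes_at f ?P" "\<not> vanishes_at g ?P"
          using nv f(1) g(1) nz(1,2) by blast+
        then show False using pt[OF x(1) nz(3)] Z f(2) g(2) by blast
      qed
    qed
  qed

  have "secant_variety B r X = zero_locus B {D}"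
    unfolding secant_variety_def locus[symmetric] R_def ..
  moreover have "segre_grassmann_basis 2 1 (4 * l + 2) = B"
    unfolding segre_grassmann_basis_eq B_def by (rule arg_cong[of _ _ tensor_basis]) (simp add: s_def)
  moreover have "det (exterior_flattening (4 * l + 3) pvar) = D"
    by (simp add: D_def flat_det_def s_def)
  ultimately show ?thesis
    using irred hyper prime ideal_eq
    by (simp only: Let_def X_def r_def n_def)
qed

end
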